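(* Let $G$ be a finite group and let $G\wr R_n$ be the wreath product of the rook monoid $R_n$ with $G$. Then, for fixed $G$ and $n\to\infty$, the Fourier transform of an arbitrary $\mathbb{C}$-valued function on $G\wr R_n$ may be computed in $O(|G\wr R_n|\log^4|G\wr R_n|)$ operations; that is, \[ \mathcal{C}(G\wr R_n)=O(|G\wr R_n|\log^4|G\wr R_n|). \]
   Context: The rook wreath product $G\wr R_n$ is the (inverse) semigroup of all $n\times n$ matrices with entries in $\{0\}\cup G$ having at most one nonzero entry in each row and each column, under matrix multiplication (with $0\cdot g=g\cdot 0=0$, $0+g=g+0=g$). For a finite inverse semigroup $S$, $\mathbb{C}S$ is the complex semigroup algebra with basis $\{s\}_{s\in S}$; a function $f:S\to\mathbb{C}$ is identified with $\sum_{s\in S}f(s)s$. A representation of $\mathbb{C}S$ of dimension $d_\rho$ is an algebra homomorphism $\rho:\mathbb{C}S\to M_{d_\rho}(\mathbb{C})$; it is irreducible if it is nonzero and simple as a left $\mathbb{C}S$-module; two representations are equivalent if they are conjugate by an invertible matrix. A complete set $\mathcal{Y}$ of inequivalent irreducible representations contains exactly one representation from each equivalence class of irreducible representations. The Fourier transform of $f$ relative to $\mathcal{Y}$ is $\bigoplus_{\rho\in\mathcal{Y}}\sum_{s\in S}f(s)\rho(s)\in\bigoplus_{\rho\in\mathcal{Y}}M_{d_\rho}(\mathbb{C})$. Complexity: an operation is a complex multiplication followed by a complex addition, i.e. the computation of $uv+z$ where each of $u,v,z$ is an input, a constant (such as an entry of a precomputed representation matrix), or the result of an earlier operation. Only operations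 are counted: copying, storing and rearranging numbers is free. $\mathcal{T}_{\mathcal{Y}}(S)$ is the maximum number of operations needed to compute the Fourier transform relative to $\mathcal{Y}$ of an arbitrary $f=\sum_{s}f(s)s$ (given by its values $f(s)$), all representations in $\mathcal{Y}$ being precomputed and stored, and $\mathcal{C}(S)=\min_{\mathcal{Y}}\mathcal{T}_{\mathcal{Y}}(S)$ over all complete sets $\mathcal{Y}$ of inequivalent irreducible representations of $\mathbb{C}S$. *)

theory Defs
  imports
    "HOL-Algebra.Group"
    "HOL-Library.Extended_Nat"
    "HOL-Library.Landau_Symbols"
    "Jordan_Normal_Form.Matrix"
begin

section \<open>The rook wreath product\<close>

text \<open>The set {0} together with G is modelled by the option type: None is the extra zero and
  Some g is the group element g.\<close>

fun zmult :: "('a, 'b) monoid_scheme \<Rightarrow> 'a option \<Rightarrow> 'a option \<Rightarrow> 'a option" where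
  "zmult G (Some g) (Some h) = Some (g \<otimes>\<^bsub>G\<^esub> h)"
| "zmult G None y = None"
| "zmult G x None = None"

text \<open>The sum of two group elements is left unspecified: it never occurs when matrices with at
  most one nonzero entry in each row and column are multiplied.\<close>

fun zadd :: "'a option \<Rightarrow> 'a option \<Rightarrow> 'a option" where
  "zadd None y = y"
| "zadd (Some g) None = Some g"
| "zadd (Some g) (Some h) = undefined"

primrec zsum :: "nat \<Rightarrow> (nat \<Rightarrow> 'a option) \<Rightarrow> 'a option" where
  "zsum 0 x = None"
| "zsum (Suc n) x = zadd (zsum n x) (x n)"

definition rook_wreath :: "('a, 'b) monoid_scheme \<Rightarrow> nat \<Rightarrow> 'a option mat monoid" where
  "rook_wreath G n =
    \<lparr>carrier = {A \<in> carrier_mat n n.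
        (\<forall>i<n. \<forall>j<n. A $$ (i, j) \<in> {None} \<union> Some ` carrier G) \<and>
        (\<forall>i<n. \<forall>j<n. \<forall>k<n. A $$ (i, j) \<noteq> None \<and> A $$ (i, k) \<noteq> None \<longrightarrow> j = k) \<and>
        (\<forall>i<n. \<forall>j<n. \<forall>k<n. A $$ (j, i) \<noteq> None \<and> A $$ (k, i) \<noteq> None \<longrightarrow> j = k)},
     monoid.mult = (\<lambda>A B. mat n n (\<lambda>(i, j). zsum n (\<lambda>k. zmult G (A $$ (i, k)) (B $$ (k, j))))),
     one = mat n n (\<lambda>(i, j). if i = j then Some \<one>\<^bsub>G\<^esub> else None)\<rparr>"


section \<open>Semigroup algebras and their representations\<close>

text \<open>Everything from here on uses only the carrier and the multiplication of the record S, so it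
  is meaningful for finite semigroups; the unit field is never consulted.\<close>

definition semigroup_algebra :: "('s, 'b) monoid_scheme \<Rightarrow> ('s \<Rightarrow> complex) set" where
  "semigroup_algebra S = {f. \<forall>s. s \<notin> carrier S \<longrightarrow> f s = 0}"

definition basis_elem :: "'s \<Rightarrow> 's \<Rightarrow> complex" where
  "basis_elem s = (\<lambda>t. if t = s then 1 else 0)"

definition convolve ::
  "('s, 'b) monoid_scheme \<Rightarrow> ('s \<Rightarrow> complex) \<Rightarrow> ('s \<Rightarrow> complex) \<Rightarrow> 's \<Rightarrow> complex" where
  "convolve S f g =
    (\<lambda>u. \<Sum>(s, t) \<in> {(s, t). s \<in> carrier S \<and> t \<in> carrier S \<and> s \<otimes>\<^bsub>S\<^esub> t = u}. f s * g t)"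

text \<open>A dimension together with a map into the square matrices of that dimension.  The values of
  the map outside the semigroup algebra are irrelevant.\<close>

type_synonym 's rep = "nat \<times> (('s \<Rightarrow> complex) \<Rightarrow> complex mat)"

definition representation :: "('s, 'b) monoid_scheme \<Rightarrow> 's rep \<Rightarrow> bool" where
  "representation S = (\<lambda>(d, \<rho>).
    (\<forall>f \<in> semigroup_algebra S. \<rho> f \<in> carrier_mat d d) \<and>
    (\<forall>f \<in> semigroup_algebra S. \<forall>g \<in> semigroup_algebra S. \<rho> (\<lambda>s. f s + g s) = \<rho> f + \<rho> g) \<and>
    (\<forall>c. \<forall>f \<in> semigroup_algebra S. \<rho> (\<lambda>s. c * f s) = c \<cdot>\<^sub>m \<rho> f) \<and>
    (\<forall>f \<in> semigroup_algebra S. \<forall>g \<in> semigroup_algebra S. \<rho> (convolve S f g) = \<rho> f * \<rho> g))"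

definition invariant_subspace :: "('s, 'b) monoid_scheme \<Rightarrow> 's rep \<Rightarrow> complex vec set \<Rightarrow> bool" where
  "invariant_subspace S = (\<lambda>(d, \<rho>) W.
    W \<subseteq> carrier_vec d \<and> 0\<^sub>v d \<in> W \<and>
    (\<forall>v \<in> W. \<forall>w \<in> W. v + w \<in> W) \<and>
    (\<forall>c. \<forall>v \<in> W. c \<cdot>\<^sub>v v \<in> W) \<and>
    (\<forall>f \<in> semigroup_algebra S. \<forall>v \<in> W. \<rho> f *\<^sub>v v \<in> W))"

definition irreducible_rep :: "('s, 'b) monoid_scheme \<Rightarrow> 's rep \<Rightarrow> bool" where
  "irreducible_rep S = (\<lambda>(d, \<rho>).
    representation S (d, \<rho>) \<and>
    (\<exists>f \<in> semigroup_algebra S. \<rho> f \<noteq> 0\<^sub>m d d) \<and>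
    (\<forall>W. invariant_subspace S (d, \<rho>) W \<longrightarrow> W = {0\<^sub>v d} \<or> W = carrier_vec d))"

text \<open>One matrix P, with inverse Q, has to conjugate all values simultaneously.\<close>

definition equivalent_reps :: "('s, 'b) monoid_scheme \<Rightarrow> 's rep \<Rightarrow> 's rep \<Rightarrow> bool" where
  "equivalent_reps S = (\<lambda>(d, \<rho>) (e, \<sigma>).
    d = e \<and> (\<exists>P Q. \<forall>f \<in> semigroup_algebra S. similar_mat_wit (\<rho> f) (\<sigma> f) P Q))"

definition complete_irreps :: "('s, 'b) monoid_scheme \<Rightarrow> 's rep set \<Rightarrow> bool" where
  "complete_irreps S Y \<longleftrightarrow>
    (\<forall>r \<in> Y. irreducible_rep S r) \<and>
    (\<forall>r. irreducible_rep S r \<longrightarrow> (\<exists>!r'. r' \<in> Y \<and> equivalent_reps S r r'))"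

text \<open>The Fourier transform relative to Y is the family of the following matrices, for (d, \<rho>) in Y.\<close>

definition fourier :: "('s, 'b) monoid_scheme \<Rightarrow> ('s \<Rightarrow> complex) \<Rightarrow> 's rep \<Rightarrow> complex mat" where
  "fourier S f = (\<lambda>(d, \<rho>).
    mat d d (\<lambda>(i, j). \<Sum>s \<in> carrier S. f s * \<rho> (basis_elem s) $$ (i, j)))"


section \<open>Arithmetic complexity\<close>

text \<open>An algorithm is a straight-line program: a list of instructions (u, v, z), each denoting the
  single operation u * v + z.  Result k refers to the outcome of instruction number k, counting
  from 0.  The program does not depend on f, so its length is the number of operations it
  performs on every input.\<close>

datatype 's operand = Input 's | Const complex | Result nat

type_synonym 's program = "('s operand \<times> 's operand \<times> 's operand) list"

primrec operand_value :: "('s \<Rightarrow> complex) \<Rightarrow> complex list \<Rightarrow> 's operand \<Rightarrow> complex" where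
  "operand_value f rs (Input s) = f s"
| "operand_value f rs (Const c) = c"
| "operand_value f rs (Result k) = rs ! k"

definition run :: "('s \<Rightarrow> complex) \<Rightarrow> 's program \<Rightarrow> complex list" where
  "run f p = foldl (\<lambda>rs (u, v, z).
      rs @ [operand_value f rs u * operand_value f rs v + operand_value f rs z]) [] p"

text \<open>Operands that may be used once m operations have been carried out.\<close>

primrec available :: "('s, 'b) monoid_scheme \<Rightarrow> nat \<Rightarrow> 's operand \<Rightarrow> bool" where
  "available S m (Input s) \<longleftrightarrow> s \<in> carrier S"
| "available S m (Const c) \<longleftrightarrow> True"
| "available S m (Result k) \<longleftrightarrow> k < m"

definition valid_program :: "('s, 'b) monoid_scheme \<Rightarrow> 's program \<Rightarrow> bool" where
  "valid_program S p \<longleftrightarrow>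
    (\<forall>i < length p. case p ! i of (u, v, z) \<Rightarrow>
      available S i u \<and> available S i v \<and> available S i z)"

text \<open>Copying is free, so an output may be any operand available at the end.\<close>

definition computes_fourier :: "('s, 'b) monoid_scheme \<Rightarrow> 's rep set \<Rightarrow> 's program \<Rightarrow> bool" where
  "computes_fourier S Y p \<longleftrightarrow> valid_program S p \<and>
    (\<exists>out. \<forall>(d, \<rho>) \<in> Y. \<forall>i<d. \<forall>j<d.
      available S (length p) (out (d, \<rho>) i j) \<and>
      (\<forall>f \<in> semigroup_algebra S.
        operand_value f (run f p) (out (d, \<rho>) i j) = fourier S f (d, \<rho>) $$ (i, j)))"

text \<open>The infima are taken in the extended naturals, so the value would be infinite, and not 0,
  if there were nothing to minimise over; infima of nonempty sets are attained.\<close>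

definition fourier_complexity_wrt :: "('s, 'b) monoid_scheme \<Rightarrow> 's rep set \<Rightarrow> enat" where
  "fourier_complexity_wrt S Y = (INF p \<in> {p. computes_fourier S Y p}. enat (length p))"

definition fourier_complexity :: "('s, 'b) monoid_scheme \<Rightarrow> enat" where
  "fourier_complexity S = (INF Y \<in> {Y. complete_irreps S Y}. fourier_complexity_wrt S Y)"

end

theory Submission
  imports
    Defs
    "HOL-Combinatorics.Permutations"
    "HOL-Library.Function_Algebras"
    "Jordan_Normal_Form.Spectral_Radius"
begin

text \<open>Write H(k) for the group of monomial k \<times> k matrices with entries in G.  An element of the rook wreath
  product is a bijection between a set J of columns and a set L of rows of the same size k, labelled by G, so its
  order is the sum over k of (n choose k)^2 |H(k)|.  An irreducible representation \<rho> vanishes on all elements of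
  rank below some k but not on all those of rank k.  It is then determined by the irreducible representation \<sigma>
  of H(k) on the range of the idempotent of rank k, and its entries at f are the entries of
  \<Sum>w\<in>H(k). fhat(L, J, w) \<sigma>(w), where fhat(L, J, w) sums f over all extensions of the rank k element (L, J, w).

  The sums fhat are computed column by column in O(n^2) operations per element.  There remain (n choose k)^2
  Fourier transforms on H(k), which together cost O(n^4) operations per element of the rook wreath product if
  each costs O(k^4 |H(k)|).  Since the order is at least 2^n, this is the claimed bound.

  For H(k), take representations whose restrictions to H(0), H(1), ... are block diagonal.  The transform is
  assembled from those on the k|G| cosets of H(k - 1), each multiplied by at most k matrices \<sigma>(x) where x
  belongs to some H(j) and commutes with H(j - 2).  By Schur's lemma the number of nonzero entries in a row
  of such a matrix is at most the multiplicity m of an irreducible representation of H(j - 2) in one of H(j), and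
  m^2 is at most the index of H(j - 2) in H(j), which is below (j|G|)^2.\<close>

section \<open>Complex matrices indexed by finite sets\<close>

text \<open>The fourth power comes from the groups alone. Passing from H(k - 1) to H(k) involves at
  most k|G| cosets, at most k letters for each, and at most k|G| operations for each letter and
  matrix entry; the entries of all irreducible representations number at most |H(k)|, because the
  squares of the degrees sum to at most the order. This is of size k^3 |H(k)|, and since |H(k)| is
  the number of cosets times |H(k - 1)|, costs per element simply add over the k levels. Coset
  representatives are split into letters because it is the letters that commute with a subgroup
  large enough for the row bound. Sums over extensions arise as follows. If k is the least rank on
  which \<rho> does not vanish, products of two different partial identities of rank k go to 0, and
  irreducibility forces their images to add up to the identity. In the resulting blocks, block (L,
  J) of \<rho>(s) sees only the restriction of s to J. Modules are replaced by rectangular matrices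
  and idempotents; comparisons of dimensions rest on the fact that an identity matrix cannot factor
  through fewer coordinates than its size.\<close>

text \<open>A matrix with rows I and columns J is a function vanishing off I \<times> J, so that matrix
  identities are plain equations between functions.\<close>

type_synonym ('i, 'j) cmat = "'i \<Rightarrow> 'j \<Rightarrow> complex"

definition mats :: "'i set \<Rightarrow> 'j set \<Rightarrow> ('i, 'j) cmat set" where
  "mats I J = {A. \<forall>i j. A i j \<noteq> 0 \<longrightarrow> i \<in> I \<and> j \<in> J}"

definition mm :: "('i, 'k) cmat \<Rightarrow> 'k set \<Rightarrow> ('k, 'j) cmat \<Rightarrow> ('i, 'j) cmat"
    ("(_ \<star>[_]/ _)" [70, 0, 71] 70) where
  "A \<star>[K] B = (\<lambda>i j. \<Sum>k\<in>K. A i k * B k j)"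

definition idm :: "'i set \<Rightarrow> ('i, 'i) cmat" where
  "idm I = (\<lambda>i j. if i = j \<and> i \<in> I then 1 else 0)"

definition sm :: "complex \<Rightarrow> ('i, 'j) cmat \<Rightarrow> ('i, 'j) cmat" where
  "sm c A = (\<lambda>i j. c * A i j)"

lemma sum_fun_eval: "(\<Sum>x\<in>X. F x) i = (\<Sum>x\<in>X. F x i)"
  by (induction X rule: infinite_finite_induct) auto

text \<open>Holds for arbitrary index sets and without support conditions, because
  \<open>sum.swap\<close> does. Long products can therefore be rebracketed freely below, and
  \<open>mats\<close> matters mainly where an identity matrix is absorbed.\<close>

lemma mm_assoc: "(A \<star>[K] B) \<star>[L] C = A \<star>[K] (B \<star>[L] C)"
  unfolding mm_def
  by (intro ext, simp add: sum_distrib_left sum_distrib_right sum.swap[of _ L] mult.assoc)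

lemma mm_diff_left: "(A - B) \<star>[K] C = A \<star>[K] C - B \<star>[K] C"
  by (intro ext) (simp add: mm_def algebra_simps sum_subtractf)

lemma mm_diff_right: "C \<star>[K] (A - B) = C \<star>[K] A - C \<star>[K] B"
  by (intro ext) (simp add: mm_def algebra_simps sum_subtractf)

lemma mm_sum_left: "(\<Sum>x\<in>X. F x) \<star>[K] C = (\<Sum>x\<in>X. F x \<star>[K] C)"
  by (intro ext) (simp add: mm_def sum_fun_eval sum_distrib_right sum.swap[of _ X])

lemma mm_sum_right: "C \<star>[K] (\<Sum>x\<in>X. F x) = (\<Sum>x\<in>X. C \<star>[K] F x)"
  by (intro ext) (simp add: mm_def sum_fun_eval sum_distrib_left sum.swap[of _ X])

lemma mm_zero [simp]: "0 \<star>[K] C = 0" "C \<star>[K] 0 = 0"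
  by (intro ext, simp add: mm_def)+

lemma mm_sm: "sm c A \<star>[K] B = sm c (A \<star>[K] B)" "A \<star>[K] sm c B = sm c (A \<star>[K] B)"
  by (intro ext, simp add: mm_def sm_def sum_distrib_left algebra_simps)+

lemma mm_idm_left:
  assumes "finite I" "A \<in> mats I J"
  shows "idm I \<star>[I] A = A"
proof (intro ext)
  fix i j
  have "(\<Sum>k\<in>I. idm I i k * A k j) = (\<Sum>k\<in>I. if k = i then A i j else 0)"
    by (intro sum.cong) (auto simp: idm_def)
  also have "\<dots> = A i j" using assms by (auto simp: sum.delta mats_def)
  finally show "(idm I \<star>[I] A) i j = A i j" by (simp add: mm_def)
qed

lemma mm_idm_right:
  assumes "finite J" "A \<in> mats I J"
  shows "A \<star>[J] idm J = A"
proof (intro ext)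
  fix i j
  have "(\<Sum>k\<in>J. A i k * idm J k j) = (\<Sum>k\<in>J. if k = j then A i j else 0)"
    by (intro sum.cong) (auto simp: idm_def)
  also have "\<dots> = A i j" using assms by (auto simp: sum.delta mats_def)
  finally show "(A \<star>[J] idm J) i j = A i j" by (simp add: mm_def)
qed

lemma mm_mats: "A \<in> mats I K \<Longrightarrow> B \<in> mats L J \<Longrightarrow> A \<star>[M] B \<in> mats I J"
  unfolding mats_def mm_def by clarsimp (metis (no_types, lifting) mult_eq_0_iff sum.neutral)

lemma zero_mats [simp]: "0 \<in> mats I J"
  by (simp add: mats_def)

lemma idm_mats [simp]: "idm I \<in> mats I I"
  by (simp add: mats_def idm_def)

lemma sm_mats: "A \<in> mats I J \<Longrightarrow> sm c A \<in> mats I J"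
  by (auto simp: mats_def sm_def)

lemma add_mats: "A \<in> mats I J \<Longrightarrow> B \<in> mats I J \<Longrightarrow> A + B \<in> mats I J"
  unfolding mats_def by clarsimp (metis add.right_neutral)

lemma diff_mats: "A \<in> mats I J \<Longrightarrow> B \<in> mats I J \<Longrightarrow> A - B \<in> mats I J"
  unfolding mats_def by clarsimp (metis diff_zero)

lemma sum_mats: "(\<And>x. x \<in> X \<Longrightarrow> F x \<in> mats I J) \<Longrightarrow> (\<Sum>x\<in>X. F x) \<in> mats I J"
  by (induction X rule: infinite_finite_induct) (auto intro: add_mats)

lemma mats_zero: "A \<in> mats I J \<Longrightarrow> i \<notin> I \<or> j \<notin> J \<Longrightarrow> A i j = 0"
  by (auto simp: mats_def)

lemma matsI: "(\<And>i j. i \<notin> I \<or> j \<notin> J \<Longrightarrow> A i j = 0) \<Longrightarrow> A \<in> mats I J"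
  by (auto simp: mats_def)

lemma mats_eqI:
  assumes "A \<in> mats I J" "B \<in> mats I J" "\<And>i j. i \<in> I \<Longrightarrow> j \<in> J \<Longrightarrow> A i j = B i j"
  shows "A = B"
  by (intro ext) (metis assms mats_zero)

text \<open>Full-rank factorisation by elimination: each round removes a rank one matrix and lowers
  the number of nonzero rows. The one-sided inverses are part of the result so that kernels and
  ranges can be handled by matrix identities.\<close>

lemma rank_factorization:
  fixes T :: "('i, 'j) cmat"
  assumes fin: "finite I" "finite J" and T: "T \<in> mats I J"
  obtains r :: nat and A A' C C'
  where "A \<in> mats I {..<r}" "A' \<in> mats {..<r} I" "C \<in> mats {..<r} J" "C' \<in> mats J {..<r}"
    "T = A \<star>[{..<r}] C" "A' \<star>[I] A = idm {..<r}" "C \<star>[J] C' = idm {..<r}"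
proof -
  have "\<exists>(r :: nat) A A' C C'. A \<in> mats I {..<r} \<and> A' \<in> mats {..<r} I \<and> C \<in> mats {..<r} J \<and>
    C' \<in> mats J {..<r} \<and> T = A \<star>[{..<r}] C \<and> A' \<star>[I] A = idm {..<r} \<and> C \<star>[J] C' = idm {..<r}"
    using T
  proof (induction "card {i \<in> I. \<exists>j. T i j \<noteq> 0}" arbitrary: T rule: less_induct)
    case less
    show ?case
    proof (cases "\<exists>p q. T p q \<noteq> 0")
      case False
      then have "T = 0" by (intro ext) auto
      then show ?thesis
        by (intro exI[of _ 0]) (auto simp: mats_def mm_def idm_def fun_eq_iff)
    next
      case True
      then obtain p q where t: "T p q \<noteq> 0" by auto
      have pq: "p \<in> I" "q \<in> J" using t less.prems by (auto simp: mats_def)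
      \<comment> \<open>Subtracting this rank one matrix clears both row p and column q; row p was
        nonzero before, so the induction measure drops.\<close>
      define T' where "T' = (\<lambda>i j. T i j - T i q * T p j / T p q)"
      have T': "T' \<in> mats I J"
        using less.prems by (intro matsI) (auto simp: T'_def mats_zero)
      have "{i \<in> I. \<exists>j. T' i j \<noteq> 0} \<subseteq> {i \<in> I. \<exists>j. T i j \<noteq> 0} - {p}"
        using t by (auto simp: T'_def) (metis diff_self div_0 mult_zero_left)
      moreover have "p \<in> {i \<in> I. \<exists>j. T i j \<noteq> 0}" using t pq by auto
      ultimately have "{i \<in> I. \<exists>j. T' i j \<noteq> 0} \<subset> {i \<in> I. \<exists>j. T i j \<noteq> 0}"
        by blast
      then have "card {i \<in> I. \<exists>j. T' i j \<noteq> 0} < card {i \<in> I. \<exists>j. T i j \<noteq> 0}"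
        by (intro psubset_card_mono) (use fin in auto)
      from less.hyps[OF this T'] obtain r :: nat and A1 A1' C1 C1' where
        A1: "A1 \<in> mats I {..<r}" and A1': "A1' \<in> mats {..<r} I"
        and C1: "C1 \<in> mats {..<r} J" and C1': "C1' \<in> mats J {..<r}"
        and T'_eq: "T' = A1 \<star>[{..<r}] C1" and AA: "A1' \<star>[I] A1 = idm {..<r}"
        and CC: "C1 \<star>[J] C1' = idm {..<r}" by blast
      \<comment> \<open>Row p of \<open>A1\<close> vanishes because \<open>A1\<close> is
        \<open>T'\<close> times \<open>C1'\<close> and row p of \<open>T'\<close> is 0; dually for
        column q of \<open>C1\<close>. These zeros keep the new column and row of the factorisation
        independent of the old ones.\<close>
      have A1p: "A1 p l = 0" for l
      proof -
        have "A1 = T' \<star>[J] C1'"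
          unfolding T'_eq mm_assoc CC using A1 by (simp add: mm_idm_right)
        moreover have "T' p j = 0" for j using t by (simp add: T'_def)
        ultimately show ?thesis by (simp add: mm_def)
      qed
      have C1q: "C1 l q = 0" for l
      proof -
        have "C1 = A1' \<star>[I] T'"
          unfolding T'_eq mm_assoc[symmetric] AA using C1 by (simp add: mm_idm_left)
        moreover have "T' i q = 0" for i using t by (simp add: T'_def)
        ultimately show ?thesis by (simp add: mm_def)
      qed
      define e where "e = (\<lambda>i. if i = p then 1 / T p q else (0::complex))"
      define g where "g = (\<lambda>j. if j = q then (1::complex) else 0)"
      define A where "A = (\<lambda>i l. if l = r then T i q else A1 i l)"
      \<comment> \<open>Row r reads off coordinate p, scaled by the pivot; the other rows are
        corrected by a multiple of it so that they annihilate the new column \<open>T i q\<close>.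
        The columns of \<open>C'\<close> are treated in the same way.\<close>
      define A' where "A' = (\<lambda>l i. if l = r then e i else A1' l i - (\<Sum>k\<in>I. A1' l k * T k q) * e i)"
      define C where "C = (\<lambda>l j. if l = r then T p j / T p q else C1 l j)"
      define C' where "C' = (\<lambda>j l. if l = r then g j else C1' j l - g j * (\<Sum>k\<in>J. T p k / T p q * C1' k l))"
      have esum: "(\<Sum>i\<in>I. e i * x i) = x p / T p q" for x
        using pq fin by (simp add: e_def if_distrib[of "\<lambda>y. y * _"] sum.delta cong: if_cong)
      have gsum: "(\<Sum>j\<in>J. x j * g j) = x q" for x
        using pq fin by (simp add: g_def if_distrib[of "\<lambda>y. _ * y"] sum.delta cong: if_cong)
      have m1: "A \<in> mats I {..<Suc r}"
        using A1 less.prems by (auto simp: A_def mats_def less_Suc_eq split: if_splits)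
      have m2: "A' \<in> mats {..<Suc r} I"
        using A1' pq by (intro matsI) (auto simp: A'_def e_def mats_zero)
      have m3: "C \<in> mats {..<Suc r} J"
        using C1 less.prems by (auto simp: C_def mats_def less_Suc_eq split: if_splits)
      have m4: "C' \<in> mats J {..<Suc r}"
        using C1' pq by (intro matsI) (auto simp: C'_def g_def mats_zero)
      have m5: "T = A \<star>[{..<Suc r}] C"
      proof (intro ext)
        fix i j
        have "(A \<star>[{..<Suc r}] C) i j = (\<Sum>k<r. A1 i k * C1 k j) + T i q * T p j / T p q"
          by (simp add: mm_def A_def C_def)
        also have "(\<Sum>k<r. A1 i k * C1 k j) = T' i j" by (simp add: T'_eq mm_def)
        finally show "T i j = (A \<star>[{..<Suc r}] C) i j" by (simp add: T'_def)
      qed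
      have AA_eval: "(\<Sum>i\<in>I. A1' l i * A1 i m) = idm {..<r} l m" for l m
        using AA by (auto simp: mm_def fun_eq_iff)
      have CC_eval: "(\<Sum>i\<in>J. C1 l i * C1' i m) = idm {..<r} l m" for l m
        using CC by (auto simp: mm_def fun_eq_iff)
      have m6: "A' \<star>[I] A = idm {..<Suc r}"
      proof (rule mats_eqI)
        show "A' \<star>[I] A \<in> mats {..<Suc r} {..<Suc r}" using mm_mats[OF m2 m1] .
        fix l m assume "l \<in> {..<Suc r}" "m \<in> {..<Suc r}"
        have "(\<Sum>i\<in>I. (A1' l i - c * e i) * x i) = (\<Sum>i\<in>I. A1' l i * x i) - c * (x p / T p q)" for c x
          by (simp add: left_diff_distrib sum_subtractf mult.assoc sum_distrib_left[symmetric] esum)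
        then show "(A' \<star>[I] A) l m = idm {..<Suc r} l m"
          using t A1p \<open>m \<in> _\<close> \<open>l \<in> _\<close>
          by (cases "l = r"; cases "m = r") (auto simp: mm_def A'_def A_def esum AA_eval idm_def)
      qed simp
      have m7: "C \<star>[J] C' = idm {..<Suc r}"
      proof (rule mats_eqI)
        show "C \<star>[J] C' \<in> mats {..<Suc r} {..<Suc r}" using mm_mats[OF m3 m4] .
        fix l m assume "l \<in> {..<Suc r}" "m \<in> {..<Suc r}"
        have "(\<Sum>i\<in>J. x i * (C1' i m - g i * c)) = (\<Sum>i\<in>J. x i * C1' i m) - x q * c" for c x
          by (simp add: right_diff_distrib sum_subtractf mult.assoc[symmetric] sum_distrib_right[symmetric] gsum)
        then show "(C \<star>[J] C') l m = idm {..<Suc r} l m"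
          using t C1q \<open>m \<in> _\<close> \<open>l \<in> _\<close>
          by (cases "l = r"; cases "m = r") (auto simp: mm_def C'_def C_def gsum CC_eval idm_def
              simp del: times_divide_eq_left times_divide_eq_right)
      qed simp
      from m1 m2 m3 m4 m5 m6 m7 show ?thesis by blast
    qed
  qed
  then show ?thesis using that by blast
qed

text \<open>Each coordinate k of D is eliminated at the price of at most one index q of R. Degrees,
  multiplicities and sizes of bases are bounded later by exhibiting a family A of vectors together
  with a dual family B.\<close>

lemma left_inverse_card_le:
  fixes B :: "('r, 'd) cmat" and A :: "('d, 'r) cmat"
  assumes "finite D" "finite R" "\<And>i j. i \<in> R \<Longrightarrow> j \<in> R \<Longrightarrow> (\<Sum>k\<in>D. B i k * A k j) = (if i = j then 1 else 0)"
  shows "card R \<le> card D"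
  using assms
proof (induction D arbitrary: R A rule: finite_induct)
  case empty
  then have "R = {}" by force
  then show ?case by simp
next
  case (insert k D)
  show ?case
  proof (cases "\<exists>q\<in>R. A k q \<noteq> 0")
    case False
    have "card R \<le> card D"
    proof (rule insert.IH)
      fix i j assume "i \<in> R" "j \<in> R"
      then show "(\<Sum>k\<in>D. B i k * A k j) = (if i = j then 1 else 0)"
        using insert.prems(2)[of i j] False insert.hyps by auto
    qed (use insert in auto)
    then show ?thesis using insert.hyps by simp
  next
    case True
    then obtain q where q: "q \<in> R" "A k q \<noteq> 0" by auto
    define A' where "A' = (\<lambda>l j. A l j - A l q * A k j / A k q)"
    have "card (R - {q}) \<le> card D"
    proof (rule insert.IH)
      fix i j assume ij: "i \<in> R - {q}" "j \<in> R - {q}"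
      have "A' k j = 0" using q by (simp add: A'_def)
      then have "(\<Sum>l\<in>D. B i l * A' l j) = (\<Sum>l\<in>insert k D. B i l * A' l j)"
        using insert.hyps by simp
      also have "\<dots> = (\<Sum>l\<in>insert k D. B i l * A l j) - (\<Sum>l\<in>insert k D. B i l * A l q) * (A k j / A k q)"
        unfolding A'_def right_diff_distrib sum_subtractf sum_distrib_right by (simp add: mult.assoc)
      finally show "(\<Sum>l\<in>D. B i l * A' l j) = (if i = j then 1 else 0)"
        using insert.prems(2)[of i j] insert.prems(2)[of i q] q ij by auto
    qed (use insert in auto)
    then show ?thesis using insert.hyps insert.prems q by (simp add: card_Diff_singleton)
  qed
qed

text \<open>Write E = AC with full rank. Then A'(EE)C' = CA, while A'EC' is the identity, so
  idempotency gives CA = 1 and C itself serves as \<open>B'\<close>.\<close>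

lemma idempotent_factorization:
  fixes E :: "('i, 'i) cmat"
  assumes fin: "finite I" and E: "E \<in> mats I I" "E \<star>[I] E = E"
  obtains r :: nat and B B' where "B \<in> mats I {..<r}" "B' \<in> mats {..<r} I"
    "B' \<star>[I] B = idm {..<r}" "B \<star>[{..<r}] B' = E"
proof -
  obtain r :: nat and A A' C C' where f: "A \<in> mats I {..<r}" "A' \<in> mats {..<r} I" "C \<in> mats {..<r} I"
    "C' \<in> mats I {..<r}" "E = A \<star>[{..<r}] C" "A' \<star>[I] A = idm {..<r}" "C \<star>[I] C' = idm {..<r}"
    using rank_factorization[OF fin fin E(1)] .
  have "A' \<star>[I] (E \<star>[I] E) \<star>[I] C' = (A' \<star>[I] A) \<star>[{..<r}] (C \<star>[I] A) \<star>[{..<r}] (C \<star>[I] C')"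
    unfolding f(5) by (simp add: mm_assoc)
  also have "\<dots> = C \<star>[I] A"
    unfolding f(6,7) using mm_mats[OF f(3) f(1), of I] by (simp add: mm_idm_left mm_idm_right)
  finally have "C \<star>[I] A = A' \<star>[I] E \<star>[I] C'" by (simp add: E)
  also have "\<dots> = (A' \<star>[I] A) \<star>[{..<r}] (C \<star>[I] C')"
    unfolding f(5) by (simp add: mm_assoc)
  also have "\<dots> = idm {..<r}" unfolding f(6,7) by (rule mm_idm_left[OF _ idm_mats]) simp
  finally show ?thesis using f that by metis
qed

text \<open>The place where the complex numbers enter as an algebraically closed field; it supplies
  the scalars in Schur's lemma.\<close>

lemma eigenvector_exists:
  fixes T :: "(nat, nat) cmat"
  assumes "0 < d"
  obtains c v where "\<exists>i<d. v i \<noteq> 0" "\<And>i. i < d \<Longrightarrow> (\<Sum>j<d. T i j * v j) = c * v i"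
proof -
  define M where "M = mat d d (\<lambda>(i, j). T i j)"
  have M: "M \<in> carrier_mat d d" by (simp add: M_def)
  obtain c v where cv: "eigenvector M v c"
    using spectrum_non_empty[OF M assms] by (auto simp: spectrum_def eigenvalue_def)
  then have v: "v \<in> carrier_vec d" "v \<noteq> 0\<^sub>v d" "M *\<^sub>v v = c \<cdot>\<^sub>v v"
    using M by (auto simp: eigenvector_def)
  have "\<exists>i<d. v $ i \<noteq> 0"
  proof (rule ccontr)
    assume "\<not> ?thesis"
    then have "v = 0\<^sub>v d" using v(1) by (intro eq_vecI) auto
    then show False using v by simp
  qed
  moreover have "(\<Sum>j<d. T i j * v $ j) = c * v $ i" if "i < d" for i
  proof -
    have "(M *\<^sub>v v) $ i = (\<Sum>j<d. T i j * v $ j)"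
      using that v(1) by (simp add: M_def scalar_prod_def lessThan_atLeast0)
    then show ?thesis using v that by simp
  qed
  ultimately show ?thesis using that by blast
qed

section \<open>Matrix representations of finite groups\<close>

type_synonym 'h mrep = "nat \<times> ('h \<Rightarrow> (nat, nat) cmat)"

definition matrix_rep :: "('h, 'b) monoid_scheme \<Rightarrow> 'h mrep \<Rightarrow> bool" where
  "matrix_rep G = (\<lambda>(d, \<sigma>).
    (\<forall>x \<in> carrier G. \<sigma> x \<in> mats {..<d} {..<d}) \<and> \<sigma> \<one>\<^bsub>G\<^esub> = idm {..<d} \<and>
    (\<forall>x \<in> carrier G. \<forall>y \<in> carrier G. \<sigma> (x \<otimes>\<^bsub>G\<^esub> y) = \<sigma> x \<star>[{..<d}] \<sigma> y))"

definition intertwiner :: "('h, 'b) monoid_scheme \<Rightarrow> 'h mrep \<Rightarrow> 'h mrep \<Rightarrow> (nat, nat) cmat \<Rightarrow> bool" where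
  "intertwiner G = (\<lambda>(d, \<sigma>) (e, \<tau>) T. T \<in> mats {..<d} {..<e} \<and>
    (\<forall>x \<in> carrier G. \<sigma> x \<star>[{..<d}] T = T \<star>[{..<e}] \<tau> x))"

text \<open>For finite groups this agrees with the absence of invariant subspaces, by averaging.\<close>

definition simple_rep :: "('h, 'b) monoid_scheme \<Rightarrow> 'h mrep \<Rightarrow> bool" where
  "simple_rep G = (\<lambda>(d, \<sigma>). matrix_rep G (d, \<sigma>) \<and> 0 < d \<and>
    (\<forall>E. intertwiner G (d, \<sigma>) (d, \<sigma>) E \<and> E \<star>[{..<d}] E = E \<longrightarrow> E = 0 \<or> E = idm {..<d}))"

definition equiv_mreps :: "('h, 'b) monoid_scheme \<Rightarrow> 'h mrep \<Rightarrow> 'h mrep \<Rightarrow> bool" where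
  "equiv_mreps G a b \<longleftrightarrow> (\<exists>P Q. intertwiner G a b P \<and> Q \<in> mats {..<fst b} {..<fst a} \<and>
    P \<star>[{..<fst b}] Q = idm {..<fst a} \<and> Q \<star>[{..<fst a}] P = idm {..<fst b})"

lemma matrix_repD:
  assumes "matrix_rep G (d, \<sigma>)"
  shows "x \<in> carrier G \<Longrightarrow> \<sigma> x \<in> mats {..<d} {..<d}" "\<sigma> \<one>\<^bsub>G\<^esub> = idm {..<d}"
    "x \<in> carrier G \<Longrightarrow> y \<in> carrier G \<Longrightarrow> \<sigma> (x \<otimes>\<^bsub>G\<^esub> y) = \<sigma> x \<star>[{..<d}] \<sigma> y"
  using assms by (auto simp: matrix_rep_def)

lemma intertwinerD:
  assumes "intertwiner G (d, \<sigma>) (e, \<tau>) T"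
  shows "T \<in> mats {..<d} {..<e}" "x \<in> carrier G \<Longrightarrow> \<sigma> x \<star>[{..<d}] T = T \<star>[{..<e}] \<tau> x"
  using assms by (auto simp: intertwiner_def)

lemma simple_repD:
  assumes "simple_rep G (d, \<sigma>)"
  shows "matrix_rep G (d, \<sigma>)" "0 < d"
    "intertwiner G (d, \<sigma>) (d, \<sigma>) E \<Longrightarrow> E \<star>[{..<d}] E = E \<Longrightarrow> E = 0 \<or> E = idm {..<d}"
  using assms by (auto simp: simple_rep_def)

lemma idm_nonzero: "0 < d \<Longrightarrow> idm {..<d} \<noteq> (0 :: (nat, nat) cmat)"
  by (auto simp: idm_def fun_eq_iff)

lemma equiv_mreps_refl:
  assumes "matrix_rep G a"
  shows "equiv_mreps G a a"
proof -
  obtain d \<sigma> where [simp]: "a = (d, \<sigma>)" by force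
  have "intertwiner G a a (idm {..<d})"
    using assms by (auto simp: intertwiner_def matrix_rep_def mm_idm_left[OF _ , where J="{..<d}"]
      mm_idm_right[where I="{..<d}"])
  then show ?thesis unfolding equiv_mreps_def
    by (intro exI[of _ "idm {..<d}"]) (auto simp: mm_idm_left[OF _ idm_mats])
qed

lemma equiv_mreps_sym:
  assumes "equiv_mreps G a b" "matrix_rep G a" "matrix_rep G b"
  shows "equiv_mreps G b a"
proof -
  obtain d \<sigma> e \<tau> where [simp]: "a = (d, \<sigma>)" "b = (e, \<tau>)" by (metis surj_pair)
  obtain P Q where PQ: "intertwiner G (d, \<sigma>) (e, \<tau>) P" "Q \<in> mats {..<e} {..<d}"
    "P \<star>[{..<e}] Q = idm {..<d}" "Q \<star>[{..<d}] P = idm {..<e}"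
    using assms(1) by (auto simp: equiv_mreps_def)
  have "intertwiner G (e, \<tau>) (d, \<sigma>) Q"
    unfolding intertwiner_def
  proof (clarsimp simp: PQ(2))
    fix x assume x: "x \<in> carrier G"
    have s: "\<sigma> x \<in> mats {..<d} {..<d}" and t: "\<tau> x \<in> mats {..<e} {..<e}"
      using assms x by (auto simp: matrix_rep_def)
    have "Q \<star>[{..<d}] \<sigma> x = Q \<star>[{..<d}] \<sigma> x \<star>[{..<d}] (P \<star>[{..<e}] Q)"
      using mm_mats[OF PQ(2) s, of "{..<d}"] by (simp add: PQ mm_idm_right)
    also have "\<dots> = Q \<star>[{..<d}] (\<sigma> x \<star>[{..<d}] P) \<star>[{..<e}] Q" by (simp add: mm_assoc)
    also have "\<dots> = (Q \<star>[{..<d}] P) \<star>[{..<e}] \<tau> x \<star>[{..<e}] Q"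
      using x intertwinerD(2)[OF PQ(1)] by (simp add: mm_assoc)
    also have "\<dots> = \<tau> x \<star>[{..<e}] Q" using t PQ by (simp add: mm_idm_left)
    finally show "\<tau> x \<star>[{..<e}] Q = Q \<star>[{..<d}] \<sigma> x" by simp
  qed
  then show ?thesis unfolding equiv_mreps_def using PQ by (auto dest: intertwinerD(1))
qed

lemma intertwiner_mult:
  assumes "intertwiner G (d, \<sigma>) (e, \<tau>) P" "intertwiner G (e, \<tau>) (f, \<upsilon>) Q"
  shows "intertwiner G (d, \<sigma>) (f, \<upsilon>) (P \<star>[{..<e}] Q)"
  unfolding intertwiner_def
proof (clarsimp, intro conjI ballI)
  show "P \<star>[{..<e}] Q \<in> mats {..<d} {..<f}" using assms by (auto dest: intertwinerD(1) intro!: mm_mats)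
  fix x assume x: "x \<in> carrier G"
  have "\<sigma> x \<star>[{..<d}] (P \<star>[{..<e}] Q) = P \<star>[{..<e}] (\<tau> x \<star>[{..<e}] Q)"
    using x intertwinerD(2)[OF assms(1)] by (simp add: mm_assoc[symmetric])
  then show "\<sigma> x \<star>[{..<d}] (P \<star>[{..<e}] Q) = P \<star>[{..<e}] Q \<star>[{..<f}] \<upsilon> x"
    using x intertwinerD(2)[OF assms(2)] by (simp add: mm_assoc)
qed

lemma equiv_mreps_trans:
  assumes "equiv_mreps G a b" "equiv_mreps G b c"
  shows "equiv_mreps G a c"
proof -
  obtain d \<sigma> e \<tau> f \<upsilon> where [simp]: "a = (d, \<sigma>)" "b = (e, \<tau>)" "c = (f, \<upsilon>)" by (metis surj_pair)
  obtain P Q where PQ: "intertwiner G (d, \<sigma>) (e, \<tau>) P" "Q \<in> mats {..<e} {..<d}"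
    "P \<star>[{..<e}] Q = idm {..<d}" "Q \<star>[{..<d}] P = idm {..<e}"
    using assms(1) by (auto simp: equiv_mreps_def)
  obtain P1 Q1 where PQ1: "intertwiner G (e, \<tau>) (f, \<upsilon>) P1" "Q1 \<in> mats {..<f} {..<e}"
    "P1 \<star>[{..<f}] Q1 = idm {..<e}" "Q1 \<star>[{..<e}] P1 = idm {..<f}"
    using assms(2) by (auto simp: equiv_mreps_def)
  have P: "P \<in> mats {..<d} {..<e}" and P1: "P1 \<in> mats {..<e} {..<f}"
    using PQ PQ1 by (auto dest: intertwinerD(1))
  have "P \<star>[{..<e}] P1 \<star>[{..<f}] (Q1 \<star>[{..<e}] Q) = P \<star>[{..<e}] ((P1 \<star>[{..<f}] Q1) \<star>[{..<e}] Q)"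
    by (simp add: mm_assoc)
  also have "\<dots> = idm {..<d}" using PQ by (simp add: PQ1 mm_idm_left)
  finally have 1: "P \<star>[{..<e}] P1 \<star>[{..<f}] (Q1 \<star>[{..<e}] Q) = idm {..<d}" .
  have "Q1 \<star>[{..<e}] Q \<star>[{..<d}] (P \<star>[{..<e}] P1) = Q1 \<star>[{..<e}] ((Q \<star>[{..<d}] P) \<star>[{..<e}] P1)"
    by (simp add: mm_assoc)
  also have "\<dots> = idm {..<f}" using PQ PQ1 P1 by (simp add: mm_idm_left)
  finally show ?thesis
    unfolding equiv_mreps_def using 1 intertwiner_mult[OF PQ(1) PQ1(1)] mm_mats[OF PQ1(2) PQ(2)]
    by auto
qed

lemma intertwiner_mats_mult: 
  assumes "intertwiner G (d, \<sigma>) (e, \<tau>) T" "x \<in> carrier G"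
  shows "\<sigma> x \<star>[{..<d}] (T \<star>[{..<e}] X) = T \<star>[{..<e}] (\<tau> x \<star>[{..<e}] X)"
  using intertwinerD(2)[OF assms] by (simp add: mm_assoc[symmetric])

section \<open>Averaging, Schur's lemma and orthogonality of matrix entries\<close>

locale fin_group = group G for G (structure) +
  assumes fin: "finite (carrier G)"
begin

lemma card_pos: "0 < card (carrier G)"
  using fin by (simp add: card_gt_0_iff carrier_not_empty)

lemma rep_inv:
  assumes "matrix_rep G (d, \<sigma>)" "x \<in> carrier G"
  shows "\<sigma> x \<star>[{..<d}] \<sigma> (inv x) = idm {..<d}" "\<sigma> (inv x) \<star>[{..<d}] \<sigma> x = idm {..<d}"
  using assms matrix_repD(2,3)[OF assms(1)] by (metis inv_closed r_inv, metis inv_closed l_inv)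

text \<open>The averaging operator of Maschke's theorem without division by the group order: its
  users rescale with \<open>sm\<close>, whereas the orthogonality relations want the plain
  sum.\<close>

definition avg :: "'a mrep \<Rightarrow> 'a mrep \<Rightarrow> (nat, nat) cmat \<Rightarrow> (nat, nat) cmat" where
  "avg a b X = (\<Sum>x\<in>carrier G. snd a x \<star>[{..<fst a}] X \<star>[{..<fst b}] snd b (inv x))"

lemma avg_intertwiner:
  assumes a: "matrix_rep G (d, \<sigma>)" and b: "matrix_rep G (e, \<tau>)" and X: "X \<in> mats {..<d} {..<e}"
  shows "intertwiner G (d, \<sigma>) (e, \<tau>) (avg (d, \<sigma>) (e, \<tau>) X)"
  unfolding intertwiner_def
proof (clarsimp, intro conjI ballI)
  show "avg (d, \<sigma>) (e, \<tau>) X \<in> mats {..<d} {..<e}"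
    unfolding avg_def using a b
    by (auto intro!: sum_mats mm_mats[OF mm_mats] X dest: matrix_repD(1))
  fix y assume y: "y \<in> carrier G"
  have "\<sigma> y \<star>[{..<d}] avg (d, \<sigma>) (e, \<tau>) X =
      (\<Sum>x\<in>carrier G. \<sigma> (y \<otimes> x) \<star>[{..<d}] X \<star>[{..<e}] \<tau> (inv x))"
    unfolding avg_def mm_sum_right using y matrix_repD(3)[OF a]
    by (intro sum.cong) (auto simp: mm_assoc)
  also have "\<dots> = (\<Sum>x\<in>carrier G. \<sigma> x \<star>[{..<d}] X \<star>[{..<e}] \<tau> (inv x \<otimes> y))"
    by (rule sum.reindex_bij_witness[of _ "\<lambda>x. inv y \<otimes> x" "\<lambda>x. y \<otimes> x"])
      (use y in \<open>auto simp: m_assoc[symmetric] inv_mult_group\<close>, auto simp: m_assoc)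
  also have "\<dots> = avg (d, \<sigma>) (e, \<tau>) X \<star>[{..<e}] \<tau> y"
    unfolding avg_def mm_sum_left using y matrix_repD(3)[OF b]
    by (intro sum.cong) (auto simp: mm_assoc)
  finally show "\<sigma> y \<star>[{..<d}] avg (d, \<sigma>) (e, \<tau>) X = avg (d, \<sigma>) (e, \<tau>) X \<star>[{..<e}] \<tau> y" .
qed

lemma sum_const_cmat: "(\<Sum>x\<in>carrier G. (Y :: ('i, 'j) cmat)) = sm (of_nat (card (carrier G))) Y"
  by (intro ext) (simp add: sum_fun_eval sm_def)

lemma sm_inverse_card: "sm (1 / of_nat (card (carrier G))) (sm (of_nat (card (carrier G))) Y) = Y"
  using card_pos by (auto simp: sm_def)

lemma intertwiner_sm: "intertwiner G a b T \<Longrightarrow> intertwiner G a b (sm c T)"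
  by (auto simp: intertwiner_def sm_mats mm_sm split: prod.splits)

text \<open>With a generalised inverse H of T, so that THT = T, the matrix 1 - HT projects onto the
  kernel of T, and averaging preserves this because the kernel is invariant. The matrix v stands for
  any collection of columns in the kernel; taking v = E yields idempotency.\<close>

lemma kernel_idempotent:
  assumes a: "matrix_rep G (c, \<tau>)" and b: "matrix_rep G (d, \<sigma>)"
    and T: "intertwiner G (c, \<tau>) (d, \<sigma>) T"
  obtains E where "intertwiner G (d, \<sigma>) (d, \<sigma>) E" "E \<star>[{..<d}] E = E" "T \<star>[{..<d}] E = 0"
    "\<And>v :: (nat, nat) cmat. v \<in> mats {..<d} UNIV \<Longrightarrow> T \<star>[{..<d}] v = 0 \<Longrightarrow> E \<star>[{..<d}] v = v"
proof -
  let ?n = "card (carrier G)"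
  have Tm: "T \<in> mats {..<c} {..<d}" using T by (auto dest: intertwinerD(1))
  obtain r :: nat and A A' C C' where f: "A \<in> mats {..<c} {..<r}" "A' \<in> mats {..<r} {..<c}"
    "C \<in> mats {..<r} {..<d}" "C' \<in> mats {..<d} {..<r}" "T = A \<star>[{..<r}] C"
    "A' \<star>[{..<c}] A = idm {..<r}" "C \<star>[{..<d}] C' = idm {..<r}"
    using rank_factorization[OF finite_lessThan finite_lessThan Tm] by metis
  define H where "H = C' \<star>[{..<r}] A'"
  define E0 where "E0 = idm {..<d} - H \<star>[{..<c}] T"
  have H: "H \<in> mats {..<d} {..<c}" unfolding H_def using f by (auto intro: mm_mats)
  have E0: "E0 \<in> mats {..<d} {..<d}" unfolding E0_def using H Tm by (intro diff_mats mm_mats) auto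
  have "T \<star>[{..<d}] (H \<star>[{..<c}] T) = A \<star>[{..<r}] (C \<star>[{..<d}] C') \<star>[{..<r}] (A' \<star>[{..<c}] A) \<star>[{..<r}] C"
    unfolding H_def f(5) by (simp add: mm_assoc)
  also have "\<dots> = T" using f by (simp add: mm_idm_right)
  finally have TE0: "T \<star>[{..<d}] E0 = 0"
    unfolding E0_def mm_diff_right using Tm by (simp add: mm_idm_right)
  define E where "E = sm (1 / of_nat ?n) (avg (d, \<sigma>) (d, \<sigma>) E0)"
  have 1: "intertwiner G (d, \<sigma>) (d, \<sigma>) E"
    unfolding E_def by (intro intertwiner_sm avg_intertwiner b E0)
  then have Em: "E \<in> mats {..<d} {..<d}" by (auto dest: intertwinerD(1))
  have comm: "T \<star>[{..<d}] (\<sigma> x \<star>[{..<d}] v) = \<tau> x \<star>[{..<c}] (T \<star>[{..<d}] v)" if "x \<in> carrier G" for x and v :: "(nat, nat) cmat"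
    by (rule intertwiner_mats_mult[OF T that, symmetric])
  have 2: "T \<star>[{..<d}] E = 0"
  proof -
    have "T \<star>[{..<d}] (\<sigma> x \<star>[{..<d}] E0 \<star>[{..<d}] \<sigma> (inv x)) = 0" if "x \<in> carrier G" for x
    proof -
      have "T \<star>[{..<d}] (\<sigma> x \<star>[{..<d}] E0 \<star>[{..<d}] \<sigma> (inv x)) =
          \<tau> x \<star>[{..<c}] ((T \<star>[{..<d}] E0) \<star>[{..<d}] \<sigma> (inv x))"
        using comm[OF that] by (simp only: mm_assoc)
      then show ?thesis by (simp add: TE0)
    qed
    then show ?thesis
      unfolding E_def avg_def mm_sm mm_sum_right by (simp add: sm_def fun_eq_iff)
  qed
  have 3: "E \<star>[{..<d}] v = v" if v: "v \<in> mats {..<d} UNIV" and z: "T \<star>[{..<d}] v = 0" for v :: "(nat, nat) cmat"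
  proof -
    have "(\<Sum>x\<in>carrier G. \<sigma> x \<star>[{..<d}] E0 \<star>[{..<d}] \<sigma> (inv x) \<star>[{..<d}] v) = (\<Sum>x\<in>carrier G. v)"
    proof (intro sum.cong refl)
      fix x assume x: "x \<in> carrier G"
      define w where "w = \<sigma> (inv x) \<star>[{..<d}] v"
      have w: "w \<in> mats {..<d} UNIV" unfolding w_def using x b v by (intro mm_mats) (auto dest: matrix_repD(1))
      have "T \<star>[{..<d}] w = 0" unfolding w_def using x comm z by simp
      then have "E0 \<star>[{..<d}] w = w"
        unfolding E0_def mm_diff_left using w by (simp add: mm_assoc mm_idm_left)
      then have "\<sigma> x \<star>[{..<d}] E0 \<star>[{..<d}] \<sigma> (inv x) \<star>[{..<d}] v = \<sigma> x \<star>[{..<d}] \<sigma> (inv x) \<star>[{..<d}] v"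
        unfolding w_def by (simp add: mm_assoc)
      then show "\<sigma> x \<star>[{..<d}] E0 \<star>[{..<d}] \<sigma> (inv x) \<star>[{..<d}] v = v"
        using rep_inv[OF b x] v by (simp add: mm_idm_left)
    qed
    then show ?thesis unfolding E_def avg_def mm_sm mm_sum_left by (simp add: sum_const_cmat sm_inverse_card del: sum_constant)
  qed
  have "E \<in> mats {..<d} UNIV" using Em by (auto simp: mats_def)
  from 3[OF this 2] have "E \<star>[{..<d}] E = E" .
  with 1 2 3 show ?thesis using that by blast
qed

text \<open>Schur's lemma, first half. The kernel idempotent of T cannot be the identity, hence is
  0, and T has a left inverse H. Averaging H gives an intertwiner Q with QT = 1; then TQ is a
  nonzero idempotent intertwiner and so the identity.\<close>

lemma schur_equiv:
  assumes a: "simple_rep G a" and b: "simple_rep G b" and T: "intertwiner G a b T" "T \<noteq> 0"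
  shows "equiv_mreps G a b"
proof -
  obtain c \<tau> d \<sigma> where [simp]: "a = (c, \<tau>)" "b = (d, \<sigma>)" by (metis surj_pair)
  let ?n = "card (carrier G)"
  note ar = simple_repD[OF a[simplified]] and br = simple_repD[OF b[simplified]]
  have Ti: "intertwiner G (c, \<tau>) (d, \<sigma>) T" and Tm: "T \<in> mats {..<c} {..<d}"
    using T by (auto dest: intertwinerD(1))
  obtain E where E: "intertwiner G (d, \<sigma>) (d, \<sigma>) E" "E \<star>[{..<d}] E = E" "T \<star>[{..<d}] E = 0"
    "\<And>v :: (nat, nat) cmat. v \<in> mats {..<d} UNIV \<Longrightarrow> T \<star>[{..<d}] v = 0 \<Longrightarrow> E \<star>[{..<d}] v = v"
    using kernel_idempotent[OF ar(1) br(1) Ti] by metis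
  have E0: "E = 0" using br(3)[OF E(1,2)] E(3) T(2) Tm by (auto simp: mm_idm_right)
  obtain r :: nat and A A' C C' where f: "A \<in> mats {..<c} {..<r}" "A' \<in> mats {..<r} {..<c}"
    "C \<in> mats {..<r} {..<d}" "C' \<in> mats {..<d} {..<r}" "T = A \<star>[{..<r}] C"
    "A' \<star>[{..<c}] A = idm {..<r}" "C \<star>[{..<d}] C' = idm {..<r}"
    using rank_factorization[OF finite_lessThan finite_lessThan Tm] by metis
  define H where "H = C' \<star>[{..<r}] A'"
  have H: "H \<in> mats {..<d} {..<c}" unfolding H_def using f by (auto intro: mm_mats)
  have "T \<star>[{..<d}] (H \<star>[{..<c}] T) = A \<star>[{..<r}] (C \<star>[{..<d}] C') \<star>[{..<r}] (A' \<star>[{..<c}] A) \<star>[{..<r}] C"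
    unfolding H_def f(5) by (simp add: mm_assoc)
  also have "\<dots> = T" using f by (simp add: mm_idm_right)
  finally have "T \<star>[{..<d}] (idm {..<d} - H \<star>[{..<c}] T) = 0"
    unfolding mm_diff_right using Tm by (simp add: mm_idm_right)
  moreover have "idm {..<d} - H \<star>[{..<c}] T \<in> mats {..<d} UNIV"
    using diff_mats[OF idm_mats mm_mats[OF H Tm]] by (auto simp: mats_def)
  ultimately have HT: "H \<star>[{..<c}] T = idm {..<d}" using E(4) E0 by fastforce
  define Q where "Q = sm (1 / of_nat ?n) (avg (d, \<sigma>) (c, \<tau>) H)"
  have Q: "intertwiner G (d, \<sigma>) (c, \<tau>) Q"
    unfolding Q_def by (intro intertwiner_sm avg_intertwiner ar br H)
  then have Qm: "Q \<in> mats {..<d} {..<c}" by (auto dest: intertwinerD(1))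
  have "(\<Sum>x\<in>carrier G. \<sigma> x \<star>[{..<d}] H \<star>[{..<c}] \<tau> (inv x) \<star>[{..<c}] T) = (\<Sum>x\<in>carrier G. idm {..<d})"
  proof (intro sum.cong refl)
    fix x assume x: "x \<in> carrier G"
    have "\<sigma> x \<star>[{..<d}] H \<star>[{..<c}] \<tau> (inv x) \<star>[{..<c}] T = \<sigma> x \<star>[{..<d}] (H \<star>[{..<c}] T) \<star>[{..<d}] \<sigma> (inv x)"
      using x intertwinerD(2)[OF Ti, of "inv x"] by (simp add: mm_assoc)
    then show "\<sigma> x \<star>[{..<d}] H \<star>[{..<c}] \<tau> (inv x) \<star>[{..<c}] T = idm {..<d}"
      using rep_inv[OF br(1) x] matrix_repD(1)[OF br(1) x] by (simp add: HT mm_idm_right)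
  qed
  then have QT: "Q \<star>[{..<c}] T = idm {..<d}"
    unfolding Q_def avg_def mm_sm mm_sum_left by (simp add: sum_const_cmat sm_inverse_card del: sum_constant)
  have TQ: "intertwiner G (c, \<tau>) (c, \<tau>) (T \<star>[{..<d}] Q)" by (rule intertwiner_mult[OF Ti Q])
  have "(T \<star>[{..<d}] Q) \<star>[{..<c}] (T \<star>[{..<d}] Q) = T \<star>[{..<d}] (Q \<star>[{..<c}] T) \<star>[{..<d}] Q"
    by (simp add: mm_assoc)
  also have "\<dots> = T \<star>[{..<d}] Q" unfolding QT using Tm by (simp add: mm_idm_right)
  finally have "T \<star>[{..<d}] Q = 0 \<or> T \<star>[{..<d}] Q = idm {..<c}" by (rule ar(3)[OF TQ])
  moreover have "T \<star>[{..<d}] Q \<noteq> 0"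
  proof
    assume "T \<star>[{..<d}] Q = 0"
    then have "T \<star>[{..<d}] (Q \<star>[{..<c}] T) = 0" by (simp add: mm_assoc[symmetric])
    then show False using QT T(2) Tm by (simp add: mm_idm_right)
  qed
  ultimately show ?thesis using Ti Qm QT by (auto simp: equiv_mreps_def)
qed

text \<open>Schur's lemma, second half. For an eigenvalue c of T the kernel of T - c is nonzero, so
  its idempotent is nonzero, therefore the identity, and T - c vanishes.\<close>

lemma schur_scalar:
  assumes a: "simple_rep G (d, \<sigma>)" and T: "intertwiner G (d, \<sigma>) (d, \<sigma>) T"
  obtains c where "T = sm c (idm {..<d})"
proof -
  note ar = simple_repD[OF a]
  have Tm: "T \<in> mats {..<d} {..<d}" using T by (auto dest: intertwinerD(1))
  obtain c v where cv: "\<exists>i<d. v i \<noteq> 0" "\<And>i. i < d \<Longrightarrow> (\<Sum>j<d. T i j * v j) = c * v i"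
    by (rule eigenvector_exists[OF ar(2), of T]) (rule that)
  define T' where "T' = T - sm c (idm {..<d})"
  have T': "intertwiner G (d, \<sigma>) (d, \<sigma>) T'"
    unfolding intertwiner_def
  proof (clarsimp, intro conjI ballI)
    show "T' \<in> mats {..<d} {..<d}" unfolding T'_def by (intro diff_mats sm_mats Tm idm_mats)
    fix x assume x: "x \<in> carrier G"
    show "\<sigma> x \<star>[{..<d}] T' = T' \<star>[{..<d}] \<sigma> x"
      using intertwinerD(2)[OF T x] matrix_repD(1)[OF ar(1) x]
      by (simp add: T'_def mm_diff_left mm_diff_right mm_sm mm_idm_left mm_idm_right)
  qed
  \<comment> \<open>The eigenvector as a matrix supported in column 0, to fit the matrix form of
    \<open>kernel_idempotent\<close>.\<close>
  define V :: "(nat, nat) cmat" where "V = (\<lambda>i j. if i < d \<and> j = 0 then v i else 0)"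
  have V: "V \<in> mats {..<d} UNIV" by (auto simp: V_def mats_def)
  have "T' \<star>[{..<d}] V = 0"
  proof (intro ext)
    fix i j
    have z: "T' i k = 0" if "\<not> i < d" for k using mats_zero[OF intertwinerD(1)[OF T']] that by auto
    have 1: "(\<Sum>k<d. T' i k * V k j) = (if j = 0 then (\<Sum>k<d. T i k * v k) - c * (\<Sum>k<d. idm {..<d} i k * v k) else 0)"
      by (simp add: V_def T'_def left_diff_distrib sum_subtractf sm_def sum_distrib_left mult.assoc)
    have "(\<Sum>k<d. idm {..<d} i k * v k) = (\<Sum>k<d. if k = i then v i else 0)"
      by (intro sum.cong) (auto simp: idm_def)
    then show "(T' \<star>[{..<d}] V) i j = 0 i j"
      using cv(2)[of i] z 1 by (cases "i < d") (auto simp: mm_def)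
  qed
  obtain E where E: "intertwiner G (d, \<sigma>) (d, \<sigma>) E" "E \<star>[{..<d}] E = E" "T' \<star>[{..<d}] E = 0"
    "\<And>v :: (nat, nat) cmat. v \<in> mats {..<d} UNIV \<Longrightarrow> T' \<star>[{..<d}] v = 0 \<Longrightarrow> E \<star>[{..<d}] v = v"
    using kernel_idempotent[OF ar(1) ar(1) T'] by metis
  have "E \<star>[{..<d}] V = V" using E(4)[OF V] \<open>T' \<star>[{..<d}] V = 0\<close> by simp
  moreover have "V \<noteq> 0" using cv(1) by (auto simp: V_def fun_eq_iff)
  ultimately have "E \<noteq> 0" by auto
  then have "E = idm {..<d}" using ar(3)[OF E(1,2)] by simp
  then have "T' = 0" using E(3) T' by (auto simp: mm_idm_right dest!: intertwinerD(1))
  then have "T = sm c (idm {..<d})" unfolding T'_def by (simp add: fun_eq_iff)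
  then show ?thesis using that by blast
qed

definition unit_mat :: "nat \<Rightarrow> nat \<Rightarrow> (nat, nat) cmat" where
  "unit_mat p q = (\<lambda>i j. if i = p \<and> j = q then 1 else 0)"

text \<open>Averaging a matrix unit produces exactly the sums of the orthogonality relations, as
  entries of an intertwiner.\<close>

lemma avg_unit_eval:
  assumes "p < d" "q < e"
  shows "avg (d, \<sigma>) (e, \<tau>) (unit_mat p q) i j = (\<Sum>x\<in>carrier G. \<sigma> x i p * \<tau> (inv x) q j)"
  unfolding avg_def sum_fun_eval
proof (intro sum.cong refl)
  fix x
  have "(\<sigma> x \<star>[{..<d}] unit_mat p q) i k = (if k = q then \<sigma> x i p else 0)" for k
    using assms by (simp add: mm_def unit_mat_def if_distrib[of "\<lambda>y. _ * y"] sum.delta cong: if_cong conj_cong)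
  then show "(snd (d, \<sigma>) x \<star>[{..<fst (d, \<sigma>)}] unit_mat p q \<star>[{..<fst (e, \<tau>)}] snd (e, \<tau>) (inv x)) i j
      = \<sigma> x i p * \<tau> (inv x) q j"
    using assms by (subst mm_def) (simp add: if_distrib[of "\<lambda>y. y * _"] sum.delta cong: if_cong)
qed

lemma unit_mat_mats: "p < d \<Longrightarrow> q < e \<Longrightarrow> unit_mat p q \<in> mats {..<d} {..<e}"
  by (auto simp: unit_mat_def mats_def)

lemma schur_orthogonality_inequiv:
  assumes "simple_rep G (d, \<sigma>)" "simple_rep G (e, \<tau>)" "\<not> equiv_mreps G (d, \<sigma>) (e, \<tau>)" "p < d" "q < e"
  shows "(\<Sum>x\<in>carrier G. \<sigma> x i p * \<tau> (inv x) q j) = 0"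
proof -
  have "intertwiner G (d, \<sigma>) (e, \<tau>) (avg (d, \<sigma>) (e, \<tau>) (unit_mat p q))"
    using assms by (intro avg_intertwiner unit_mat_mats) (auto dest: simple_repD(1))
  then have "avg (d, \<sigma>) (e, \<tau>) (unit_mat p q) = 0" using schur_equiv assms by blast
  then show ?thesis using avg_unit_eval[OF assms(4,5), of \<sigma> \<tau> i j] by simp
qed

lemma schur_orthogonality:
  assumes a: "simple_rep G (d, \<sigma>)" and "p < d" "q < d" "i < d" "j < d"
  shows "(\<Sum>x\<in>carrier G. \<sigma> x i p * \<sigma> (inv x) q j) =
    (if i = j \<and> p = q then of_nat (card (carrier G)) / of_nat d else 0)"
proof -
  note ar = simple_repD[OF a]
  have "intertwiner G (d, \<sigma>) (d, \<sigma>) (avg (d, \<sigma>) (d, \<sigma>) (unit_mat p q))"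
    using assms ar by (intro avg_intertwiner unit_mat_mats) auto
  then obtain c where c: "avg (d, \<sigma>) (d, \<sigma>) (unit_mat p q) = sm c (idm {..<d})"
    using schur_scalar[OF a] by blast
  then have ev: "(\<Sum>x\<in>carrier G. \<sigma> x i p * \<sigma> (inv x) q j) = (if i = j then c else 0)" if "i < d" "j < d" for i j
    using avg_unit_eval[OF assms(2,3), of \<sigma> \<sigma> i j, symmetric] that unfolding c
    by (simp add: sm_def idm_def)
  \<comment> \<open>The scalar is found by a trace: summing over i = j turns the products into
    entries of \<sigma>(inv x) \<sigma>(x) = 1.\<close>
  have "of_nat d * c = (\<Sum>i<d. \<Sum>x\<in>carrier G. \<sigma> x i p * \<sigma> (inv x) q i)"
    by (simp add: ev)
  also have "\<dots> = (\<Sum>x\<in>carrier G. (\<sigma> (inv x) \<star>[{..<d}] \<sigma> x) q p)"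
    by (subst sum.swap) (simp add: mm_def mult.commute)
  also have "\<dots> = (\<Sum>x\<in>carrier G. idm {..<d} q p)"
    using rep_inv[OF ar(1)] by simp
  also have "\<dots> = (if p = q then of_nat (card (carrier G)) else 0)"
    using assms by (simp add: idm_def)
  finally have "c = (if p = q then of_nat (card (carrier G)) / of_nat d else 0)"
    using ar(2) by (auto simp: field_simps)
  then show ?thesis using ev[OF assms(4,5)] by simp
qed

text \<open>The matrix entries of inequivalent simple representations, as functions on the group,
  have a dual family by Schur orthogonality. They are thus independent, and there are at most as
  many of them as group elements.\<close>

lemma sum_dim_squares_finite:
  assumes "finite Y" and simple: "\<And>a. a \<in> Y \<Longrightarrow> simple_rep G a"
    and ineq: "\<And>a b. a \<in> Y \<Longrightarrow> b \<in> Y \<Longrightarrow> equiv_mreps G a b \<Longrightarrow> a = b"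
  shows "(\<Sum>a\<in>Y. fst a * fst a) \<le> card (carrier G)"
proof -
  let ?n = "of_nat (card (carrier G)) :: complex"
  define R where "R = (SIGMA a:Y. {..<fst a} \<times> {..<fst a})"
  define B where "B = (\<lambda>(a :: 'a mrep, i, p) x. snd a x i p * (of_nat (fst a) / ?n))"
  define A where "A = (\<lambda>x (a :: 'a mrep, j, q). snd a (inv x) q j)"
  have "card R \<le> card (carrier G)"
  proof (rule left_inverse_card_le[of "carrier G" R B A])
    show "finite R" using assms(1) by (auto simp: R_def)
    fix r s assume "r \<in> R" "s \<in> R"
    then obtain d \<sigma> i p e \<tau> j q where r: "r = ((d, \<sigma>), i, p)" "(d, \<sigma>) \<in> Y" "i < d" "p < d"
      and s: "s = ((e, \<tau>), j, q)" "(e, \<tau>) \<in> Y" "j < e" "q < e"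
      by (auto simp: R_def)
    have "(\<Sum>x\<in>carrier G. B r x * A x s) = (\<Sum>x\<in>carrier G. \<sigma> x i p * \<tau> (inv x) q j) * (of_nat d / ?n)"
      by (simp add: r s B_def A_def sum_distrib_left sum_divide_distrib mult_ac)
    also have "\<dots> = (if r = s then 1 else 0)"
    proof (cases "(d, \<sigma>) = (e, \<tau>)")
      case True
      then show ?thesis using schur_orthogonality[of d \<sigma> p q i j] simple[OF r(2)] simple_repD(2)[OF simple[OF r(2)]] r s card_pos
        by auto
    next
      case False
      then have "\<not> equiv_mreps G (d, \<sigma>) (e, \<tau>)" using ineq r s by blast
      then show ?thesis using schur_orthogonality_inequiv[of d \<sigma> e \<tau>] simple r s False by auto
    qed
    finally show "(\<Sum>x\<in>carrier G. B r x * A x s) = (if r = s then 1 else 0)" .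
  qed (rule fin)
  also have "card R = (\<Sum>a\<in>Y. fst a * fst a)" using assms(1) by (simp add: R_def)
  finally show ?thesis .
qed

text \<open>Degrees are positive, so the finite case bounds the size of every finite subset of Y by
  the group order, and finiteness of Y itself follows.\<close>

lemma inequivalent_simple_reps:
  assumes simple: "\<And>a. a \<in> Y \<Longrightarrow> simple_rep G a"
    and ineq: "\<And>a b. a \<in> Y \<Longrightarrow> b \<in> Y \<Longrightarrow> equiv_mreps G a b \<Longrightarrow> a = b"
  shows "finite Y" "(\<Sum>a\<in>Y. fst a * fst a) \<le> card (carrier G)"
proof -
  have "card Z \<le> card (carrier G)" if "finite Z" "Z \<subseteq> Y" for Z
  proof -
    have "card Z \<le> (\<Sum>a\<in>Z. fst a * fst a)"
    proof -
      have "(\<Sum>a\<in>Z. 1) \<le> (\<Sum>a\<in>Z. fst a * fst a)"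
      proof (intro sum_mono)
        fix a assume "a \<in> Z"
        then have "0 < fst a" using that simple simple_repD(2)[of G "fst a" "snd a"] by (metis prod.collapse subsetD)
        then show "1 \<le> fst a * fst a" by (simp add: Suc_le_eq)
      qed
      then show ?thesis by simp
    qed
    also have "\<dots> \<le> card (carrier G)" by (intro sum_dim_squares_finite) (use that assms in blast)+
    finally show ?thesis .
  qed
  then show f: "finite Y" by (meson finite_if_finite_subsets_card_bdd)
  show "(\<Sum>a\<in>Y. fst a * fst a) \<le> card (carrier G)" using f assms by (intro sum_dim_squares_finite) auto
qed

end

section \<open>Change of basis and complete reducibility\<close>

lemma conjugate_rep:
  assumes a: "matrix_rep G (d, \<sigma>)" and P: "P \<in> mats {..<d} {..<e}" and Q: "Q \<in> mats {..<e} {..<d}"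
    and PQ: "P \<star>[{..<e}] Q = idm {..<d}" and QP: "Q \<star>[{..<d}] P = idm {..<e}"
  shows "matrix_rep G (e, \<lambda>x. Q \<star>[{..<d}] \<sigma> x \<star>[{..<d}] P)"
    "equiv_mreps G (d, \<sigma>) (e, \<lambda>x. Q \<star>[{..<d}] \<sigma> x \<star>[{..<d}] P)"
proof -
  have "Q \<star>[{..<d}] (\<sigma> x \<star>[{..<d}] \<sigma> y) \<star>[{..<d}] P =
      Q \<star>[{..<d}] \<sigma> x \<star>[{..<d}] P \<star>[{..<e}] (Q \<star>[{..<d}] \<sigma> y \<star>[{..<d}] P)"
    if "x \<in> carrier G" "y \<in> carrier G" for x y
  proof -
    have "Q \<star>[{..<d}] \<sigma> x \<star>[{..<d}] P \<star>[{..<e}] (Q \<star>[{..<d}] \<sigma> y \<star>[{..<d}] P) =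
      Q \<star>[{..<d}] (\<sigma> x \<star>[{..<d}] (P \<star>[{..<e}] Q)) \<star>[{..<d}] \<sigma> y \<star>[{..<d}] P" by (simp add: mm_assoc)
    then show ?thesis using matrix_repD(1)[OF a that(1)] PQ by (simp add: mm_idm_right mm_assoc)
  qed
  then show "matrix_rep G (e, \<lambda>x. Q \<star>[{..<d}] \<sigma> x \<star>[{..<d}] P)"
    using matrix_repD[OF a] P Q QP
    by (auto simp: matrix_rep_def mm_idm_right[OF _ Q] intro!: mm_mats)
  have "\<sigma> x \<star>[{..<d}] P = P \<star>[{..<e}] (Q \<star>[{..<d}] \<sigma> x \<star>[{..<d}] P)" if "x \<in> carrier G" for x
  proof -
    have "P \<star>[{..<e}] (Q \<star>[{..<d}] \<sigma> x \<star>[{..<d}] P) = (P \<star>[{..<e}] Q) \<star>[{..<d}] \<sigma> x \<star>[{..<d}] P"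
      by (simp add: mm_assoc)
    then show ?thesis using matrix_repD(1)[OF a that] PQ by (simp add: mm_idm_left)
  qed
  then show "equiv_mreps G (d, \<sigma>) (e, \<lambda>x. Q \<star>[{..<d}] \<sigma> x \<star>[{..<d}] P)"
    using P Q PQ QP by (auto simp: equiv_mreps_def intertwiner_def)
qed

lemma simple_rep_equiv:
  assumes a: "simple_rep G a" and b: "matrix_rep G b" and ab: "equiv_mreps G a b"
  shows "simple_rep G b"
proof -
  obtain d \<sigma> e \<tau> where [simp]: "a = (d, \<sigma>)" "b = (e, \<tau>)" by (metis surj_pair)
  note ar = simple_repD[OF a[simplified]]
  obtain P Q where P: "intertwiner G (d, \<sigma>) (e, \<tau>) P" and Q: "Q \<in> mats {..<e} {..<d}"
    and PQ: "P \<star>[{..<e}] Q = idm {..<d}" and QP: "Q \<star>[{..<d}] P = idm {..<e}"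
    using ab by (auto simp: equiv_mreps_def)
  have Pm: "P \<in> mats {..<d} {..<e}" using P by (auto dest: intertwinerD(1))
  have "intertwiner G (e, \<tau>) (d, \<sigma>) Q"
  proof -
    have "\<tau> x \<star>[{..<e}] Q = Q \<star>[{..<d}] \<sigma> x" if x: "x \<in> carrier G" for x
    proof -
      have "\<tau> x \<star>[{..<e}] Q = (Q \<star>[{..<d}] P) \<star>[{..<e}] \<tau> x \<star>[{..<e}] Q"
        using matrix_repD(1)[OF b[simplified] x] QP by (simp add: mm_idm_left)
      also have "\<dots> = Q \<star>[{..<d}] \<sigma> x \<star>[{..<d}] (P \<star>[{..<e}] Q)"
        using intertwinerD(2)[OF P x] by (simp add: mm_assoc) (simp add: mm_assoc[symmetric])
      also have "\<dots> = Q \<star>[{..<d}] \<sigma> x"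
        using mm_mats[OF Q matrix_repD(1)[OF ar(1) x], of "{..<d}"] PQ by (simp add: mm_idm_right)
      finally show ?thesis .
    qed
    then show ?thesis using Q by (auto simp: intertwiner_def)
  qed
  note Qi = this
  have "e > 0"
  proof (rule ccontr)
    assume "\<not> 0 < e"
    then have "P \<star>[{..<e}] Q = 0" by (auto simp: mm_def fun_eq_iff)
    then show False using PQ idm_nonzero[OF ar(2)] by simp
  qed
  moreover have "E = 0 \<or> E = idm {..<e}" if E: "intertwiner G (e, \<tau>) (e, \<tau>) E" "E \<star>[{..<e}] E = E" for E
  proof -
    have Em: "E \<in> mats {..<e} {..<e}" using E by (auto dest: intertwinerD(1))
    define F where "F = P \<star>[{..<e}] E \<star>[{..<e}] Q"
    have "F \<star>[{..<d}] F = P \<star>[{..<e}] E \<star>[{..<e}] (Q \<star>[{..<d}] P) \<star>[{..<e}] E \<star>[{..<e}] Q"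
      by (simp add: F_def mm_assoc)
    also have "\<dots> = P \<star>[{..<e}] (E \<star>[{..<e}] E) \<star>[{..<e}] Q"
      unfolding QP using mm_mats[OF Pm Em, of "{..<e}"] by (simp add: mm_idm_right) (simp add: mm_assoc)
    finally have "F \<star>[{..<d}] F = F" using E by (simp add: F_def)
    moreover have "intertwiner G (d, \<sigma>) (d, \<sigma>) F"
      unfolding F_def by (rule intertwiner_mult[OF intertwiner_mult[OF P E(1)] Qi])
    ultimately have "F = 0 \<or> F = idm {..<d}" using ar(3) by blast
    moreover have "Q \<star>[{..<d}] F \<star>[{..<d}] P = (Q \<star>[{..<d}] P) \<star>[{..<e}] E \<star>[{..<e}] (Q \<star>[{..<d}] P)"
      by (simp add: F_def mm_assoc)
    then have "Q \<star>[{..<d}] F \<star>[{..<d}] P = E"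
      unfolding QP using Em by (simp add: mm_idm_left mm_idm_right)
    ultimately show ?thesis using Q QP by (auto simp: mm_idm_right)
  qed
  ultimately show ?thesis using b by (auto simp: simple_rep_def)
qed

text \<open>The range of E becomes a representation of its own: B embeds it and B' takes
  coordinates. Conjugation with them is multiplicative because E commutes with the action and fixes
  B.\<close>

lemma idempotent_subrep:
  assumes a: "matrix_rep G (d, \<sigma>)" and E: "intertwiner G (d, \<sigma>) (d, \<sigma>) E" "E \<star>[{..<d}] E = E"
  obtains r B B' where "B' \<in> mats {..<r} {..<d}" "B' \<star>[{..<d}] B = idm {..<r}" "B \<star>[{..<r}] B' = E"
    "matrix_rep G (r, \<lambda>x. B' \<star>[{..<d}] \<sigma> x \<star>[{..<d}] B)"
    "intertwiner G (d, \<sigma>) (r, \<lambda>x. B' \<star>[{..<d}] \<sigma> x \<star>[{..<d}] B) B"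
proof -
  obtain r :: nat and B B' where B: "B \<in> mats {..<d} {..<r}" "B' \<in> mats {..<r} {..<d}"
    "B' \<star>[{..<d}] B = idm {..<r}" "B \<star>[{..<r}] B' = E"
    using idempotent_factorization[OF finite_lessThan intertwinerD(1)[OF E(1)] E(2)] by metis
  have EB: "E \<star>[{..<d}] B = B"
    by (metis B(1,3,4) mm_assoc mm_idm_right finite_lessThan)
  have i: "\<sigma> x \<star>[{..<d}] B = B \<star>[{..<r}] (B' \<star>[{..<d}] \<sigma> x \<star>[{..<d}] B)" if "x \<in> carrier G" for x
  proof -
    have "B \<star>[{..<r}] (B' \<star>[{..<d}] \<sigma> x \<star>[{..<d}] B) = E \<star>[{..<d}] \<sigma> x \<star>[{..<d}] B"
      unfolding B(4)[symmetric] by (simp add: mm_assoc)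
    also have "\<dots> = \<sigma> x \<star>[{..<d}] (E \<star>[{..<d}] B)"
      unfolding intertwinerD(2)[OF E(1) that, symmetric] by (simp add: mm_assoc)
    finally show ?thesis by (simp add: EB)
  qed
  have m: "B' \<star>[{..<d}] (\<sigma> x \<star>[{..<d}] \<sigma> y) \<star>[{..<d}] B =
      B' \<star>[{..<d}] \<sigma> x \<star>[{..<d}] B \<star>[{..<r}] (B' \<star>[{..<d}] \<sigma> y \<star>[{..<d}] B)" if "y \<in> carrier G" for x y
    using i[OF that] by (simp add: mm_assoc)
  show ?thesis
  proof (rule that[OF B(2-4)])
    show "matrix_rep G (r, \<lambda>x. B' \<star>[{..<d}] \<sigma> x \<star>[{..<d}] B)"
      using B m matrix_repD[OF a] by (auto simp: matrix_rep_def mm_idm_right[OF _ B(2)] intro!: mm_mats)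
    show "intertwiner G (d, \<sigma>) (r, \<lambda>x. B' \<star>[{..<d}] \<sigma> x \<star>[{..<d}] B) B"
      using i B by (auto simp: intertwiner_def)
  qed
qed

lemma idempotent_complement_dims:
  assumes B: "B' \<star>[{..<d}] B = idm {..<r}" "B \<star>[{..<r}] B' = (E :: (nat, nat) cmat)"
    and C: "C' \<star>[{..<d}] C = idm {..<s}" "C \<star>[{..<s}] C' = idm {..<d} - E"
    and m: "B \<in> mats {..<d} {..<r}" "B' \<in> mats {..<r} {..<d}" "C \<in> mats {..<d} {..<s}" "C' \<in> mats {..<s} {..<d}"
  shows "B' \<star>[{..<d}] C = 0" "C' \<star>[{..<d}] B = 0" "r + s \<le> d"
proof -
  have "B' \<star>[{..<d}] E = B'"
    by (metis B m(2) mm_assoc mm_idm_left finite_lessThan)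
  then have "B' \<star>[{..<d}] (C \<star>[{..<s}] C') = 0" unfolding C mm_diff_right using m by (simp add: mm_idm_right)
  then have "B' \<star>[{..<d}] C \<star>[{..<s}] (C' \<star>[{..<d}] C) = 0" by (simp add: mm_assoc[symmetric])
  then show BC: "B' \<star>[{..<d}] C = 0" using mm_mats[OF m(2,3), of "{..<d}"] by (simp add: C mm_idm_right)
  have "E \<star>[{..<d}] B = B"
    by (metis B m(1) mm_assoc mm_idm_right finite_lessThan)
  then have "C \<star>[{..<s}] C' \<star>[{..<d}] B = 0" unfolding C mm_diff_left using m by (simp add: mm_idm_left)
  then have "(C' \<star>[{..<d}] C) \<star>[{..<s}] (C' \<star>[{..<d}] B) = 0" by (simp add: mm_assoc)
  then show CB: "C' \<star>[{..<d}] B = 0" using mm_mats[OF m(4,1), of "{..<d}"] by (simp add: C mm_idm_left)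
  \<comment> \<open>Stacking B' over C' and placing B beside C gives an identity matrix of size r +
    s that factors through d coordinates.\<close>
  have "card ({..<r} <+> {..<s}) \<le> card {..<d}"
  proof (rule left_inverse_card_le[where B = "case_sum B' C'" and A = "\<lambda>k. case_sum (B k) (C k)"])
    fix i j assume "i \<in> {..<r} <+> {..<s}" "j \<in> {..<r} <+> {..<s}"
    moreover have "(\<Sum>k<d. B' a k * B k b) = idm {..<r} a b" "(\<Sum>k<d. C' a k * C k b) = idm {..<s} a b"
      "(\<Sum>k<d. B' a k * C k b) = 0" "(\<Sum>k<d. C' a k * B k b) = 0" for a b
      using B(1) C(1) BC CB by (auto simp: mm_def fun_eq_iff)
    ultimately show "(\<Sum>k<d. case_sum B' C' i k * case_sum (B k) (C k) j) = (if i = j then 1 else 0)"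
      by (auto simp: idm_def split: if_splits)
  qed auto
  then show "r + s \<le> d" by (simp add: card_Plus)
qed

text \<open>\<open>A b\<close> embeds the block with index b and \<open>A' b\<close> reads off its
  coordinates. The last two clauses say that these maps are mutually inverse between the
  representation and the direct sum of its blocks. Multiplicities appear as repeated values of
  \<open>ty\<close>.\<close>

definition decomposes :: "('h, 'b) monoid_scheme \<Rightarrow> 'h mrep set \<Rightarrow> 'h mrep \<Rightarrow> nat set \<Rightarrow>
    (nat \<Rightarrow> 'h mrep) \<Rightarrow> (nat \<Rightarrow> (nat, nat) cmat) \<Rightarrow> (nat \<Rightarrow> (nat, nat) cmat) \<Rightarrow> bool" where
  "decomposes G Y a Bs ty A A' \<longleftrightarrow> finite Bs \<and> (\<forall>b\<in>Bs. ty b \<in> Y \<and> intertwiner G a (ty b) (A b) \<and>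
      A' b \<in> mats {..<fst (ty b)} {..<fst a}) \<and>
    (\<forall>b\<in>Bs. \<forall>c\<in>Bs. A' b \<star>[{..<fst a}] A c = (if b = c then idm {..<fst (ty b)} else 0)) \<and>
    (\<Sum>b\<in>Bs. A b \<star>[{..<fst (ty b)}] A' b) = idm {..<fst a}"

lemma decomposesD:
  assumes "decomposes G Y (d, \<sigma>) Bs ty A A'"
  shows "finite Bs" "\<And>b. b \<in> Bs \<Longrightarrow> ty b \<in> Y" "\<And>b. b \<in> Bs \<Longrightarrow> intertwiner G (d, \<sigma>) (ty b) (A b)"
    "\<And>b. b \<in> Bs \<Longrightarrow> A' b \<in> mats {..<fst (ty b)} {..<d}"
    "\<And>b c. b \<in> Bs \<Longrightarrow> c \<in> Bs \<Longrightarrow> A' b \<star>[{..<d}] A c = (if b = c then idm {..<fst (ty b)} else 0)"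
    "(\<Sum>b\<in>Bs. A b \<star>[{..<fst (ty b)}] A' b) = idm {..<d}"
  using assms by (simp_all add: decomposes_def)

lemma decomposition:
  assumes complete: "\<And>a. simple_rep G a \<Longrightarrow> \<exists>y\<in>Y. equiv_mreps G a y"
    and a: "matrix_rep G (d, \<sigma>)"
  shows "\<exists>Bs ty A A'. decomposes G Y (d, \<sigma>) Bs ty A A'"
  using a
proof (induction d arbitrary: \<sigma> rule: less_induct)
  case (less d)
  show ?case
  proof (cases "simple_rep G (d, \<sigma>)")
    case True
    then obtain y where y: "y \<in> Y" "equiv_mreps G (d, \<sigma>) y" using complete by blast
    obtain P Q where "intertwiner G (d, \<sigma>) y P" "Q \<in> mats {..<fst y} {..<d}"
      "P \<star>[{..<fst y}] Q = idm {..<d}" "Q \<star>[{..<d}] P = idm {..<fst y}"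
      using y by (auto simp: equiv_mreps_def)
    then show ?thesis using y
      unfolding decomposes_def
      by (intro exI[of _ "{0}"] exI[of _ "\<lambda>_. y"] exI[of _ "\<lambda>_. P"] exI[of _ "\<lambda>_. Q"]) auto
  next
    case ns: False
    show ?thesis
    proof (cases "d = 0")
      case True
      have "(0 :: (nat, nat) cmat) = idm {..<d}" using True by (auto simp: idm_def fun_eq_iff)
      then show ?thesis unfolding decomposes_def by (intro exI[of _ "{}"]) auto
    next
      case False
      then obtain E where E: "intertwiner G (d, \<sigma>) (d, \<sigma>) E" "E \<star>[{..<d}] E = E" "E \<noteq> 0" "E \<noteq> idm {..<d}"
        using ns less.prems by (auto simp: simple_rep_def)
      have Em: "E \<in> mats {..<d} {..<d}" using E by (auto dest: intertwinerD(1))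
      define F where "F = idm {..<d} - E"
      have Fi: "intertwiner G (d, \<sigma>) (d, \<sigma>) F"
        unfolding intertwiner_def
      proof (clarsimp, intro conjI ballI)
        show "F \<in> mats {..<d} {..<d}" unfolding F_def by (intro diff_mats Em idm_mats)
        fix x assume x: "x \<in> carrier G"
        show "\<sigma> x \<star>[{..<d}] F = F \<star>[{..<d}] \<sigma> x"
          using intertwinerD(2)[OF E(1) x] matrix_repD(1)[OF less.prems x]
          by (simp add: F_def mm_diff_left mm_diff_right mm_idm_left mm_idm_right)
      qed
      have F2: "F \<star>[{..<d}] F = F"
        using Em E by (simp add: F_def mm_diff_left mm_diff_right mm_idm_left[OF _ idm_mats] mm_idm_left mm_idm_right)
      obtain r B B' where B: "B' \<in> mats {..<r} {..<d}" "B' \<star>[{..<d}] B = idm {..<r}" "B \<star>[{..<r}] B' = E"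
        "matrix_rep G (r, \<lambda>x. B' \<star>[{..<d}] \<sigma> x \<star>[{..<d}] B)"
        "intertwiner G (d, \<sigma>) (r, \<lambda>x. B' \<star>[{..<d}] \<sigma> x \<star>[{..<d}] B) B"
        by (rule idempotent_subrep[OF less.prems E(1,2)]) (rule that)
      obtain s C C' where C: "C' \<in> mats {..<s} {..<d}" "C' \<star>[{..<d}] C = idm {..<s}" "C \<star>[{..<s}] C' = F"
        "matrix_rep G (s, \<lambda>x. C' \<star>[{..<d}] \<sigma> x \<star>[{..<d}] C)"
        "intertwiner G (d, \<sigma>) (s, \<lambda>x. C' \<star>[{..<d}] \<sigma> x \<star>[{..<d}] C) C"
        by (rule idempotent_subrep[OF less.prems Fi F2]) (rule that)
      have Bm: "B \<in> mats {..<d} {..<r}" and Cm: "C \<in> mats {..<d} {..<s}"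
        using B(5) C(5) by (auto dest: intertwinerD(1))
      have z: "B' \<star>[{..<d}] C = 0" "C' \<star>[{..<d}] B = 0" and rs: "r + s \<le> d"
        using idempotent_complement_dims[OF B(2,3) C(2) C(3)[unfolded F_def] Bm B(1) Cm C(1)] by auto
      have "r > 0" using B(3) E(3) by (cases r) (auto simp: mm_def fun_eq_iff)
      moreover have "s > 0" using C(3) E(4) by (cases s) (auto simp: mm_def F_def fun_eq_iff)
      ultimately have lt: "r < d" "s < d" using rs by auto
      obtain Bs1 ty1 A1 A1' where d1:
        "decomposes G Y (r, \<lambda>x. B' \<star>[{..<d}] \<sigma> x \<star>[{..<d}] B) Bs1 ty1 A1 A1'"
        using less.IH[OF lt(1) B(4)] by (elim exE) (rule that)
      note 1 = decomposesD[OF d1]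
      obtain Bs2 ty2 A2 A2' where d2:
        "decomposes G Y (s, \<lambda>x. C' \<star>[{..<d}] \<sigma> x \<star>[{..<d}] C) Bs2 ty2 A2 A2'"
        using less.IH[OF lt(2) C(4)] by (elim exE) (rule that)
      note 2 = decomposesD[OF d2]
      \<comment> \<open>Even numbers index the blocks of the range of E, odd numbers those of the
        range of 1 - E.\<close>
      define Bs where "Bs = (\<lambda>b. 2 * b) ` Bs1 \<union> (\<lambda>b. Suc (2 * b)) ` Bs2"
      define ty where "ty = (\<lambda>b. if even b then ty1 (b div 2) else ty2 (b div 2))"
      define A where "A = (\<lambda>b. if even b then B \<star>[{..<r}] A1 (b div 2) else C \<star>[{..<s}] A2 (b div 2))"
      define A' where "A' = (\<lambda>b. if even b then A1' (b div 2) \<star>[{..<r}] B' else A2' (b div 2) \<star>[{..<s}] C')"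
      have ev: "ty (2 * b) = ty1 b" "ty (Suc (2 * b)) = ty2 b" "A (2 * b) = B \<star>[{..<r}] A1 b"
        "A (Suc (2 * b)) = C \<star>[{..<s}] A2 b" "A' (2 * b) = A1' b \<star>[{..<r}] B'"
        "A' (Suc (2 * b)) = A2' b \<star>[{..<s}] C'" for b
        by (auto simp: ty_def A_def A'_def)
      have m1: "A1 b \<in> mats {..<r} {..<fst (ty1 b)}" if "b \<in> Bs1" for b
        using 1(3)[OF that] by (cases "ty1 b") (auto dest: intertwinerD(1))
      have m2: "A2 b \<in> mats {..<s} {..<fst (ty2 b)}" if "b \<in> Bs2" for b
        using 2(3)[OF that] by (cases "ty2 b") (auto dest: intertwinerD(1))
      note orth1 = 1(5) and orth2 = 2(5) and A1'm = 1(4) and A2'm = 2(4)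
      have f: "finite Bs" using 1 2 by (simp add: Bs_def)
      have p1: "\<forall>b\<in>Bs. ty b \<in> Y \<and> intertwiner G (d, \<sigma>) (ty b) (A b) \<and> A' b \<in> mats {..<fst (ty b)} {..<d}"
        unfolding Bs_def
      proof (safe)
        fix b assume b: "b \<in> Bs1"
        obtain e \<mu> where e: "ty1 b = (e, \<mu>)" by force
        show "ty (2 * b) \<in> Y" using 1 b by (simp add: ev)
        show "intertwiner G (d, \<sigma>) (ty (2 * b)) (A (2 * b))"
          using intertwiner_mult[OF B(5), of e \<mu> "A1 b"] 1(3)[OF b] by (simp add: ev e)
        show "A' (2 * b) \<in> mats {..<fst (ty (2 * b))} {..<d}"
          unfolding ev by (rule mm_mats[OF 1(4)[OF b] B(1)])
      next
        fix b assume b: "b \<in> Bs2"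
        obtain e \<mu> where e: "ty2 b = (e, \<mu>)" by force
        show "ty (Suc (2 * b)) \<in> Y" using 2 b by (simp add: ev)
        show "intertwiner G (d, \<sigma>) (ty (Suc (2 * b))) (A (Suc (2 * b)))"
          using intertwiner_mult[OF C(5), of e \<mu> "A2 b"] 2(3)[OF b] by (simp add: ev e)
        show "A' (Suc (2 * b)) \<in> mats {..<fst (ty (Suc (2 * b)))} {..<d}"
          unfolding ev by (rule mm_mats[OF 2(4)[OF b] C(1)])
      qed
      have mid: "X \<star>[{..<u}] U \<star>[{..<d}] (V \<star>[{..<v}] Z) = X \<star>[{..<u}] (U \<star>[{..<d}] V) \<star>[{..<v}] Z"
        for X U V Z :: "(nat, nat) cmat" and u v by (simp add: mm_assoc)
      have p2: "\<forall>b\<in>Bs. \<forall>c\<in>Bs. A' b \<star>[{..<d}] A c = (if b = c then idm {..<fst (ty b)} else 0)"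
      proof (intro ballI)
        fix b c assume "b \<in> Bs" "c \<in> Bs"
        then consider (1) b' c' where "b = 2 * b'" "b' \<in> Bs1" "c = 2 * c'" "c' \<in> Bs1"
          | (2) b' c' where "b = 2 * b'" "b' \<in> Bs1" "c = Suc (2 * c')" "c' \<in> Bs2"
          | (3) b' c' where "b = Suc (2 * b')" "b' \<in> Bs2" "c = 2 * c'" "c' \<in> Bs1"
          | (4) b' c' where "b = Suc (2 * b')" "b' \<in> Bs2" "c = Suc (2 * c')" "c' \<in> Bs2"
          unfolding Bs_def by blast
        then show "A' b \<star>[{..<d}] A c = (if b = c then idm {..<fst (ty b)} else 0)"
        proof cases
          case (1 b' c')
          then show ?thesis using orth1[of b' c']
              mm_idm_right[OF finite_lessThan A1'm[of b']] by (simp add: ev mid B(2))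
        next
          case (2 b' c')
          then have "b \<noteq> c" by presburger
          then show ?thesis using 2 by (simp add: ev mid z)
        next
          case (3 b' c')
          then have "b \<noteq> c" by presburger
          then show ?thesis using 3 by (simp add: ev mid z)
        next
          case (4 b' c')
          then show ?thesis using orth2[of b' c']
              mm_idm_right[OF finite_lessThan A2'm[of b']] by (simp add: ev mid C(2))
        qed
      qed
      have "(\<Sum>b\<in>Bs. A b \<star>[{..<fst (ty b)}] A' b) =
          (\<Sum>b\<in>(\<lambda>b. 2 * b) ` Bs1. A b \<star>[{..<fst (ty b)}] A' b) +
          (\<Sum>b\<in>(\<lambda>b. Suc (2 * b)) ` Bs2. A b \<star>[{..<fst (ty b)}] A' b)"
        unfolding Bs_def using 1(1) 2(1) by (intro sum.union_disjoint) (auto simp: image_iff, presburger?)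
      also have "(\<Sum>b\<in>(\<lambda>b. 2 * b) ` Bs1. A b \<star>[{..<fst (ty b)}] A' b) =
          (\<Sum>b\<in>Bs1. B \<star>[{..<r}] (A1 b \<star>[{..<fst (ty1 b)}] A1' b) \<star>[{..<r}] B')"
        by (subst sum.reindex) (auto simp: inj_on_def ev mm_assoc)
      also have "\<dots> = B \<star>[{..<r}] (\<Sum>b\<in>Bs1. A1 b \<star>[{..<fst (ty1 b)}] A1' b) \<star>[{..<r}] B'"
        by (simp add: mm_sum_left mm_sum_right)
      also have "\<dots> = E" using Bm by (simp add: 1(6) mm_idm_right B(3))
      also have "(\<Sum>b\<in>(\<lambda>b. Suc (2 * b)) ` Bs2. A b \<star>[{..<fst (ty b)}] A' b) =
          (\<Sum>b\<in>Bs2. C \<star>[{..<s}] (A2 b \<star>[{..<fst (ty2 b)}] A2' b) \<star>[{..<s}] C')"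
        by (subst sum.reindex) (auto simp: inj_on_def ev mm_assoc)
      also have "\<dots> = C \<star>[{..<s}] (\<Sum>b\<in>Bs2. A2 b \<star>[{..<fst (ty2 b)}] A2' b) \<star>[{..<s}] C'"
        by (simp add: mm_sum_left mm_sum_right)
      also have "\<dots> = F" using Cm by (simp add: 2(6) mm_idm_right C(3))
      finally have p3: "(\<Sum>b\<in>Bs. A b \<star>[{..<fst (ty b)}] A' b) = idm {..<d}"
        by (simp add: F_def)
      have "decomposes G Y (d, \<sigma>) Bs ty A A'" unfolding decomposes_def using f p1 p2 p3 by simp
      then show ?thesis by blast
    qed
  qed
qed

section \<open>Restriction to subgroups\<close>

text \<open>The coordinates q 0, ..., q (e - 1) span a direct summand of the restriction to H, on which H acts by \<mu>.\<close>

definition block_at :: "('h, 'b) monoid_scheme \<Rightarrow> 'h mrep \<Rightarrow> 'h mrep \<Rightarrow> (nat \<Rightarrow> nat) \<Rightarrow> bool" where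
  "block_at H = (\<lambda>(d, \<sigma>) (e, \<mu>) q. inj_on q {..<e} \<and> q ` {..<e} \<subseteq> {..<d} \<and>
    (\<forall>h \<in> carrier H. (\<forall>l<e. \<forall>l'<e. \<sigma> h (q l) (q l') = \<mu> h l l') \<and>
      (\<forall>l<e. \<forall>j. j \<notin> q ` {..<e} \<longrightarrow> \<sigma> h (q l) j = 0 \<and> \<sigma> h j (q l) = 0)))"

text \<open>Block diagonality without a chosen decomposition: every coordinate lies in some block
  that equals, and is not merely equivalent to, a member of Y. Equality is what lets entries for the
  subgroup be copied without arithmetic.\<close>

definition adapted :: "('h, 'b) monoid_scheme \<Rightarrow> 'h mrep set \<Rightarrow> 'h mrep \<Rightarrow> bool" where
  "adapted H Y a \<longleftrightarrow> (\<forall>i < fst a. \<exists>y\<in>Y. \<exists>q. block_at H a y q \<and> i \<in> q ` {..<fst y})"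

lemma block_atD:
  assumes "block_at H (d, \<sigma>) (e, \<mu>) q"
  shows "inj_on q {..<e}" "l < e \<Longrightarrow> q l < d"
    "h \<in> carrier H \<Longrightarrow> l < e \<Longrightarrow> l' < e \<Longrightarrow> \<sigma> h (q l) (q l') = \<mu> h l l'"
    "h \<in> carrier H \<Longrightarrow> l < e \<Longrightarrow> j \<notin> q ` {..<e} \<Longrightarrow> \<sigma> h (q l) j = 0"
    "h \<in> carrier H \<Longrightarrow> l < e \<Longrightarrow> j \<notin> q ` {..<e} \<Longrightarrow> \<sigma> h j (q l) = 0"
  using assms by (auto simp: block_at_def)

lemma block_at_row_sum:
  assumes b: "block_at H (d, \<sigma>) (e, \<mu>) q" and h: "h \<in> carrier H" and l: "l < e"
  shows "(\<Sum>k<d. \<sigma> h (q l) k * f k) = (\<Sum>c<e. \<mu> h l c * f (q c))"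
proof -
  have "(\<Sum>k<d. \<sigma> h (q l) k * f k) = (\<Sum>k\<in>q ` {..<e}. \<sigma> h (q l) k * f k)"
    using block_atD(2)[OF b] block_atD(4)[OF b h l] by (intro sum.mono_neutral_right) auto
  also have "\<dots> = (\<Sum>c<e. \<mu> h l c * f (q c))"
    using block_atD(1,3)[OF b] h l by (subst sum.reindex) auto
  finally show ?thesis .
qed

lemma block_at_col_sum:
  assumes b: "block_at H (d, \<sigma>) (e, \<mu>) q" and h: "h \<in> carrier H" and l: "l < e"
  shows "(\<Sum>k<d. f k * \<sigma> h k (q l)) = (\<Sum>c<e. f (q c) * \<mu> h c l)"
proof -
  have "(\<Sum>k<d. f k * \<sigma> h k (q l)) = (\<Sum>k\<in>q ` {..<e}. f k * \<sigma> h k (q l))"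
    using block_atD(2)[OF b] block_atD(5)[OF b h l] by (intro sum.mono_neutral_right) auto
  also have "\<dots> = (\<Sum>c<e. f (q c) * \<mu> h c l)"
    using block_atD(1,3)[OF b] h l by (subst sum.reindex) auto
  finally show ?thesis .
qed

lemma block_at_trans:
  assumes ab: "block_at H (d, \<sigma>) (e, \<mu>) q" and bc: "block_at H' (e, \<mu>) (f, \<nu>) p" and sub: "carrier H' \<subseteq> carrier H"
  shows "block_at H' (d, \<sigma>) (f, \<nu>) (q \<circ> p)"
proof -
  note q = block_atD[OF ab] and p = block_atD[OF bc]
  have inj: "inj_on (q \<circ> p) {..<f}"
    using p(1,2) by (intro comp_inj_on inj_on_subset[OF q(1)]) auto
  have zero: "\<sigma> h (q (p l)) j = 0 \<and> \<sigma> h j (q (p l)) = 0"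
    if "h \<in> carrier H'" "l < f" "j \<notin> (q \<circ> p) ` {..<f}" for h l j
  proof (cases "j \<in> q ` {..<e}")
    case True
    then obtain m where m: "j = q m" "m < e" by auto
    then have "m \<notin> p ` {..<f}" using that by auto
    then show ?thesis using p(4,5)[OF that(1,2)] q(3) that sub m p(2) by auto
  next
    case False
    then show ?thesis using q(4,5) that p(2) sub by auto
  qed
  show ?thesis
    unfolding block_at_def using inj zero q(2,3) p(2,3) sub by (auto simp: subset_iff)
qed

lemma adapted_trans:
  assumes "adapted H Y a" "\<And>y. y \<in> Y \<Longrightarrow> adapted H' Y' y" "carrier H' \<subseteq> carrier H"
  shows "adapted H' Y' a"
  unfolding adapted_def
proof (intro allI impI)
  fix i assume "i < fst a"
  then obtain y q where y: "y \<in> Y" "block_at H a y q" "i \<in> q ` {..<fst y}" using assms(1) by (auto simp: adapted_def)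
  then obtain l where l: "i = q l" "l < fst y" by auto
  then obtain z p where z: "z \<in> Y'" "block_at H' y z p" "l \<in> p ` {..<fst z}"
    using assms(2)[OF y(1)] by (auto simp: adapted_def)
  have "block_at H' a z (q \<circ> p)"
    using block_at_trans[of H "fst a" "snd a" "fst y" "snd y" q H' "fst z" "snd z" p] y(2) z(2) assms(3) by simp
  then show "\<exists>y\<in>Y'. \<exists>q. block_at H' a y q \<and> i \<in> q ` {..<fst y}"
    using z l by (intro bexI[of _ z] exI[of _ "q \<circ> p"]) auto
qed

text \<open>The columns of all the embeddings \<open>A b\<close> form a basis. The inverse relations
  on both sides show that it has exactly d members, so they can be numbered by
  \<open>{..<d}\<close>, and conjugation with this basis puts every block literally in
  place.\<close>

lemma exists_adapted_basis:
  assumes complete: "\<And>a. simple_rep H a \<Longrightarrow> \<exists>y\<in>Y. equiv_mreps H a y"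
    and a: "matrix_rep H (d, \<sigma>)"
  obtains P Q where "P \<in> mats {..<d} {..<d}" "Q \<in> mats {..<d} {..<d}" "P \<star>[{..<d}] Q = idm {..<d}"
    "Q \<star>[{..<d}] P = idm {..<d}" "adapted H Y (d, \<lambda>x. Q \<star>[{..<d}] \<sigma> x \<star>[{..<d}] P)"
proof -
  have "\<exists>Bs ty A A'. decomposes H Y (d, \<sigma>) Bs ty A A'"
    by (rule decomposition[OF _ a]) (rule complete)
  then obtain Bs ty A A' where dec: "decomposes H Y (d, \<sigma>) Bs ty A A'"
    by (elim exE) (rule that)
  note D = decomposesD[OF dec]
  define I where "I = (SIGMA b:Bs. {..<fst (ty b)})"
  have finI: "finite I" unfolding I_def using D(1) by auto
  have Am: "A b \<in> mats {..<d} {..<fst (ty b)}" if "b \<in> Bs" for b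
    using D(3)[OF that] by (cases "ty b") (auto dest: intertwinerD(1))
  define p where "p = (\<lambda>i (b, l). A b i l)"
  define q where "q = (\<lambda>(b, l) i. A' b l i)"
  have qp: "(\<Sum>k<d. q s k * p k t) = (if s = t then 1 else 0)" if st: "s \<in> I" "t \<in> I" for s t
  proof -
    obtain b l c m where [simp]: "s = (b, l)" "t = (c, m)" by (metis surj_pair)
    have "(\<Sum>k<d. q s k * p k t) = (A' b \<star>[{..<d}] A c) l m" by (simp add: mm_def p_def q_def)
    also have "\<dots> = (if s = t then 1 else 0)"
      using D(5)[of b c] st by (auto simp: I_def idm_def)
    finally show ?thesis .
  qed
  have pq: "(\<Sum>s\<in>I. p i s * q s j) = idm {..<d} i j" for i j
  proof -
    have "(\<Sum>s\<in>I. p i s * q s j) = (\<Sum>b\<in>Bs. (A b \<star>[{..<fst (ty b)}] A' b) i j)"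
      unfolding I_def mm_def using D(1) by (subst sum.Sigma) (auto simp: p_def q_def intro!: sum.cong)
    then show ?thesis using fun_cong[OF fun_cong[OF D(6)], of i j] by (simp add: sum_fun_eval)
  qed
  have "card I \<le> card {..<d}" by (rule left_inverse_card_le[of _ _ q p]) (use finI qp in auto)
  moreover have "card {..<d} \<le> card I"
    by (rule left_inverse_card_le[of _ _ p q]) (use finI pq in \<open>auto simp: idm_def\<close>)
  ultimately have "card {..<d} = card I" by simp
  then obtain \<beta> where \<beta>: "bij_betw \<beta> {..<d} I" using finite_same_card_bij[OF finite_lessThan finI] by blast
  define P where "P = (\<lambda>i j. if j < d then p i (\<beta> j) else 0)"
  define Q where "Q = (\<lambda>j i. if j < d then q (\<beta> j) i else 0)"
  have \<beta>I: "\<beta> j \<in> I" if "j < d" for j using \<beta> that by (auto simp: bij_betw_def)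
  have Pm: "P \<in> mats {..<d} {..<d}"
  proof (rule matsI)
    fix i j assume "i \<notin> {..<d} \<or> j \<notin> {..<d}"
    then show "P i j = 0"
      using \<beta>I[of j] mats_zero[OF Am[of "fst (\<beta> j)"], of i] by (auto simp: P_def p_def I_def split: prod.splits)
  qed
  have Qm: "Q \<in> mats {..<d} {..<d}"
  proof (rule matsI)
    fix j i assume "j \<notin> {..<d} \<or> i \<notin> {..<d}"
    then show "Q j i = 0"
      using \<beta>I[of j] mats_zero[OF D(4)[of "fst (\<beta> j)"], of _ i] by (auto simp: Q_def q_def I_def split: prod.splits)
  qed
  have PQ: "P \<star>[{..<d}] Q = idm {..<d}"
  proof (intro ext)
    fix i j
    have "(P \<star>[{..<d}] Q) i j = (\<Sum>k<d. p i (\<beta> k) * q (\<beta> k) j)" by (simp add: mm_def P_def Q_def)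
    also have "\<dots> = (\<Sum>s\<in>I. p i s * q s j)" by (rule sum.reindex_bij_betw[OF \<beta>])
    finally show "(P \<star>[{..<d}] Q) i j = idm {..<d} i j" by (simp add: pq)
  qed
  have inj: "\<beta> i = \<beta> j \<longleftrightarrow> i = j" if "i < d" "j < d" for i j
    using \<beta> that by (auto simp: bij_betw_def inj_on_def)
  have QP: "Q \<star>[{..<d}] P = idm {..<d}"
  proof (rule mats_eqI)
    fix i j assume "i \<in> {..<d}" "j \<in> {..<d}"
    then show "(Q \<star>[{..<d}] P) i j = idm {..<d} i j"
      using qp[OF \<beta>I \<beta>I, of i j] by (simp add: mm_def P_def Q_def idm_def inj)
  qed (use mm_mats[OF Qm Pm] in auto)
  define \<sigma>' where "\<sigma>' = (\<lambda>x. Q \<star>[{..<d}] \<sigma> x \<star>[{..<d}] P)"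
  have ev: "\<sigma>' x i j = (if b = c then snd (ty c) x l m else 0)"
    if x: "x \<in> carrier H" and ij: "i < d" "j < d" "\<beta> i = (b, l)" "\<beta> j = (c, m)" for x i j b c l m
  proof -
    have bc: "b \<in> Bs" "c \<in> Bs" "l < fst (ty b)" "m < fst (ty c)"
      using \<beta>I[of i] \<beta>I[of j] ij by (auto simp: I_def)
    have "\<sigma>' x i j = (A' b \<star>[{..<d}] \<sigma> x \<star>[{..<d}] A c) l m"
      using ij by (simp add: \<sigma>'_def mm_def P_def Q_def p_def q_def)
    also have "A' b \<star>[{..<d}] \<sigma> x \<star>[{..<d}] A c = A' b \<star>[{..<d}] A c \<star>[{..<fst (ty c)}] snd (ty c) x"
      using D(3)[OF bc(2)] x by (cases "ty c") (simp add: mm_assoc intertwiner_def)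
    also have "\<dots> l m = (if b = c then (\<Sum>k<fst (ty c). idm {..<fst (ty c)} l k * snd (ty c) x k m) else 0)"
      using D(5)[OF bc(1,2)] by (simp add: mm_def)
    also have "(\<Sum>k<fst (ty c). idm {..<fst (ty c)} l k * snd (ty c) x k m) =
        (\<Sum>k<fst (ty c). if k = l then snd (ty c) x l m else 0)"
      by (intro sum.cong) (auto simp: idm_def)
    finally show ?thesis using bc by auto
  qed
  have "adapted H Y (d, \<sigma>')"
    unfolding adapted_def
  proof (intro allI impI)
    fix i assume "i < fst (d, \<sigma>')"
    then have i: "i < d" by simp
    obtain b l where bl: "\<beta> i = (b, l)" by force
    then have b: "b \<in> Bs" "l < fst (ty b)" using \<beta>I[OF i] by (auto simp: I_def)
    obtain e \<mu> where ty: "ty b = (e, \<mu>)" by force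
    define g where "g = (\<lambda>l. the_inv_into {..<d} \<beta> (b, l))"
    have bI: "(b, l) \<in> I" if "l < e" for l using that b ty by (auto simp: I_def)
    have g: "g l < d" "\<beta> (g l) = (b, l)" if "l < e" for l
      using bspec[OF bij_betwE[OF bij_betw_the_inv_into[OF \<beta>]] bI[OF that]]
        f_the_inv_into_f_bij_betw[OF \<beta> bI[OF that]]
      by (simp_all add: g_def)
    have gi: "g ` {..<e} = {j. j < d \<and> fst (\<beta> j) = b}"
    proof (rule Set.set_eqI, rule iffI)
      fix j assume "j \<in> g ` {..<e}"
      then obtain l where l: "l < e" "j = g l" by auto
      then show "j \<in> {j. j < d \<and> fst (\<beta> j) = b}" using g[OF l(1)] by simp
    next
      fix j assume "j \<in> {j. j < d \<and> fst (\<beta> j) = b}"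
      then obtain l where j: "j < d" "\<beta> j = (b, l)" by (metis (mono_tags) mem_Collect_eq prod.collapse)
      then have l: "l < e" using \<beta>I[OF j(1)] ty by (simp add: I_def)
      then have "g l = j" using g[OF l] inj[of "g l" j] j by simp
      then show "j \<in> g ` {..<e}" using l by blast
    qed
    have z: "\<sigma>' h (g l) j = 0 \<and> \<sigma>' h j (g l) = 0" if h: "h \<in> carrier H" "l < e" "j \<notin> g ` {..<e}" for h l j
    proof (cases "j < d")
      case True
      obtain c m where cm: "\<beta> j = (c, m)" by force
      then have "c \<noteq> b" using h(3) True unfolding gi by simp
      then show ?thesis
        using ev[OF h(1) g(1)[OF h(2)] True g(2)[OF h(2)] cm] ev[OF h(1) True g(1)[OF h(2)] cm g(2)[OF h(2)]] by simp
    next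
      case False
      have "\<sigma>' h \<in> mats {..<d} {..<d}"
        unfolding \<sigma>'_def by (rule mm_mats[OF mm_mats[OF Qm matrix_repD(1)[OF a h(1)]] Pm])
      then show ?thesis using mats_zero[of "\<sigma>' h" "{..<d}" "{..<d}"] False by blast
    qed
    have "block_at H (d, \<sigma>') (e, \<mu>) g"
      unfolding block_at_def
    proof (clarsimp, intro conjI ballI allI impI)
      show "inj_on g {..<e}"
      proof (rule inj_onI)
        fix x y assume xy: "x \<in> {..<e}" "y \<in> {..<e}" "g x = g y"
        have "(b, x) = \<beta> (g x)" using g(2)[of x] xy(1) by simp
        also have "\<dots> = (b, y)" unfolding xy(3) using g(2)[of y] xy(2) by simp
        finally show "x = y" by simp
      qed
      show "g ` {..<e} \<subseteq> {..<d}" using g by auto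
      fix h l l' assume "h \<in> carrier H" "l < e" "l' < e"
      then show "\<sigma>' h (g l) (g l') = \<mu> h l l'" using ev[OF _ g(1) g(1) g(2) g(2)] ty by simp
    qed (use z in auto)
    moreover have "i \<in> g ` {..<e}" unfolding gi using i bl by simp
    ultimately show "\<exists>y\<in>Y. \<exists>q. block_at H (d, \<sigma>') y q \<and> i \<in> q ` {..<fst y}"
      using D(2)[OF b(1)] ty by (intro bexI[of _ "ty b"] exI[of _ g]) auto
  qed
  then show ?thesis using that[OF Pm Qm PQ QP] by (simp add: \<sigma>'_def)
qed

text \<open>The coefficients of \<sigma> in the columns that belong to the card J copies of \<mu> are linearly independent by Schur
  orthogonality, but lie in the span of card R * e * e functions supported on cosets of H.\<close>

lemma multiplicity_bound:
  fixes G :: "('h, 'b) monoid_scheme" and H :: "('h, 'c) monoid_scheme"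
  assumes G: "fin_group G" and sub: "carrier H \<subseteq> carrier G" and a: "simple_rep G (d, \<sigma>)" and e: "0 < e"
    and J: "finite J" "\<And>j. j \<in> J \<Longrightarrow> block_at H (d, \<sigma>) (e, \<mu>) (q j)"
    and inj: "inj_on (\<lambda>(j, l). q j l) (J \<times> {..<e})"
    and R: "finite R" "R \<subseteq> carrier G" "\<And>x. x \<in> carrier G \<Longrightarrow> \<exists>r\<in>R. \<exists>h\<in>carrier H. x = r \<otimes>\<^bsub>G\<^esub> h"
  shows "card J * card J \<le> card R"
proof -
  interpret fin_group G by fact
  note ar = simple_repD[OF a]
  let ?n = "of_nat (card (carrier G)) :: complex"
  obtain rr hh where rh: "\<And>x. x \<in> carrier G \<Longrightarrow> rr x \<in> R \<and> hh x \<in> carrier H \<and> rr x \<otimes>\<^bsub>G\<^esub> hh x = x"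
    using R(3) by metis
  define I where "I = {..<d} \<times> (J \<times> {..<e})"
  define D where "D = R \<times> ({..<e} \<times> {..<e})"
  \<comment> \<open>B is the dual family from Schur orthogonality. \<open>A1\<close> and
    \<open>A2\<close> factor the coefficient functions through D by writing x = rh: on the coset of
    r the coefficient is a combination of the entries \<open>\<mu> h m l\<close>, and its
    coefficients depend on r only.\<close>
  define B where "B = (\<lambda>(i, j, l) x. \<sigma> (inv\<^bsub>G\<^esub> x) (q j l) i * (of_nat d / ?n))"
  define A1 where "A1 = (\<lambda>x (r, m :: nat, l :: nat). if r = rr x then \<mu> (hh x) m l else 0)"
  define A2 where "A2 = (\<lambda>(r, m :: nat, l :: nat) (i, j, l'). if l = l' then \<sigma> r i (q j m) else 0)"
  have qd: "q j l < d" if "j \<in> J" "l < e" for j l using block_atD(2)[OF J(2)] that by auto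
  have A12: "(\<Sum>t\<in>D. A1 x t * A2 t (i, j, l)) = \<sigma> x i (q j l)"
    if x: "x \<in> carrier G" and ij: "i < d" "j \<in> J" "l < e" for x i j l
  proof -
    have D_sum: "(\<Sum>t\<in>D. F t) = (\<Sum>r\<in>R. \<Sum>m<e. \<Sum>l'<e. F (r, m, l'))" for F :: "_ \<Rightarrow> complex"
      unfolding D_def by (simp add: sum.cartesian_product split_def)
    have "(\<Sum>t\<in>D. A1 x t * A2 t (i, j, l)) =
        (\<Sum>r\<in>R. \<Sum>m<e. \<Sum>l'<e. if r = rr x then if l' = l then \<mu> (hh x) m l * \<sigma> r i (q j m) else 0 else 0)"
      unfolding D_sum by (intro sum.cong refl) (simp add: A1_def A2_def)
    also have "\<dots> = (\<Sum>r\<in>R. if r = rr x then (\<Sum>m<e. \<mu> (hh x) m l * \<sigma> r i (q j m)) else 0)"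
      using ij by (intro sum.cong refl) (auto simp: sum.delta)
    also have "\<dots> = (\<Sum>m<e. \<sigma> (rr x) i (q j m) * \<mu> (hh x) m l)"
      using R(1) rh[OF x] by (simp add: sum.delta mult.commute)
    also have "\<dots> = (\<sigma> (rr x) \<star>[{..<d}] \<sigma> (hh x)) i (q j l)"
      unfolding mm_def using block_at_col_sum[OF J(2)] ij rh[OF x] by simp
    also have "\<sigma> (rr x) \<star>[{..<d}] \<sigma> (hh x) = \<sigma> x"
    proof -
      have "rr x \<in> carrier G" "hh x \<in> carrier G" using rh[OF x] R(2) sub by auto
      then show ?thesis by (simp only: matrix_repD(3)[OF ar(1), symmetric] rh[OF x])
    qed
    finally show ?thesis .
  qed
  have "card I \<le> card D"
  proof (rule left_inverse_card_le[of D I "\<lambda>s t. \<Sum>x\<in>carrier G. B s x * A1 x t" A2])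
    show "finite D" using R by (simp add: D_def)
    show "finite I" using J by (simp add: I_def)
    fix s t assume "s \<in> I" "t \<in> I"
    then obtain i j l i' j' l' where s: "s = (i, j, l)" "i < d" "j \<in> J" "l < e"
      and t: "t = (i', j', l')" "i' < d" "j' \<in> J" "l' < e" by (auto simp: I_def)
    have "(\<Sum>k\<in>D. (\<Sum>x\<in>carrier G. B s x * A1 x k) * A2 k t) =
        (\<Sum>x\<in>carrier G. B s x * (\<Sum>k\<in>D. A1 x k * A2 k t))"
      unfolding sum_distrib_left sum_distrib_right by (subst sum.swap) (simp add: mult.assoc)
    also have "\<dots> = (\<Sum>x\<in>carrier G. \<sigma> x i' (q j' l') * \<sigma> (inv\<^bsub>G\<^esub> x) (q j l) i) * (of_nat d / ?n)"
      unfolding t(1) using A12 t by (simp add: B_def s(1) sum_distrib_left sum_divide_distrib mult_ac)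
    also have "\<dots> = (if i' = i \<and> q j' l' = q j l then 1 else 0)"
      using schur_orthogonality[OF a, of "q j' l'" "q j l" i' i] qd s t card_pos ar(2) by auto
    also have "\<dots> = (if s = t then 1 else 0)"
      using inj_onD[OF inj, of "(j', l')" "(j, l)"] s t by auto
    finally show "(\<Sum>k\<in>D. (\<Sum>x\<in>carrier G. B s x * A1 x k) * A2 k t) = (if s = t then 1 else 0)" .
  qed
  \<comment> \<open>For m = \<open>card J\<close> copies the count reads d m e \<le> |R| e^2. The
    copies occupy m e different coordinates, so m e \<le> d; this removes the degree d, and e
    cancels.\<close>
  then have 1: "d * (card J * e) \<le> card R * (e * e)"
    by (simp add: I_def D_def card_cartesian_product)
  have "(\<lambda>(j, l). q j l) ` (J \<times> {..<e}) \<subseteq> {..<d}" using qd by auto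
  then have "card (J \<times> {..<e}) \<le> d" using card_inj_on_le[OF inj, of "{..<d}"] by simp
  then have 2: "card J * e \<le> d" by (simp add: card_cartesian_product)
  have "(card J * e) * (card J * e) \<le> card R * (e * e)"
    using le_trans[OF mult_le_mono1[OF 2] 1] .
  then have "(card J * card J) * (e * e) \<le> card R * (e * e)" by (simp add: algebra_simps)
  then show ?thesis using e by simp
qed

text \<open>The matrix f is abstract because it is used in two ways: as \<sigma>(x) for an element x
  commuting with H, and as the identity matrix, which compares two overlapping blocks.\<close>

lemma block_intertwiner:
  assumes \<mu>: "matrix_rep H (e, \<mu>)" and \<nu>: "matrix_rep H (e', \<nu>)"
    and q: "block_at H (d, \<sigma>) (e, \<mu>) q" and q': "block_at H (d, \<sigma>) (e', \<nu>) q'"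
    and comm: "\<And>h i j. h \<in> carrier H \<Longrightarrow> i < d \<Longrightarrow> j < d \<Longrightarrow> (\<Sum>k<d. \<sigma> h i k * f k j) = (\<Sum>k<d. f i k * \<sigma> h k j)"
  shows "intertwiner H (e, \<mu>) (e', \<nu>) (\<lambda>a b. if a < e \<and> b < e' then f (q a) (q' b) else 0)"
    (is "intertwiner _ _ _ ?T")
  unfolding intertwiner_def
proof (clarsimp, intro conjI ballI)
  show T: "?T \<in> mats {..<e} {..<e'}" by (auto simp: mats_def)
  fix h assume h: "h \<in> carrier H"
  show "\<mu> h \<star>[{..<e}] ?T = ?T \<star>[{..<e'}] \<nu> h"
  proof (rule mats_eqI)
    show "\<mu> h \<star>[{..<e}] ?T \<in> mats {..<e} {..<e'}" by (rule mm_mats[OF matrix_repD(1)[OF \<mu> h] T])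
    show "?T \<star>[{..<e'}] \<nu> h \<in> mats {..<e} {..<e'}" by (rule mm_mats[OF T matrix_repD(1)[OF \<nu> h]])
    fix a b assume ab: "a \<in> {..<e}" "b \<in> {..<e'}"
    have "(\<Sum>c<e. \<mu> h a c * ?T c b) = (\<Sum>k<d. \<sigma> h (q a) k * f k (q' b))"
      using ab by (simp add: block_at_row_sum[OF q h])
    also have "\<dots> = (\<Sum>k<d. f (q a) k * \<sigma> h k (q' b))"
      using comm[OF h] block_atD(2)[OF q] block_atD(2)[OF q'] ab by simp
    also have "\<dots> = (\<Sum>c<e'. ?T a c * \<nu> h c b)"
      using ab by (simp add: block_at_col_sum[OF q' h])
    finally show "(\<mu> h \<star>[{..<e}] ?T) a b = (?T \<star>[{..<e'}] \<nu> h) a b" by (simp add: mm_def)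
  qed
qed

text \<open>If \<open>\<sigma> x i j\<close> is nonzero, Schur's lemma for the submatrix of
  \<sigma>(x) between a block of i and a block of j forces both to be the same \<mu>, with i and j
  at the same position l. Different j therefore belong to disjoint copies of \<mu>, and
  \<open>multiplicity_bound\<close> limits the number of copies.\<close>

lemma commuting_element_sparse:
  assumes G: "fin_group G" and H: "fin_group H" and sub: "carrier H \<subseteq> carrier G"
    and a: "simple_rep G (d, \<sigma>)" and ad: "adapted H Y (d, \<sigma>)"
    and simple: "\<And>y. y \<in> Y \<Longrightarrow> simple_rep H y"
    and ineq: "\<And>y z. y \<in> Y \<Longrightarrow> z \<in> Y \<Longrightarrow> equiv_mreps H y z \<Longrightarrow> y = z"
    and R: "finite R" "R \<subseteq> carrier G" "\<And>x. x \<in> carrier G \<Longrightarrow> \<exists>r\<in>R. \<exists>h\<in>carrier H. x = r \<otimes>\<^bsub>G\<^esub> h"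
    and x: "x \<in> carrier G" "\<And>h. h \<in> carrier H \<Longrightarrow> x \<otimes>\<^bsub>G\<^esub> h = h \<otimes>\<^bsub>G\<^esub> x"
  shows "card {j. \<sigma> x i j \<noteq> 0} * card {j. \<sigma> x i j \<noteq> 0} \<le> card R"
proof (cases "i < d")
  case False
  then have "{j. \<sigma> x i j \<noteq> 0} = {}"
    using mats_zero[OF matrix_repD(1)[OF simple_repD(1)[OF a] x(1)]] by auto
  then show ?thesis by simp
next
  case True
  interpret G: fin_group G by fact
  interpret H: fin_group H by fact
  note ar = simple_repD[OF a]
  have comm: "\<sigma> h \<star>[{..<d}] \<sigma> x = \<sigma> x \<star>[{..<d}] \<sigma> h" if "h \<in> carrier H" for h
    using matrix_repD(3)[OF ar(1)] x that sub by (metis subsetD)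
  have comm_eval: "(\<Sum>k<d. \<sigma> h i k * \<sigma> x k j) = (\<Sum>k<d. \<sigma> x i k * \<sigma> h k j)" if "h \<in> carrier H" for h i j
    using fun_cong[OF fun_cong[OF comm[OF that]], of i j] by (simp add: mm_def)
  obtain e \<mu> q l where y: "(e, \<mu>) \<in> Y" "block_at H (d, \<sigma>) (e, \<mu>) q" "i = q l" "l < e"
    using ad True by (fastforce simp: adapted_def)
  have se: "simple_rep H (e, \<mu>)" using simple y by blast
  note er = simple_repD[OF se]
  define J where "J = {j. \<sigma> x i j \<noteq> 0}"
  have "\<exists>p. block_at H (d, \<sigma>) (e, \<mu>) p \<and> p l = j" if j: "j \<in> J" for j
  proof -
    have "j < d" using j mats_zero[OF matrix_repD(1)[OF ar(1) x(1)]] by (force simp: J_def)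
    then obtain e' \<nu> p m where z: "(e', \<nu>) \<in> Y" "block_at H (d, \<sigma>) (e', \<nu>) p" "j = p m" "m < e'"
      using ad by (fastforce simp: adapted_def)
    note z1 = simple_repD(1)[OF simple[OF z(1)]]
    define T where "T = (\<lambda>a b. if a < e \<and> b < e' then \<sigma> x (q a) (p b) else 0)"
    have T: "intertwiner H (e, \<mu>) (e', \<nu>) T"
      unfolding T_def by (rule block_intertwiner[OF er(1) z1 y(2) z(2) comm_eval])
    have nz: "T l m \<noteq> 0" using j y z by (auto simp: J_def T_def)
    then have "T \<noteq> 0" by auto
    then have same: "(e, \<mu>) = (e', \<nu>)"
      using ineq[OF y(1) z(1)] H.schur_equiv[OF se simple[OF z(1)] T] by blast
    have "intertwiner H (e, \<mu>) (e, \<mu>) T" using T same by simp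
    then obtain c where "T = sm c (idm {..<e})"
      by (rule H.schur_scalar[OF se]) (rule that)
    then have "l = m" using nz by (auto simp: sm_def idm_def split: if_splits)
    then show ?thesis using z same by auto
  qed
  then obtain p where p: "\<And>j. j \<in> J \<Longrightarrow> block_at H (d, \<sigma>) (e, \<mu>) (p j)" "\<And>j. j \<in> J \<Longrightarrow> p j l = j" by metis
  have "inj_on (\<lambda>(j, m). p j m) (J \<times> {..<e})"
  proof (rule inj_onI, clarsimp)
    fix j m j' m' assume j: "j \<in> J" "j' \<in> J" "m < e" "m' < e" "p j m = p j' m'"
    \<comment> \<open>A submatrix of the identity is an intertwiner here, hence a scalar c. A common
      coordinate gives c = 1 and equal positions, so the two copies also agree at position l, where
      they contain j and j'.\<close>
    define T where "T = (\<lambda>a b. if a < e \<and> b < e then (if p j a = p j' b then 1 else 0) else (0 :: complex))"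
    have "intertwiner H (e, \<mu>) (e, \<mu>) T"
      unfolding T_def by (rule block_intertwiner[OF er(1) er(1) p(1)[OF j(1)] p(1)[OF j(2)], of "\<lambda>a b. if a = b then 1 else 0"])
        (simp add: if_distrib[of "\<lambda>z. z * _"] if_distrib[of "\<lambda>z. _ * z"] sum.delta cong: if_cong)
    then obtain c where c: "T = sm c (idm {..<e})"
      by (rule H.schur_scalar[OF se]) (rule that)
    have T: "T a b = sm c (idm {..<e}) a b" for a b unfolding c ..
    from T[of m m'] j have mm: "m = m'" "c = 1" by (auto simp: sm_def idm_def T_def split: if_splits)
    moreover have "p j l = p j' l" using T[of l l] y mm by (auto simp: sm_def idm_def T_def split: if_splits)
    ultimately show "j = j' \<and> m = m'" using p(2) j by auto
  qed
  moreover have "finite J"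
    by (rule finite_subset[of _ "{..<d}"]) (use mats_zero[OF matrix_repD(1)[OF ar(1) x(1)]] in \<open>force simp: J_def\<close>)+
  ultimately show ?thesis
    using multiplicity_bound[OF G sub a er(2) _ p(1) _ R, of J] by (simp add: J_def)
qed

section \<open>Straight-line computations\<close>

text \<open>Quantities are functions of the input f, and slp A n B says that those in B can be obtained from those in A
  and constants with n operations.\<close>

inductive slp :: "('f \<Rightarrow> complex) set \<Rightarrow> nat \<Rightarrow> ('f \<Rightarrow> complex) set \<Rightarrow> bool" where
  base: "B \<subseteq> A \<union> range (\<lambda>c f. c) \<Longrightarrow> slp A 0 B"
| step: "u \<in> A \<union> range (\<lambda>c f. c) \<Longrightarrow> v \<in> A \<union> range (\<lambda>c f. c) \<Longrightarrow> z \<in> A \<union> range (\<lambda>c f. c) \<Longrightarrow>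
    slp (insert (\<lambda>f. u f * v f + z f) A) n B \<Longrightarrow> slp A (Suc n) B"

lemma slp_mono_in: "slp A n B \<Longrightarrow> A \<subseteq> A' \<union> range (\<lambda>c f. c) \<Longrightarrow> slp A' n B"
proof (induction arbitrary: A' rule: slp.induct)
  case (base B A)
  then show ?case by (intro slp.base) auto
next
  case (step u A v z n B)
  show ?case
    by (rule slp.step[of u _ v z], use step in blast, use step in blast, use step in blast)
      (rule step.IH, use step.prems in blast)
qed

lemma slp_mono_out: "slp A n B \<Longrightarrow> B' \<subseteq> B \<Longrightarrow> slp A n B'"
proof (induction rule: slp.induct)
  case (base B A)
  then show ?case by (intro slp.base) blast
next
  case (step u A v z n B)
  show ?case by (rule slp.step[OF step(1-3) step.IH[OF step.prems]])
qed

lemma slp_Suc: "slp A n B \<Longrightarrow> slp A (Suc n) B"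
  by (rule slp.step[of "\<lambda>f. 0" _ "\<lambda>f. 0" "\<lambda>f. 0"], blast, blast, blast, erule slp_mono_in, blast)

lemma slp_le: "slp A n B \<Longrightarrow> n \<le> m \<Longrightarrow> slp A m B"
  by (induction m rule: nat_induct) (auto simp: le_Suc_eq slp_Suc)

lemma slp_keep: "slp A n B \<Longrightarrow> slp A n (A \<union> B)"
proof (induction rule: slp.induct)
  case (base B A)
  then show ?case by (intro slp.base) auto
next
  case (step u A v z n B)
  show ?case
    by (rule slp.step[OF step(1-3)], rule slp_mono_out[OF step.IH]) blast
qed

lemma slp_trans: "slp A n B \<Longrightarrow> slp (A \<union> B) m C \<Longrightarrow> slp A (n + m) C"
proof (induction rule: slp.induct)
  case (base B A)
  have "slp A m C" by (rule slp_mono_in[OF base(2)]) (use base(1) in blast)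
  then show ?case by simp
next
  case (step u A v z n B)
  have "slp (insert (\<lambda>f. u f * v f + z f) A \<union> B) m C" using step.prems by (rule slp_mono_in) auto
  then have "slp (insert (\<lambda>f. u f * v f + z f) A) (n + m) C" by (rule step.IH)
  from slp.step[OF step(1-3) this] show ?case by simp
qed

lemma slp_comp: "slp A n B \<Longrightarrow> slp B m C \<Longrightarrow> slp A (n + m) C"
  by (rule slp_trans, assumption, erule slp_mono_in, blast)

lemma slp_Un:
  assumes B: "slp A n B" and C: "slp A m C"
  shows "slp A (n + m) (B \<union> C)"
proof (rule slp_trans[OF B])
  have "slp (A \<union> B) m C" by (rule slp_mono_in[OF C]) blast
  then show "slp (A \<union> B) m (B \<union> C)" by (rule slp_mono_out[OF slp_keep]) blast
qed

lemma slp_UN: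
  assumes "finite I" "\<And>i. i \<in> I \<Longrightarrow> slp A (n i) (B i)"
  shows "slp A (\<Sum>i\<in>I. n i) (\<Union>i\<in>I. B i)"
  using assms
proof (induction I rule: finite_induct)
  case empty
  show ?case by (simp add: slp.base)
next
  case (insert x I)
  have "slp A (n x + (\<Sum>i\<in>I. n i)) (B x \<union> (\<Union>i\<in>I. B i))"
    by (rule slp_Un) (use insert in blast)+
  then show ?case using insert.hyps by simp
qed

lemma slp_UN_le:
  assumes "finite I" "\<And>i. i \<in> I \<Longrightarrow> slp A n (B i)" "card I * n \<le> N"
  shows "slp A N (\<Union>i\<in>I. B i)"
  using slp_le[OF slp_UN[of I A "\<lambda>_. n" B]] assms by simp

text \<open>One operation multiplies by a constant coefficient and adds to the running sum, which
  starts as the constant 0. A term thus costs one operation, addition included.\<close>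

lemma slp_linear_combination:
  assumes "finite I" "\<And>i. i \<in> I \<Longrightarrow> a i \<in> A"
  shows "slp A (card I) {\<lambda>f. \<Sum>i\<in>I. c i * a i f}"
  using assms
proof (induction I rule: finite_induct)
  case empty
  then show ?case by (auto intro: slp.base)
next
  case (insert x I)
  let ?s = "\<lambda>f. \<Sum>i\<in>I. c i * a i f"
  have "slp (A \<union> {?s}) 1 {\<lambda>f. c x * a x f + ?s f}"
    unfolding One_nat_def
    by (rule slp.step[of "\<lambda>f. c x" _ "a x" ?s]) (use insert.prems in \<open>auto intro: slp.base\<close>)
  moreover have "slp A (card I) {?s}" using insert by simp
  ultimately have "slp A (card I + 1) {\<lambda>f. c x * a x f + ?s f}" by (rule slp_trans[rotated])
  then show ?case using insert.hyps by simp
qed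

section \<open>Fast Fourier transforms along a chain of groups\<close>

definition transversal :: "('a \<Rightarrow> 'a \<Rightarrow> bool) \<Rightarrow> 'a set \<Rightarrow> 'a set" where
  "transversal R Z = (\<lambda>z. SOME y. y \<in> Z \<and> R z y) ` Z"

lemma transversal:
  assumes refl: "\<And>x. x \<in> Z \<Longrightarrow> R x x"
    and sym: "\<And>x y. x \<in> Z \<Longrightarrow> y \<in> Z \<Longrightarrow> R x y \<Longrightarrow> R y x"
    and trans: "\<And>x y z. x \<in> Z \<Longrightarrow> y \<in> Z \<Longrightarrow> z \<in> Z \<Longrightarrow> R x y \<Longrightarrow> R y z \<Longrightarrow> R x z"
  shows "transversal R Z \<subseteq> Z" "z \<in> Z \<Longrightarrow> \<exists>y\<in>transversal R Z. R z y"
    "x \<in> transversal R Z \<Longrightarrow> y \<in> transversal R Z \<Longrightarrow> R x y \<Longrightarrow> x = y"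
proof -
  define f where "f = (\<lambda>z. SOME y. y \<in> Z \<and> R z y)"
  have f: "f z \<in> Z \<and> R z (f z)" if "z \<in> Z" for z
    unfolding f_def by (rule someI[of _ z]) (use that refl in blast)
  show "transversal R Z \<subseteq> Z" "z \<in> Z \<Longrightarrow> \<exists>y\<in>transversal R Z. R z y"
    using f unfolding transversal_def f_def[symmetric] by auto
  assume "x \<in> transversal R Z" "y \<in> transversal R Z" "R x y"
  then obtain a b where ab: "a \<in> Z" "b \<in> Z" "x = f a" "y = f b" "R (f a) (f b)"
    unfolding transversal_def f_def[symmetric] by auto
  have "R a b" using f[OF ab(1)] f[OF ab(2)] ab sym trans by meson
  \<comment> \<open>Equivalent elements have the same candidates, so \<open>SOME\<close> picks the
    same representative for both.\<close>
  then have "(\<lambda>y. y \<in> Z \<and> R a y) = (\<lambda>y. y \<in> Z \<and> R b y)" using ab(1,2) sym trans by (intro ext) blast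
  then show "x = y" using ab by (simp add: f_def)
qed

text \<open>All groups share one multiplication and one unit and are nested as sets. A word lists
  letters whose product represents a coset of \<open>K k\<close> in \<open>K (Suc k)\<close>. The
  gap of two levels between \<open>K (Suc j)\<close> and \<open>K (j - 1)\<close> is what adjacent
  transpositions allow; for j = 0 the truncated difference makes the second group
  \<open>K 0\<close>.\<close>

locale group_chain =
  fixes K :: "nat \<Rightarrow> 'h set" and m :: "'h \<Rightarrow> 'h \<Rightarrow> 'h" (infixl "\<bullet>" 70) and e :: 'h
    and words :: "nat \<Rightarrow> 'h list set" and c :: nat
  assumes group_K: "fin_group \<lparr>carrier = K k, mult = (\<bullet>), one = e\<rparr>"
    and K_mono: "K k \<subseteq> K (Suc k)"
    and finite_words: "finite (words k)"
    and card_words: "card (words k) \<le> c * Suc k"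
    and length_words: "w \<in> words k \<Longrightarrow> length w \<le> Suc k"
    and bij_words: "bij_betw (\<lambda>(w, h). foldr (\<bullet>) w e \<bullet> h) (words k \<times> K k) (K (Suc k))"
    and letters: "w \<in> words k \<Longrightarrow> y \<in> set w \<Longrightarrow>
      \<exists>j\<le>k. y \<in> K (Suc j) \<and> (\<forall>h \<in> K (j - 1). y \<bullet> h = h \<bullet> y)"
begin

definition H where "H k = \<lparr>carrier = K k, mult = (\<bullet>), one = e\<rparr>"

lemma H_simps [simp]: "carrier (H k) = K k" "x \<otimes>\<^bsub>H k\<^esub> y = x \<bullet> y" "\<one>\<^bsub>H k\<^esub> = e"
  by (simp_all add: H_def)

lemma fin_group_H: "fin_group (H k)"
  using group_K by (simp add: H_def)

lemma K_mono': "i \<le> j \<Longrightarrow> K i \<subseteq> K j"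
  by (rule lift_Suc_mono_le[of K]) (use K_mono in auto)

lemma finite_K: "finite (K k)"
  using fin_group.fin[OF fin_group_H[of k]] by simp

lemma K_closed: "x \<in> K k \<Longrightarrow> y \<in> K k \<Longrightarrow> x \<bullet> y \<in> K k"
  using monoid.m_closed[OF group.is_monoid[OF fin_group.axioms(1)[OF fin_group_H[of k]]], of x y] by simp

lemma K_assoc: "x \<in> K k \<Longrightarrow> y \<in> K k \<Longrightarrow> z \<in> K k \<Longrightarrow> x \<bullet> y \<bullet> z = x \<bullet> (y \<bullet> z)"
  using monoid.m_assoc[OF group.is_monoid[OF fin_group.axioms(1)[OF fin_group_H[of k]]], of x y z] by simp

lemma e_in_K: "e \<in> K k"
  using monoid.one_closed[OF group.is_monoid[OF fin_group.axioms(1)[OF fin_group_H[of k]]]] by simp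

lemma e_left: "x \<in> K k \<Longrightarrow> e \<bullet> x = x"
  using monoid.l_one[OF group.is_monoid[OF fin_group.axioms(1)[OF fin_group_H[of k]]]] by simp

lemma word_in_K:
  assumes "w \<in> words k" "set u \<subseteq> set w"
  shows "foldr (\<bullet>) u e \<in> K (Suc k)"
  using assms(2)
proof (induction u)
  case (Cons y u)
  obtain j where "j \<le> k" "y \<in> K (Suc j)" using letters[OF assms(1), of y] Cons.prems by auto
  then have "y \<in> K (Suc k)" using K_mono'[of "Suc j" "Suc k"] by auto
  then show ?case using Cons by (simp add: K_closed)
qed (simp add: e_in_K)

lemma matrix_rep_restrict: "matrix_rep (H (Suc k)) a \<Longrightarrow> matrix_rep (H k) a"
  using subsetD[OF K_mono[of k]] by (auto simp: matrix_rep_def)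

text \<open>Representatives are chosen only among representations whose restriction to the previous
  group consists literally of blocks from \<open>irr k\<close>; by recursion they are adapted to the
  whole chain.\<close>

primrec irr :: "nat \<Rightarrow> 'h mrep set" where
  "irr 0 = transversal (equiv_mreps (H 0)) {a. simple_rep (H 0) a}"
| "irr (Suc k) = transversal (equiv_mreps (H (Suc k))) {a. simple_rep (H (Suc k)) a \<and> adapted (H k) (irr k) a}"

lemma irr_transversal:
  assumes "Z \<subseteq> {a. simple_rep (H k) a}"
  shows "transversal (equiv_mreps (H k)) Z \<subseteq> Z"
    "z \<in> Z \<Longrightarrow> \<exists>y\<in>transversal (equiv_mreps (H k)) Z. equiv_mreps (H k) z y"
    "x \<in> transversal (equiv_mreps (H k)) Z \<Longrightarrow> y \<in> transversal (equiv_mreps (H k)) Z \<Longrightarrow>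
      equiv_mreps (H k) x y \<Longrightarrow> x = y"
proof -
  have r: "matrix_rep (H k) z" if "z \<in> Z" for z
    using assms that by (cases z) (auto dest: simple_repD(1))
  have refl: "equiv_mreps (H k) x x" if "x \<in> Z" for x using equiv_mreps_refl r that by blast
  have sym: "equiv_mreps (H k) y x" if "x \<in> Z" "y \<in> Z" "equiv_mreps (H k) x y" for x y
    using equiv_mreps_sym r that by blast
  have trans: "equiv_mreps (H k) x z" if "x \<in> Z" "y \<in> Z" "z \<in> Z" "equiv_mreps (H k) x y" "equiv_mreps (H k) y z" for x y z
    using equiv_mreps_trans that by blast
  show "transversal (equiv_mreps (H k)) Z \<subseteq> Z"
    by (rule transversal(1)) (use refl sym trans in blast)+
  show "\<exists>y\<in>transversal (equiv_mreps (H k)) Z. equiv_mreps (H k) z y" if "z \<in> Z"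
    by (rule transversal(2)[OF _ _ _ that]) (use refl sym trans in blast)+
  show "x = y" if "x \<in> transversal (equiv_mreps (H k)) Z" "y \<in> transversal (equiv_mreps (H k)) Z"
      "equiv_mreps (H k) x y"
    by (rule transversal(3)[OF _ _ _ that]) (use refl sym trans in blast)+
qed

lemma irr_cases:
  obtains Z where "Z \<subseteq> {a. simple_rep (H k) a}" "irr k = transversal (equiv_mreps (H k)) Z"
proof (cases k)
  case 0
  then show ?thesis by (intro that[of "{a. simple_rep (H 0) a}"]) auto
next
  case (Suc j)
  then show ?thesis by (intro that[of "{a. simple_rep (H (Suc j)) a \<and> adapted (H j) (irr j) a}"]) auto
qed

lemma irr_simple: "y \<in> irr k \<Longrightarrow> simple_rep (H k) y"
  by (rule irr_cases[of k]) (use irr_transversal(1) in blast)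

lemma irr_adapted: "y \<in> irr (Suc k) \<Longrightarrow> adapted (H k) (irr k) y"
  using irr_transversal(1)[of "{a. simple_rep (H (Suc k)) a \<and> adapted (H k) (irr k) a}" "Suc k"]
  by auto

lemma irr_inequiv:
  assumes "y \<in> irr k" "z \<in> irr k" "equiv_mreps (H k) y z"
  shows "y = z"
proof -
  obtain Z where Z: "Z \<subseteq> {a. simple_rep (H k) a}" "irr k = transversal (equiv_mreps (H k)) Z"
    by (rule irr_cases)
  show ?thesis using irr_transversal(3)[OF Z(1)] assms unfolding Z(2) by blast
qed

text \<open>The recursive choice loses no equivalence class: completeness at level k provides an
  adapted basis for the restriction, and the representation conjugated to that basis is a candidate
  at level k + 1.\<close>

lemma irr_complete: "simple_rep (H k) a \<Longrightarrow> \<exists>y\<in>irr k. equiv_mreps (H k) a y"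
proof (induction k arbitrary: a)
  case 0
  then show ?case using irr_transversal(2)[of "{a. simple_rep (H 0) a}" 0] by simp
next
  case (Suc k)
  obtain d \<sigma> where [simp]: "a = (d, \<sigma>)" by force
  have r: "matrix_rep (H (Suc k)) (d, \<sigma>)" using Suc.prems by (auto dest: simple_repD(1))
  obtain P Q where PQ: "P \<in> mats {..<d} {..<d}" "Q \<in> mats {..<d} {..<d}" "P \<star>[{..<d}] Q = idm {..<d}"
    "Q \<star>[{..<d}] P = idm {..<d}" "adapted (H k) (irr k) (d, \<lambda>x. Q \<star>[{..<d}] \<sigma> x \<star>[{..<d}] P)"
    using exists_adapted_basis[of "H k" "irr k", OF Suc.IH matrix_rep_restrict[OF r]] by blast
  let ?b = "(d, \<lambda>x. Q \<star>[{..<d}] \<sigma> x \<star>[{..<d}] P)"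
  note b = conjugate_rep[OF r PQ(1-4)]
  have "simple_rep (H (Suc k)) ?b" using simple_rep_equiv[OF Suc.prems b(1)] b(2) by simp
  then have b_in: "?b \<in> {a. simple_rep (H (Suc k)) a \<and> adapted (H k) (irr k) a}" using PQ(5) by simp
  have "\<exists>y\<in>irr (Suc k). equiv_mreps (H (Suc k)) ?b y"
    unfolding irr.simps by (rule irr_transversal(2)[OF _ b_in]) blast
  then obtain y where y: "y \<in> irr (Suc k)" "equiv_mreps (H (Suc k)) ?b y" by blast
  have "equiv_mreps (H (Suc k)) (d, \<sigma>) y" by (rule equiv_mreps_trans[OF b(2) y(2)])
  then show ?case using y(1) by auto
qed

definition entries :: "nat \<Rightarrow> ('h mrep \<times> nat \<times> nat) set" where
  "entries k = (SIGMA a : irr k. {..<fst a} \<times> {..<fst a})"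

lemma entries: "finite (entries k)" "card (entries k) \<le> card (K k)"
proof -
  have i: "finite (irr k)" "(\<Sum>a\<in>irr k. fst a * fst a) \<le> card (K k)"
    using fin_group.inequivalent_simple_reps[OF fin_group_H[of k], of "irr k", OF irr_simple irr_inequiv] by auto
  then show "finite (entries k)" unfolding entries_def by auto
  show "card (entries k) \<le> card (K k)" using i by (simp add: entries_def)
qed

text \<open>At level k = j + 1 the bound comes from commutation with \<open>K (j - 1)\<close>, whose
  index is at most the square of c (j + 1). At higher levels \<sigma>(y) is block diagonal with
  blocks from the level below, so its rows gain no nonzero entries.\<close>

lemma letter_sparse:
  assumes y: "y \<in> K (Suc j)" "\<And>h. h \<in> K (j - 1) \<Longrightarrow> y \<bullet> h = h \<bullet> y" and "Suc j \<le> k" and a: "(d, \<sigma>) \<in> irr k"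
  shows "card {l. \<sigma> y i l \<noteq> 0} \<le> c * Suc j"
  using \<open>Suc j \<le> k\<close> a
proof (induction k arbitrary: d \<sigma> i rule: dec_induct)
  case base
  have words_R: "\<exists>w\<in>words t. \<exists>h\<in>K t. x = foldr (\<bullet>) w e \<bullet> h" if "x \<in> K (Suc t)" for x t
  proof -
    have "x \<in> (\<lambda>(w, h). foldr (\<bullet>) w e \<bullet> h) ` (words t \<times> K t)"
      using bij_words[of t] that by (simp add: bij_betw_def)
    then show ?thesis by auto
  qed
  \<comment> \<open>Products of representatives from two consecutive steps represent the cosets of
    \<open>K (j - 1)\<close>; for j = 0 there is just the step from \<open>K 0\<close> to
    \<open>K 1\<close>.\<close>
  define R where "R = (if j = 0 then (\<lambda>w. foldr (\<bullet>) w e) ` words 0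
    else (\<lambda>(w, u). foldr (\<bullet>) w e \<bullet> foldr (\<bullet>) u e) ` (words j \<times> words (j - 1)))"
  have sub: "K (j - 1) \<subseteq> K (Suc j)" by (rule K_mono') simp
  have R1: "finite R" using finite_words by (simp add: R_def)
  have W: "foldr (\<bullet>) w e \<in> K (Suc t)" if "w \<in> words t" for w t using word_in_K[OF that order_refl] .
  have R2: "R \<subseteq> K (Suc j)"
  proof (cases j)
    case 0
    then show ?thesis using W by (auto simp: R_def)
  next
    case (Suc i)
    then have "foldr (\<bullet>) u e \<in> K (Suc j)" if "u \<in> words i" for u
      using W[OF that] K_mono[of "Suc i"] by auto
    then show ?thesis using W Suc by (auto simp: R_def intro!: K_closed)
  qed
  have R3: "\<exists>r\<in>R. \<exists>h\<in>K (j - 1). x = r \<bullet> h" if x: "x \<in> K (Suc j)" for x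
  proof (cases j)
    case 0
    then show ?thesis using words_R[OF x] by (auto simp: R_def)
  next
    case (Suc i)
    obtain w h where w: "w \<in> words j" "h \<in> K j" "x = foldr (\<bullet>) w e \<bullet> h" using words_R[OF x] by auto
    obtain u g where u: "u \<in> words i" "g \<in> K i" "h = foldr (\<bullet>) u e \<bullet> g" using words_R[of h i] w(2) Suc by auto
    have "foldr (\<bullet>) w e \<in> K (Suc j)" "foldr (\<bullet>) u e \<in> K (Suc j)" "g \<in> K (Suc j)"
      using W[OF w(1)] W[OF u(1)] u(2) K_mono'[of "Suc i" "Suc j"] K_mono'[of i "Suc j"] Suc by auto
    then have "x = (foldr (\<bullet>) w e \<bullet> foldr (\<bullet>) u e) \<bullet> g" using w u K_assoc by simp
    moreover have "foldr (\<bullet>) w e \<bullet> foldr (\<bullet>) u e \<in> R" using w u Suc by (auto simp: R_def)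
    ultimately show ?thesis using u Suc by auto
  qed
  have cR: "card R \<le> (c * Suc j) * (c * Suc j)"
  proof (cases j)
    case 0
    have "card R \<le> card (words 0)" unfolding R_def using 0 finite_words by (auto intro: card_image_le)
    also have "\<dots> \<le> c" using card_words[of 0] by simp
    also have "\<dots> \<le> c * c" by (cases c) auto
    finally show ?thesis using 0 by simp
  next
    case (Suc i)
    have "card R = card ((\<lambda>(w, u). foldr (\<bullet>) w e \<bullet> foldr (\<bullet>) u e) ` (words j \<times> words i))"
      using Suc by (simp add: R_def)
    also have "\<dots> \<le> card (words j \<times> words i)"
      by (intro card_image_le finite_cartesian_product finite_words)
    also have "\<dots> \<le> (c * Suc j) * (c * Suc j)"
      unfolding card_cartesian_product using card_words[of j] card_words[of i] Suc
      by (intro mult_mono) (auto intro: order_trans)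
    finally show ?thesis .
  qed
  have ad: "adapted (H (j - 1)) (irr (j - 1)) (d, \<sigma>) \<or> j = 0"
  proof (cases j)
    case (Suc i)
    then show ?thesis
      using adapted_trans[OF irr_adapted[OF base(1)], of "H i" "irr i"] irr_adapted[of _ i] K_mono[of i] by auto
  qed simp
  have ad: "adapted (H (j - 1)) (irr (j - 1)) (d, \<sigma>)"
    using ad irr_adapted[OF base(1)] by auto
  have "card {l. \<sigma> y i l \<noteq> 0} * card {l. \<sigma> y i l \<noteq> 0} \<le> card R"
    by (rule commuting_element_sparse[OF fin_group_H[of "Suc j"] fin_group_H[of "j - 1"] _ irr_simple[OF base(1)] ad
          irr_simple irr_inequiv R1]) (use R2 R3 y sub in auto)
  then have "(card {l. \<sigma> y i l \<noteq> 0})\<^sup>2 \<le> (c * Suc j)\<^sup>2" using cR by (simp only: power2_eq_square)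
  then show ?case by (simp only: power2_nat_le_eq_le)
next
  case (step k)
  show ?case
  proof (cases "i < d")
    case False
    have "y \<in> K (Suc k)" using y(1) K_mono'[of "Suc j" "Suc k"] step.hyps by auto
    then have "\<sigma> y \<in> mats {..<d} {..<d}"
      using matrix_repD(1)[OF simple_repD(1)[OF irr_simple[OF step.prems]]] by simp
    then have "{l. \<sigma> y i l \<noteq> 0} = {}" using False unfolding mats_def by auto
    then show ?thesis by simp
  next
    case True
    obtain f \<mu> q l where b: "(f, \<mu>) \<in> irr k" "block_at (H k) (d, \<sigma>) (f, \<mu>) q" "i = q l" "l < f"
      using irr_adapted[OF step.prems] True by (fastforce simp: adapted_def)
    have yk: "y \<in> carrier (H k)" using y(1) K_mono'[of "Suc j" k] step.hyps by auto
    have sub: "{t. \<sigma> y i t \<noteq> 0} \<subseteq> q ` {t. \<mu> y l t \<noteq> 0}"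
    proof
      fix t assume t: "t \<in> {t. \<sigma> y i t \<noteq> 0}"
      then have "t \<in> q ` {..<f}" using block_atD(4)[OF b(2) yk b(4)] b(3) by auto
      then obtain s where "t = q s" "s < f" by auto
      then show "t \<in> q ` {t. \<mu> y l t \<noteq> 0}" using t block_atD(3)[OF b(2) yk b(4)] b(3) by auto
    qed
    have "{t. \<mu> y l t \<noteq> 0} \<subseteq> {..<f}"
      using matrix_repD(1)[OF simple_repD(1)[OF irr_simple[OF b(1)]] yk] unfolding mats_def by auto
    then have fin: "finite {t. \<mu> y l t \<noteq> 0}" by (rule finite_subset) simp
    have "card {t. \<sigma> y i t \<noteq> 0} \<le> card {t. \<mu> y l t \<noteq> 0}"
      by (rule le_trans[OF card_mono[OF finite_imageI[OF fin] sub] card_image_le[OF fin]])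
    then show ?thesis using step.IH[OF b(1), of l] by simp
  qed
qed

section \<open>The transform assembled coset by coset\<close>

definition coefficient :: "nat \<Rightarrow> ('h \<Rightarrow> 'f \<Rightarrow> complex) \<Rightarrow> 'h mrep \<times> nat \<times> nat \<Rightarrow> 'f \<Rightarrow> complex" where
  "coefficient k q = (\<lambda>(a, i, j) f. \<Sum>x\<in>K k. q x f * snd a x i j)"

text \<open>The contribution of the coset of w to the transform on \<open>K (Suc k)\<close>, where q
  is the function already moved to \<open>K k\<close>. Any list of letters is allowed for w, so that
  a word can be built up one letter at a time.\<close>

definition translated :: "nat \<Rightarrow> ('h \<Rightarrow> 'f \<Rightarrow> complex) \<Rightarrow> 'h list \<Rightarrow> 'h mrep \<times> nat \<times> nat \<Rightarrow> 'f \<Rightarrow> complex" where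
  "translated k q w = (\<lambda>(a, i, j) f. \<Sum>h\<in>K k. q h f * snd a (foldr (\<bullet>) w e \<bullet> h) i j)"

text \<open>For the empty word the sum runs over \<open>K k\<close>, on which the representation is
  block diagonal: within a block the entry belongs to the transform on \<open>K k\<close>, elsewhere
  it is 0. Hence this step needs no operation.\<close>

lemma translated_Nil:
  assumes "t \<in> entries (Suc k)"
  shows "translated k q [] t \<in> coefficient k q ` entries k \<union> range (\<lambda>c f. c)"
proof -
  obtain d \<sigma> i j where t: "t = ((d, \<sigma>), i, j)" "(d, \<sigma>) \<in> irr (Suc k)" "i < d" "j < d"
    using assms by (auto simp: entries_def)
  obtain f \<mu> p l where b: "(f, \<mu>) \<in> irr k" "block_at (H k) (d, \<sigma>) (f, \<mu>) p" "j = p l" "l < f"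
    using irr_adapted[OF t(2)] t(4) by (fastforce simp: adapted_def)
  show ?thesis
  proof (cases "i \<in> p ` {..<f}")
    case True
    then obtain l' where l': "i = p l'" "l' < f" by auto
    have "translated k q [] t = coefficient k q ((f, \<mu>), l', l)"
      using block_atD(3)[OF b(2) _ l'(2) b(4)]
      by (simp add: translated_def coefficient_def t(1) l'(1) b(3) e_left cong: sum.cong)
    then show ?thesis using b l' by (auto simp: entries_def)
  next
    case False
    have "translated k q [] t = (\<lambda>f. 0)"
      using block_atD(5)[OF b(2) _ b(4) False]
      by (simp add: translated_def t(1) b(3) e_left cong: sum.cong)
    then show ?thesis by auto
  qed
qed

text \<open>Prepending a letter multiplies from the left by \<sigma>(y). Restricting the sum to the
  support of row i makes the sparsity of \<sigma>(y) count.\<close>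

lemma translated_Cons:
  assumes y: "y \<in> K (Suc k)" and w: "foldr (\<bullet>) w e \<in> K (Suc k)" and a: "(d, \<sigma>) \<in> irr (Suc k)"
  shows "translated k q (y # w) ((d, \<sigma>), i, j) =
    (\<lambda>f. \<Sum>l\<in>{l. \<sigma> y i l \<noteq> 0}. \<sigma> y i l * translated k q w ((d, \<sigma>), l, j) f)"
proof
  fix f
  have r: "matrix_rep (H (Suc k)) (d, \<sigma>)" using irr_simple[OF a] by (rule simple_repD(1))
  let ?w = "foldr (\<bullet>) w e"
  have sub: "{l. \<sigma> y i l \<noteq> 0} \<subseteq> {..<d}"
    using matrix_repD(1)[OF r] y unfolding mats_def by fastforce
  have ev: "\<sigma> (y \<bullet> ?w \<bullet> h) i j = (\<Sum>l\<in>{l. \<sigma> y i l \<noteq> 0}. \<sigma> y i l * \<sigma> (?w \<bullet> h) l j)" if h: "h \<in> K k" for h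
  proof -
    have hS: "h \<in> K (Suc k)" using h K_mono by auto
    have "\<sigma> (y \<bullet> ?w \<bullet> h) = \<sigma> y \<star>[{..<d}] \<sigma> (?w \<bullet> h)"
      using matrix_repD(3)[OF r, of y "?w \<bullet> h"] y K_closed[OF w hS] K_assoc[OF y w hS] by simp
    then have "\<sigma> (y \<bullet> ?w \<bullet> h) i j = (\<Sum>l<d. \<sigma> y i l * \<sigma> (?w \<bullet> h) l j)" by (simp add: mm_def)
    also have "\<dots> = (\<Sum>l\<in>{l. \<sigma> y i l \<noteq> 0}. \<sigma> y i l * \<sigma> (?w \<bullet> h) l j)"
      using sub by (intro sum.mono_neutral_right) auto
    finally show ?thesis .
  qed
  have "translated k q (y # w) ((d, \<sigma>), i, j) f =
      (\<Sum>h\<in>K k. \<Sum>l\<in>{l. \<sigma> y i l \<noteq> 0}. \<sigma> y i l * (q h f * \<sigma> (?w \<bullet> h) l j))"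
    by (simp add: translated_def ev sum_distrib_left mult.left_commute cong: sum.cong)
  also have "\<dots> = (\<Sum>l\<in>{l. \<sigma> y i l \<noteq> 0}. \<sigma> y i l * translated k q w ((d, \<sigma>), l, j) f)"
    by (subst sum.swap) (simp add: translated_def sum_distrib_left)
  finally show "translated k q (y # w) ((d, \<sigma>), i, j) f =
      (\<Sum>l\<in>{l. \<sigma> y i l \<noteq> 0}. \<sigma> y i l * translated k q w ((d, \<sigma>), l, j) f)" .
qed

text \<open>One letter costs at most c (k + 1) operations for each of at most
  \<open>card (K (Suc k))\<close> entries, and only the table for the letters already applied is
  carried along.\<close>

lemma translated_cost:
  assumes w: "w \<in> words k" "set u \<subseteq> set w"
  shows "slp (translated k q [] ` entries (Suc k)) (length u * (card (K (Suc k)) * (c * Suc k)))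
    (translated k q u ` entries (Suc k))"
  using w(2)
proof (induction u)
  case Nil
  show ?case by (simp add: slp.base)
next
  case (Cons y u)
  obtain s where s: "s \<le> k" "y \<in> K (Suc s)" "\<And>h. h \<in> K (s - 1) \<Longrightarrow> y \<bullet> h = h \<bullet> y"
    using letters[OF w(1), of y] Cons.prems by auto
  have y: "y \<in> K (Suc k)" using s K_mono'[of "Suc s" "Suc k"] by auto
  have u: "foldr (\<bullet>) u e \<in> K (Suc k)" using word_in_K[OF w(1)] Cons.prems by auto
  have "slp (translated k q u ` entries (Suc k)) (c * Suc k) {translated k q (y # u) t}"
    if t: "t \<in> entries (Suc k)" for t
  proof -
    obtain d \<sigma> i j where t': "t = ((d, \<sigma>), i, j)" "(d, \<sigma>) \<in> irr (Suc k)" "i < d" "j < d"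
      using t by (auto simp: entries_def)
    have r: "matrix_rep (H (Suc k)) (d, \<sigma>)" using irr_simple[OF t'(2)] by (rule simple_repD(1))
    have sub: "{l. \<sigma> y i l \<noteq> 0} \<subseteq> {..<d}"
      using matrix_repD(1)[OF r] y unfolding mats_def by fastforce
    have "slp (translated k q u ` entries (Suc k)) (card {l. \<sigma> y i l \<noteq> 0}) {translated k q (y # u) t}"
      unfolding t'(1) translated_Cons[OF y u t'(2)]
      by (rule slp_linear_combination) (use finite_subset[OF sub] sub t' in \<open>auto simp: entries_def\<close>)
    moreover have "card {l. \<sigma> y i l \<noteq> 0} \<le> c * Suc k"
      using letter_sparse[OF s(2,3) _ t'(2), of i] s(1) by (auto intro: order_trans)
    ultimately show ?thesis by (rule slp_le)
  qed
  then have "slp (translated k q u ` entries (Suc k)) (card (K (Suc k)) * (c * Suc k))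
      (\<Union>t\<in>entries (Suc k). {translated k q (y # u) t})"
    by (rule slp_UN_le[OF entries(1)]) (use entries(2)[of "Suc k"] in \<open>auto intro: mult_right_mono\<close>)
  moreover have "(\<Union>t\<in>entries (Suc k). {translated k q (y # u) t}) = translated k q (y # u) ` entries (Suc k)"
    by auto
  ultimately have "slp (translated k q u ` entries (Suc k)) (card (K (Suc k)) * (c * Suc k))
      (translated k q (y # u) ` entries (Suc k))" by simp
  from slp_comp[OF Cons.IH this] show ?case using Cons.prems by (simp add: algebra_simps)
qed

text \<open>The factor 1 brings the sum over cosets into the shape required by
  \<open>slp_linear_combination\<close>.\<close>

lemma coefficient_Suc:
  "coefficient (Suc k) q t = (\<lambda>f. \<Sum>w\<in>words k. 1 * translated k (\<lambda>h. q (foldr (\<bullet>) w e \<bullet> h)) w t f)"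
proof -
  obtain a i j where t: "t = (a, i, j)" by (metis surj_pair)
  have "(\<Sum>x\<in>K (Suc k). q x f * snd a x i j) = (\<Sum>w\<in>words k. \<Sum>h\<in>K k.
      q (foldr (\<bullet>) w e \<bullet> h) f * snd a (foldr (\<bullet>) w e \<bullet> h) i j)" for f
    unfolding sum.reindex_bij_betw[OF bij_words[of k], symmetric] sum.cartesian_product
    by (simp add: split_def)
  then show ?thesis by (simp add: coefficient_def translated_def t)
qed

text \<open>At level 0 every coefficient is summed directly. At level k + 1 each coset pays for its
  own transform and for up to k + 1 letters; the last term adds up the contributions of all
  cosets.\<close>

primrec fft_cost :: "nat \<Rightarrow> nat" where
  "fft_cost 0 = card (K 0) * card (K 0)"
| "fft_cost (Suc k) = card (words k) * (fft_cost k + Suc k * (card (K (Suc k)) * (c * Suc k))) +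
    card (K (Suc k)) * card (words k)"

theorem fft: "slp (q ` K k) (fft_cost k) (coefficient k q ` entries k)"
proof (induction k arbitrary: q)
  case 0
  have "slp (q ` K 0) (card (K 0)) {coefficient 0 q t}" if "t \<in> entries 0" for t
  proof -
    obtain a i j where t: "t = (a, i, j)" by (metis surj_pair)
    show ?thesis
      unfolding coefficient_def t prod.case
      by (subst mult.commute, rule slp_linear_combination) (auto simp: finite_K)
  qed
  then have "slp (q ` K 0) (fft_cost 0) (\<Union>t\<in>entries 0. {coefficient 0 q t})"
    by (rule slp_UN_le[OF entries(1)]) (use entries(2)[of 0] in \<open>auto intro: mult_right_mono\<close>)
  then show ?case by (simp only: UNION_singleton_eq_range)
next
  case (Suc k)
  let ?q = "\<lambda>w h. q (foldr (\<bullet>) w e \<bullet> h)"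
  let ?N = "card (K (Suc k))"
  have 1: "slp (q ` K (Suc k)) (fft_cost k + Suc k * (?N * (c * Suc k))) (translated k (?q w) w ` entries (Suc k))"
    if w: "w \<in> words k" for w
  proof -
    have "?q w ` K k \<subseteq> q ` K (Suc k)"
      using word_in_K[OF w order_refl] K_mono[of k] by (auto intro!: K_closed)
    then have A: "slp (q ` K (Suc k)) (fft_cost k) (coefficient k (?q w) ` entries k)"
      by (intro slp_mono_in[OF Suc.IH]) auto
    have B: "slp (coefficient k (?q w) ` entries k) 0 (translated k (?q w) [] ` entries (Suc k))"
      using translated_Nil by (intro slp.base) blast
    have C: "slp (translated k (?q w) [] ` entries (Suc k)) (Suc k * (?N * (c * Suc k)))
        (translated k (?q w) w ` entries (Suc k))"
      by (rule slp_le[OF translated_cost[OF w order_refl]]) (intro mult_le_mono1 length_words w)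
    from slp_comp[OF slp_comp[OF A B] C] show ?thesis by (simp only: add_0_right)
  qed
  have "slp (q ` K (Suc k)) (card (words k) * (fft_cost k + Suc k * (?N * (c * Suc k))))
      (\<Union>w\<in>words k. translated k (?q w) w ` entries (Suc k))"
    by (rule slp_UN_le[OF finite_words 1]) auto
  moreover have "slp (\<Union>w\<in>words k. translated k (?q w) w ` entries (Suc k)) (?N * card (words k))
      (\<Union>t\<in>entries (Suc k). {coefficient (Suc k) q t})"
  proof (rule slp_UN_le[OF entries(1)])
    fix t assume "t \<in> entries (Suc k)"
    then show "slp (\<Union>w\<in>words k. translated k (?q w) w ` entries (Suc k)) (card (words k)) {coefficient (Suc k) q t}"
      unfolding coefficient_Suc by (intro slp_linear_combination finite_words) auto
  qed (use entries(2)[of "Suc k"] in \<open>auto intro: mult_right_mono\<close>)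
  ultimately have "slp (q ` K (Suc k)) (fft_cost (Suc k)) (\<Union>t\<in>entries (Suc k). {coefficient (Suc k) q t})"
    unfolding fft_cost.simps by (rule slp_comp)
  moreover have "(\<Union>t\<in>entries (Suc k). {coefficient (Suc k) q t}) = coefficient (Suc k) q ` entries (Suc k)"
    by auto
  ultimately show ?case by simp
qed

lemma card_K_Suc: "card (K (Suc k)) = card (words k) * card (K k)"
  using bij_betw_same_card[OF bij_words[of k]] by (simp add: card_cartesian_product)

text \<open>By \<open>card_K_Suc\<close> the cost per group element satisfies an additive recursion:
  the step to level k adds at most 2 c^2 k^3, one half for the letters and the other, generously,
  for the summation over cosets. The product \<open>k * k ^ 3\<close> is the number of levels times
  the bound at the top level.\<close>

lemma fft_cost_le: "fft_cost k \<le> (card (K 0) + 2 * c * c * k * k ^ 3) * card (K k)"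
proof (induction k)
  case (Suc k)
  let ?N = "card (K (Suc k))" and ?W = "card (words k)"
  show ?case
  \<comment> \<open>Without words the cost at this level is 0; otherwise c \<ge> 1, so that c is at
    most its square.\<close>
  proof (cases "?W = 0")
    case False
    then have "c \<ge> 1" using card_words[of k] by (cases c) auto
    then have cc: "c * Suc k \<le> c * c * Suc k ^ 3"
      by (metis le_square mult_le_mono power_increasing power_one_right One_nat_def Suc_le_mono le0 numeral_3_eq_3)
    have "?W * (Suc k * (?N * (c * Suc k))) \<le> (c * Suc k) * (Suc k * (?N * (c * Suc k)))"
      using card_words[of k] by (rule mult_le_mono1)
    also have "\<dots> = (c * c * Suc k ^ 3) * ?N" by (simp add: power3_eq_cube algebra_simps)
    finally have 1: "?W * (Suc k * (?N * (c * Suc k))) \<le> (c * c * Suc k ^ 3) * ?N" .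
    have "?N * ?W \<le> ?N * (c * Suc k)" using card_words[of k] by simp
    also have "\<dots> \<le> (c * c * Suc k ^ 3) * ?N" using cc by simp
    finally have 2: "?N * ?W \<le> (c * c * Suc k ^ 3) * ?N" .
    have "?W * fft_cost k \<le> ?W * ((card (K 0) + 2 * c * c * k * k ^ 3) * card (K k))"
      using Suc.IH by (rule mult_le_mono2)
    also have "\<dots> = (card (K 0) + 2 * c * c * k * k ^ 3) * ?N" by (simp add: card_K_Suc)
    also have "\<dots> \<le> (card (K 0) + 2 * c * c * k * Suc k ^ 3) * ?N"
      by (intro mult_le_mono add_le_mono order_refl power_mono) auto
    finally have "fft_cost (Suc k) \<le> (card (K 0) + 2 * c * c * k * Suc k ^ 3) * ?N +
        ((c * c * Suc k ^ 3) * ?N + (c * c * Suc k ^ 3) * ?N)"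
      using 1 2 by (simp only: fft_cost.simps distrib_left)
    also have "\<dots> = (card (K 0) + 2 * c * c * Suc k * Suc k ^ 3) * ?N" by (simp only: algebra_simps mult_Suc)
    finally show ?thesis .
  qed simp
qed simp

end

section \<open>Monomial matrices\<close>

text \<open>A monomial matrix whose column j has its only entry g in row i is the function j \<mapsto> (i, g), continued by
  the identity; this makes the groups of monomial matrices of sizes 0, 1, 2, ... an ascending chain.\<close>

locale wreath = fin_group
begin

definition cmul :: "(nat \<Rightarrow> nat \<times> 'a) \<Rightarrow> (nat \<Rightarrow> nat \<times> 'a) \<Rightarrow> nat \<Rightarrow> nat \<times> 'a" where
  "cmul w v = (\<lambda>j. (fst (w (fst (v j))), snd (w (fst (v j))) \<otimes> snd (v j)))"

definition ce :: "nat \<Rightarrow> nat \<times> 'a" where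
  "ce = (\<lambda>j. (j, \<one>))"

definition K :: "nat \<Rightarrow> (nat \<Rightarrow> nat \<times> 'a) set" where
  "K k = {w. (\<lambda>j. fst (w j)) permutes {..<k} \<and> (\<forall>j. snd (w j) \<in> carrier G) \<and> (\<forall>j\<ge>k. snd (w j) = \<one>)}"

text \<open>Indexed by the larger of the two exchanged points, so that \<open>sw j\<close> lies in
  \<open>K (Suc j)\<close> and fixes everything below j - 1. Only j \<ge> 1 occurs in words.\<close>

definition sw :: "nat \<Rightarrow> nat \<Rightarrow> nat \<times> 'a" where
  "sw j = (\<lambda>t. (Transposition.transpose (j - 1) j t, \<one>))"

definition gl :: "nat \<Rightarrow> 'a \<Rightarrow> nat \<Rightarrow> nat \<times> 'a" where
  "gl k g = (\<lambda>t. (t, if t = k then g else \<one>))"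

text \<open>The coset of an element of \<open>K (Suc k)\<close> modulo \<open>K k\<close> is
  determined by its value (i, g) at column k. The product of the word, read from the right, puts the
  label g at k and then moves k down to i by adjacent transpositions.\<close>

definition word :: "nat \<Rightarrow> nat \<times> 'a \<Rightarrow> (nat \<Rightarrow> nat \<times> 'a) list" where
  "word k = (\<lambda>(i, g). map sw [Suc i..<Suc k] @ [gl k g])"

definition words :: "nat \<Rightarrow> (nat \<Rightarrow> nat \<times> 'a) list set" where
  "words k = word k ` ({..k} \<times> carrier G)"

lemma K_I:
  "(\<lambda>j. fst (w j)) permutes {..<k} \<Longrightarrow> (\<And>j. snd (w j) \<in> carrier G) \<Longrightarrow> (\<And>j. k \<le> j \<Longrightarrow> snd (w j) = \<one>) \<Longrightarrow> w \<in> K k"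
  by (simp add: K_def)

lemma K_D:
  assumes "w \<in> K k"
  shows "(\<lambda>j. fst (w j)) permutes {..<k}" "snd (w j) \<in> carrier G" "k \<le> j \<Longrightarrow> w j = (j, \<one>)"
    "j < k \<Longrightarrow> fst (w j) < k" "fst (w i) = fst (w j) \<longleftrightarrow> i = j"
proof -
  show p: "(\<lambda>j. fst (w j)) permutes {..<k}" and "snd (w j) \<in> carrier G" using assms by (auto simp: K_def)
  show "k \<le> j \<Longrightarrow> w j = (j, \<one>)" using assms permutes_not_in[OF p, of j] by (cases "w j") (auto simp: K_def)
  show "j < k \<Longrightarrow> fst (w j) < k" using permutes_in_image[OF p, of j] by simp
  show "fst (w i) = fst (w j) \<longleftrightarrow> i = j" using permutes_inj[OF p] by (auto simp: inj_def)
qed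

lemma finite_K: "finite (K k)"
proof -
  have "K k \<subseteq> (\<lambda>(p, g) j. (p j, g j)) ` ({p. p permutes {..<k}} \<times>
      {g. \<forall>j. (j \<in> {..<k} \<longrightarrow> g j \<in> carrier G) \<and> (j \<notin> {..<k} \<longrightarrow> g j = \<one>)})"
  proof
    fix w assume "w \<in> K k"
    then show "w \<in> (\<lambda>(p, g) j. (p j, g j)) ` ({p. p permutes {..<k}} \<times>
      {g. \<forall>j. (j \<in> {..<k} \<longrightarrow> g j \<in> carrier G) \<and> (j \<notin> {..<k} \<longrightarrow> g j = \<one>)})"
      by (intro image_eqI[of _ _ "(\<lambda>j. fst (w j), \<lambda>j. snd (w j))"]) (auto simp: K_def)
  qed
  then show ?thesis
    by (rule finite_subset)
      (intro finite_imageI finite_cartesian_product finite_permutations finite_lessThan finite_set_of_finite_funs fin)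
qed

lemma cmul_K:
  assumes "w \<in> K k" "v \<in> K k"
  shows "cmul w v \<in> K k"
proof (rule K_I)
  have "(\<lambda>j. fst (w j)) \<circ> (\<lambda>j. fst (v j)) permutes {..<k}"
    by (rule permutes_compose[OF K_D(1)[OF assms(2)] K_D(1)[OF assms(1)]])
  then show "(\<lambda>j. fst (cmul w v j)) permutes {..<k}" by (simp add: cmul_def comp_def)
  show "snd (cmul w v j) \<in> carrier G" for j using K_D(2)[OF assms(1)] K_D(2)[OF assms(2)] by (simp add: cmul_def)
  show "snd (cmul w v j) = \<one>" if "k \<le> j" for j
    using K_D(3)[OF assms(1) that] K_D(3)[OF assms(2) that] by (simp add: cmul_def)
qed

lemma ce_K: "ce \<in> K k"
  by (rule K_I) (auto simp: ce_def permutes_id[unfolded id_def])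

lemma cmul_assoc:
  assumes "\<And>j. snd (u j) \<in> carrier G" "\<And>j. snd (w j) \<in> carrier G" "\<And>j. snd (v j) \<in> carrier G"
  shows "cmul (cmul u w) v = cmul u (cmul w v)"
  using assms by (simp add: cmul_def m_assoc)

lemma cmul_ce: "(\<And>j. snd (w j) \<in> carrier G) \<Longrightarrow> cmul ce w = w" "(\<And>j. snd (w j) \<in> carrier G) \<Longrightarrow> cmul w ce = w"
  by (auto simp: cmul_def ce_def)

lemma cmul_left_inverse:
  assumes w: "w \<in> K k"
  shows "\<exists>v\<in>K k. cmul v w = ce"
proof -
  define p where "p = (\<lambda>j. fst (w j))"
  have p: "p permutes {..<k}" using K_D(1)[OF w] by (simp add: p_def)
  define v where "v = (\<lambda>i. (Hilbert_Choice.inv p i, m_inv G (snd (w (Hilbert_Choice.inv p i)))))"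
  have "v \<in> K k"
  proof (rule K_I)
    show "(\<lambda>j. fst (v j)) permutes {..<k}" using permutes_inv[OF p] by (simp add: v_def)
    show "snd (v j) \<in> carrier G" for j using K_D(2)[OF w] by (simp add: v_def)
    show "snd (v j) = \<one>" if "k \<le> j" for j
    proof -
      have "Hilbert_Choice.inv p j = j" using permutes_not_in[OF permutes_inv[OF p], of j] that by simp
      then show ?thesis using K_D(3)[OF w that] by (simp add: v_def)
    qed
  qed
  moreover have "cmul v w j = ce j" for j
  proof -
    have "Hilbert_Choice.inv p (fst (w j)) = j" using permutes_inverses(2)[OF p, of j] by (simp add: p_def)
    then show ?thesis using K_D(2)[OF w, of j] by (simp add: cmul_def v_def ce_def l_inv)
  qed
  ultimately show ?thesis by (intro bexI[of _ v]) auto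
qed

lemma fin_group_K: "fin_group \<lparr>carrier = K k, mult = cmul, one = ce\<rparr>"
proof -
  have "group \<lparr>carrier = K k, mult = cmul, one = ce\<rparr>"
  proof (rule groupI, simp_all add: cmul_K ce_K cmul_left_inverse)
    show "cmul (cmul x y) z = cmul x (cmul y z)" if "x \<in> K k" "y \<in> K k" "z \<in> K k" for x y z
      by (rule cmul_assoc; rule K_D(2); rule that)
    show "cmul ce x = x" if "x \<in> K k" for x
      by (rule cmul_ce(1)) (rule K_D(2)[OF that])
  qed
  then show ?thesis by (simp add: fin_group_def fin_group_axioms_def finite_K)
qed

lemma K_Suc_subset: "K k \<subseteq> K (Suc k)"
proof
  fix w assume w: "w \<in> K k"
  show "w \<in> K (Suc k)"
    by (rule K_I) (use permutes_subset[OF K_D(1)[OF w], of "{..<Suc k}"] K_D(2,3)[OF w] in auto)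
qed

lemma sw_K: "1 \<le> j \<Longrightarrow> sw j \<in> K (Suc j)"
  by (rule K_I) (auto simp: sw_def intro!: permutes_swap_id)

lemma gl_K: "g \<in> carrier G \<Longrightarrow> gl k g \<in> K (Suc k)"
  by (rule K_I) (auto simp: gl_def permutes_id[unfolded id_def])

lemma sw_commutes:
  assumes "1 \<le> j" "h \<in> K (j - 1)"
  shows "cmul (sw j) h = cmul h (sw j)"
proof
  fix t
  note h = K_D[OF assms(2)]
  show "cmul (sw j) h t = cmul h (sw j) t"
  proof (cases "t < j - 1")
    case True
    then have "fst (h t) < j - 1" by (rule h(4))
    moreover have "Transposition.transpose (j - 1) j a = a" if "a < j - 1" for a
      using that by (simp add: Transposition.transpose_def)
    ultimately show ?thesis using True h(2)[of t] by (simp add: cmul_def sw_def)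
  next
    case False
    then have "h (Transposition.transpose (j - 1) j t) = (Transposition.transpose (j - 1) j t, \<one>)" "h t = (t, \<one>)"
      using h(3) by (auto simp: Transposition.transpose_def)
    then show ?thesis by (simp add: cmul_def sw_def)
  qed
qed

lemma gl_commutes:
  assumes "g \<in> carrier G" "h \<in> K k"
  shows "cmul (gl k g) h = cmul h (gl k g)"
proof
  fix t
  note h = K_D[OF assms(2)]
  show "cmul (gl k g) h t = cmul h (gl k g) t"
  proof (cases "t < k")
    case True
    then have "fst (h t) < k" by (rule h(4))
    then show ?thesis using True h(2)[of t] by (simp add: cmul_def gl_def)
  next
    case False
    then have "h t = (t, \<one>)" using h(3) by auto
    then show ?thesis using assms by (simp add: cmul_def gl_def)
  qed
qed

lemma word_product_K: "i \<le> k \<Longrightarrow> g \<in> carrier G \<Longrightarrow> foldr cmul (word k (i, g)) ce \<in> K (Suc k)"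
proof -
  assume g: "g \<in> carrier G"
  have "foldr cmul (map sw [Suc i..<Suc k]) v \<in> K (Suc k)" if "v \<in> K (Suc k)" "i \<le> k" for v
    using that(2)
  proof (induction i rule: inc_induct)
    case base
    then show ?case using that by simp
  next
    case (step i)
    have "sw (Suc i) \<in> K (Suc k)"
      using sw_K[of "Suc i"] lift_Suc_mono_le[of K "Suc (Suc i)" "Suc k"] K_Suc_subset step.hyps by auto
    then show ?case using step cmul_K by (simp add: upt_conv_Cons del: upt_Suc)
  qed
  then show "i \<le> k \<Longrightarrow> foldr cmul (word k (i, g)) ce \<in> K (Suc k)"
    using gl_K[OF g] cmul_K ce_K by (simp add: word_def del: upt_Suc)
qed

lemma word_product_last:
  assumes "i \<le> k" "g \<in> carrier G"
  shows "foldr cmul (word k (i, g)) ce k = (i, g)"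
proof -
  have "foldr cmul (map sw [Suc i..<Suc k]) v k = (i, g)" if "v k = (k, g)" for v
    using assms(1)
  proof (induction i rule: inc_induct)
    case base
    then show ?case using that by simp
  next
    case (step i)
    then show ?case using assms(2) by (simp add: upt_conv_Cons cmul_def sw_def del: upt_Suc)
  qed
  then show ?thesis using assms by (simp add: word_def cmul_def gl_def ce_def del: upt_Suc)
qed

text \<open>Elements of \<open>K k\<close> fix column k with label \<one>, so evaluation at k
  recovers the word from a product. Conversely, dividing u by the representative with the same value
  at k leaves an element that fixes k.\<close>

lemma bij_words: "bij_betw (\<lambda>(w, h). cmul (foldr cmul w ce) h) (words k \<times> K k) (K (Suc k))"
proof -
  interpret S: fin_group "\<lparr>carrier = K (Suc k), mult = cmul, one = ce\<rparr>" by (rule fin_group_K)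
  let ?f = "\<lambda>(w, h). cmul (foldr cmul w ce) h"
  have val: "cmul (foldr cmul (word k (i, g)) ce) h k = (i, g)" if "i \<le> k" "g \<in> carrier G" "h \<in> K k" for i g h
    using word_product_last[OF that(1,2)] K_D(3)[OF that(3), of k] that(2) by (simp add: cmul_def)
  have "inj_on ?f (words k \<times> K k)"
  proof (rule inj_onI, clarsimp)
    fix w h w' h' assume a: "w \<in> words k" "h \<in> K k" "w' \<in> words k" "h' \<in> K k"
      "cmul (foldr cmul w ce) h = cmul (foldr cmul w' ce) h'"
    obtain i g i' g' where w: "w = word k (i, g)" "i \<le> k" "g \<in> carrier G" "w' = word k (i', g')" "i' \<le> k" "g' \<in> carrier G"
      using a(1,3) by (auto simp: words_def)
    have "(i, g) = cmul (foldr cmul w ce) h k" using val[OF w(2,3) a(2)] w(1) by simp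
    also have "\<dots> = (i', g')" unfolding a(5) using val[OF w(5,6) a(4)] w(4) by simp
    finally have ww: "w = w'" using w by simp
    then have "cmul (foldr cmul w ce) h = cmul (foldr cmul w ce) h'" using a(5) by simp
    then have "h = h'"
      using S.Units_l_cancel[of "foldr cmul w ce" h h'] S.Units_eq word_product_K[OF w(2,3)] w(1) a(2,4) K_Suc_subset[of k] by auto
    then show "w = w' \<and> h = h'" using ww by simp
  qed
  moreover have "?f ` (words k \<times> K k) = K (Suc k)"
  proof (rule equalityI; rule subsetI)
    fix u assume "u \<in> ?f ` (words k \<times> K k)"
    then show "u \<in> K (Suc k)" using word_product_K K_Suc_subset[of k] by (auto simp: words_def intro!: cmul_K)
  next
    fix u assume u: "u \<in> K (Suc k)"
    obtain i g where ig: "u k = (i, g)" by force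
    have i: "i \<le> k" using K_D(4)[OF u, of k] ig by simp
    have g: "g \<in> carrier G" using K_D(2)[OF u, of k] ig by simp
    define x where "x = foldr cmul (word k (i, g)) ce"
    have x: "x \<in> K (Suc k)" "x k = (i, g)" using word_product_K[OF i g] word_product_last[OF i g] by (auto simp: x_def)
    obtain h where h: "h \<in> K (Suc k)" "cmul x h = u"
      using S.inv_closed[of x] S.m_closed[of "m_inv \<lparr>carrier = K (Suc k), mult = cmul, one = ce\<rparr> x" u]
        S.m_assoc[of x "m_inv \<lparr>carrier = K (Suc k), mult = cmul, one = ce\<rparr> x" u] S.r_inv[of x] S.l_one[of u] x(1) u
      by (intro that[of "cmul (m_inv \<lparr>carrier = K (Suc k), mult = cmul, one = ce\<rparr> x) u"]) simp_all
    have hk: "cmul x h k = x k" using h(2) ig x(2) by simp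
    then have "fst (h k) = k" using K_D(5)[OF x(1), of "fst (h k)" k] by (simp add: cmul_def) (metis fst_conv)
    moreover have "snd (h k) = \<one>"
      using hk calculation x(2) g K_D(2)[OF h(1), of k] l_cancel_one[of g "snd (h k)"]
      by (simp add: cmul_def)
    ultimately have hk: "h k = (k, \<one>)" by (cases "h k") auto
    have "h \<in> K k"
    proof (rule K_I)
      show "(\<lambda>j. fst (h j)) permutes {..<k}"
        by (rule permutes_superset[OF K_D(1)[OF h(1)]]) (use hk in \<open>auto simp: less_Suc_eq\<close>)
      show "snd (h j) \<in> carrier G" for j by (rule K_D(2)[OF h(1)])
      show "snd (h j) = \<one>" if "k \<le> j" for j
        using hk K_D(3)[OF h(1), of j] that by (cases "j = k") auto
    qed
    then show "u \<in> ?f ` (words k \<times> K k)"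
      using h(2) i g by (intro image_eqI[of _ _ "(word k (i, g), h)"]) (auto simp: x_def words_def)
  qed
  ultimately show ?thesis by (simp add: bij_betw_def)
qed

sublocale chain: group_chain K cmul ce words "card (carrier G)"
proof (rule group_chain.intro)
  fix k
  show "fin_group \<lparr>carrier = K k, mult = cmul, one = ce\<rparr>" by (rule fin_group_K)
  show "K k \<subseteq> K (Suc k)" by (rule K_Suc_subset)
  show "finite (words k)" using fin by (simp add: words_def)
  have "card (words k) \<le> card ({..k} \<times> carrier G)" unfolding words_def by (rule card_image_le) (simp add: fin)
  then show "card (words k) \<le> card (carrier G) * Suc k" by (simp add: card_cartesian_product mult.commute)
  show "bij_betw (\<lambda>(w, h). cmul (foldr cmul w ce) h) (words k \<times> K k) (K (Suc k))" by (rule bij_words)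
  fix w assume "w \<in> words k"
  then obtain i g where w: "w = word k (i, g)" "i \<le> k" "g \<in> carrier G" by (auto simp: words_def)
  show "length w \<le> Suc k" using w(2) by (simp add: w(1) word_def del: upt_Suc)
  fix y assume "y \<in> set w"
  \<comment> \<open>A transposition is a letter at the level of its index, a label a letter at level
    k.\<close>
  then consider j where "y = sw j" "1 \<le> j" "j \<le> k" | "y = gl k g"
    by (auto simp: w(1) word_def simp del: upt_Suc)
  then show "\<exists>j\<le>k. y \<in> K (Suc j) \<and> (\<forall>h\<in>K (j - 1). cmul y h = cmul h y)"
  proof cases
    case (1 j)
    then show ?thesis using sw_K sw_commutes by blast
  next
    case 2
    have "K (k - 1) \<subseteq> K k" using K_Suc_subset[of "k - 1"] by (cases k) auto
    then show ?thesis using 2 gl_K[OF w(3), of k] gl_commutes[OF w(3), of _ k] by blast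
  qed
qed

end

section \<open>From abstract computations to straight-line programs\<close>

lemma run_append: "run f (p @ q) = foldl (\<lambda>rs (u, v, z).
      rs @ [operand_value f rs u * operand_value f rs v + operand_value f rs z]) (run f p) q"
  by (simp add: run_def)

lemma length_run: "length (run f p) = length p"
  by (induction p rule: rev_induct) (auto simp: run_append run_def split: prod.splits)

lemma operand_value_append: "available S (length p) x \<Longrightarrow> operand_value f (run f (p @ [c])) x = operand_value f (run f p) x"
  by (cases c; cases x) (auto simp: run_append length_run nth_append)

definition realizes :: "('s, 'b) monoid_scheme \<Rightarrow> 's program \<Rightarrow> (('s \<Rightarrow> complex) \<Rightarrow> complex) \<Rightarrow> bool" where
  "realizes S p u \<longleftrightarrow> (\<exists>x. available S (length p) x \<and> (\<forall>f. operand_value f (run f p) x = u f))"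

lemma available_mono: "available S m x \<Longrightarrow> m \<le> m' \<Longrightarrow> available S m' x"
  by (cases x) auto

lemma realizes_append: "realizes S p u \<Longrightarrow> realizes S (p @ [c]) u"
  unfolding realizes_def using operand_value_append available_mono by (metis length_append le_add1)

lemma valid_program_append:
  "valid_program S p \<Longrightarrow> available S (length p) u \<Longrightarrow> available S (length p) v \<Longrightarrow> available S (length p) z \<Longrightarrow>
    valid_program S (p @ [(u, v, z)])"
  by (auto simp: valid_program_def nth_append less_Suc_eq)

text \<open>Each operation appends one instruction. Appending changes neither earlier results nor
  the operands that refer to them, so available quantities stay realized and the induction proceeds
  with a longer p.\<close>

lemma slp_program:
  assumes "slp A n B" "valid_program S p" "\<And>a. a \<in> A \<Longrightarrow> realizes S p a"
  shows "\<exists>p'. valid_program S p' \<and> length p' = length p + n \<and> (\<forall>b\<in>B. realizes S p' b)"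
  using assms
proof (induction arbitrary: p rule: slp.induct)
  case (base B A)
  have "realizes S p (\<lambda>f. c)" for c
    unfolding realizes_def by (intro exI[of _ "Const c"]) auto
  then show ?case using base by (intro exI[of _ p]) auto
next
  case (step u A v z n B)
  have const: "realizes S p (\<lambda>f. c)" for c
    unfolding realizes_def by (intro exI[of _ "Const c"]) auto
  then have "realizes S p u" "realizes S p v" "realizes S p z" using step.hyps(1-3) step.prems(2) by auto
  then obtain x y w where x: "available S (length p) x" "\<And>f. operand_value f (run f p) x = u f"
    and y: "available S (length p) y" "\<And>f. operand_value f (run f p) y = v f"
    and w: "available S (length p) w" "\<And>f. operand_value f (run f p) w = z f"
    unfolding realizes_def by blast
  let ?p = "p @ [(x, y, w)]"
  have "realizes S ?p (\<lambda>f. u f * v f + z f)"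
    unfolding realizes_def
    by (rule exI[of _ "Result (length p)"]) (simp add: run_append nth_append length_run x y w)
  then have "realizes S ?p a" if "a \<in> insert (\<lambda>f. u f * v f + z f) A" for a
    using that step.prems(2) realizes_append by blast
  from step.IH[OF valid_program_append[OF step.prems(1) x(1) y(1) w(1)] this] show ?case by auto
qed

section \<open>The rook wreath product as a semigroup of partial maps\<close>

lemma zmult_None [simp]: "zmult G x None = None"
  by (cases x) auto

lemma zadd_None [simp]: "zadd x None = x"
  by (cases x) auto

lemma option_eqI: "(\<And>g. x = Some g \<longleftrightarrow> y = Some g) \<Longrightarrow> x = y"
  by (cases x; cases y) auto

lemma zsum_None: "(\<And>k. k < n \<Longrightarrow> x k = None) \<Longrightarrow> zsum n x = None"
  by (induction n) auto

lemma zsum_single: "i < n \<Longrightarrow> (\<And>k. k < n \<Longrightarrow> k \<noteq> i \<Longrightarrow> x k = None) \<Longrightarrow> zsum n x = x i"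
proof (induction n)
  case (Suc n)
  show ?case
  proof (cases "i = n")
    case True
    then have "zsum n x = None" using Suc.prems(2) by (intro zsum_None) auto
    then show ?thesis using True by simp
  next
    case False
    then have "zsum n x = x i" using Suc by auto
    moreover have "x n = None" using Suc.prems(2)[of n] False by auto
    ultimately show ?thesis by simp
  qed
qed simp

context wreath
begin

text \<open>Rook matrices read column by column, in the orientation used for \<open>K\<close>;
  \<open>None\<close> marks an empty column.\<close>

definition Phi :: "nat \<Rightarrow> (nat \<Rightarrow> (nat \<times> 'a) option) set" where
  "Phi n = {\<phi>. dom \<phi> \<subseteq> {..<n} \<and> (\<forall>j i g. \<phi> j = Some (i, g) \<longrightarrow> i < n \<and> g \<in> carrier G) \<and>
    (\<forall>j j' i g g'. \<phi> j = Some (i, g) \<longrightarrow> \<phi> j' = Some (i, g') \<longrightarrow> j = j')}"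

definition pmul :: "(nat \<Rightarrow> (nat \<times> 'a) option) \<Rightarrow> (nat \<Rightarrow> (nat \<times> 'a) option) \<Rightarrow> nat \<Rightarrow> (nat \<times> 'a) option" where
  "pmul \<phi> \<psi> = (\<lambda>j. case \<psi> j of None \<Rightarrow> None
    | Some (i, g) \<Rightarrow> (case \<phi> i of None \<Rightarrow> None | Some (l, h) \<Rightarrow> Some (l, h \<otimes> g)))"

definition toM :: "nat \<Rightarrow> (nat \<Rightarrow> (nat \<times> 'a) option) \<Rightarrow> 'a option mat" where
  "toM n \<phi> = mat n n (\<lambda>(i, j). case \<phi> j of None \<Rightarrow> None | Some (l, g) \<Rightarrow> if l = i then Some g else None)"

lemma PhiD:
  assumes "\<phi> \<in> Phi n"
  shows "dom \<phi> \<subseteq> {..<n}" "\<phi> j = Some (i, g) \<Longrightarrow> j < n" "\<phi> j = Some (i, g) \<Longrightarrow> i < n"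
    "\<phi> j = Some (i, g) \<Longrightarrow> g \<in> carrier G" "\<phi> j = Some (i, g) \<Longrightarrow> \<phi> j' = Some (i, g') \<Longrightarrow> j = j'"
  using assms unfolding Phi_def by (auto simp: subset_iff domIff)

lemma PhiI:
  assumes "\<And>j i g. \<phi> j = Some (i, g) \<Longrightarrow> j < n \<and> i < n \<and> g \<in> carrier G"
    "\<And>j j' i g g'. \<phi> j = Some (i, g) \<Longrightarrow> \<phi> j' = Some (i, g') \<Longrightarrow> j = j'"
  shows "\<phi> \<in> Phi n"
  using assms unfolding Phi_def by fastforce

lemma finite_Phi: "finite (Phi n)"
proof -
  have "Phi n \<subseteq> {\<phi>. \<forall>j. (j \<in> {..<n} \<longrightarrow> \<phi> j \<in> insert None (Some ` ({..<n} \<times> carrier G))) \<and> (j \<notin> {..<n} \<longrightarrow> \<phi> j = None)}"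
  proof (intro subsetI CollectI allI conjI impI)
    fix \<phi> j assume p: "\<phi> \<in> Phi n"
    show "\<phi> j \<in> insert None (Some ` ({..<n} \<times> carrier G))"
      using PhiD(3,4)[OF p, of j] by (cases "\<phi> j") auto
    show "\<phi> j = None" if "j \<notin> {..<n}" using PhiD(1)[OF p] that by (auto simp: domIff)
  qed
  then show ?thesis
    by (rule finite_subset) (intro finite_set_of_finite_funs finite_insert[THEN iffD2] finite_imageI
      finite_cartesian_product finite_lessThan fin)
qed

lemma pmul_Some: "pmul \<phi> \<psi> j = Some (l, x) \<longleftrightarrow> (\<exists>i g h. \<psi> j = Some (i, g) \<and> \<phi> i = Some (l, h) \<and> x = h \<otimes> g)"
  by (auto simp: pmul_def split: option.splits)

lemma pmul_Phi:
  assumes \<phi>: "\<phi> \<in> Phi n" and \<psi>: "\<psi> \<in> Phi n"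
  shows "pmul \<phi> \<psi> \<in> Phi n"
proof (rule PhiI)
  fix j l x assume "pmul \<phi> \<psi> j = Some (l, x)"
  then obtain i g h where "\<psi> j = Some (i, g)" "\<phi> i = Some (l, h)" "x = h \<otimes> g" by (auto simp: pmul_Some)
  then show "j < n \<and> l < n \<and> x \<in> carrier G" using PhiD(2,4)[OF \<psi>] PhiD(3,4)[OF \<phi>] by blast
next
  fix j j' l x x' assume "pmul \<phi> \<psi> j = Some (l, x)" "pmul \<phi> \<psi> j' = Some (l, x')"
  then obtain i g h i' g' h' where "\<psi> j = Some (i, g)" "\<phi> i = Some (l, h)"
    "\<psi> j' = Some (i', g')" "\<phi> i' = Some (l, h')" by (auto simp: pmul_Some)
  then show "j = j'" using PhiD(5)[OF \<phi>] PhiD(5)[OF \<psi>] by blast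
qed

lemma toM_entry: "i < n \<Longrightarrow> j < n \<Longrightarrow> toM n \<phi> $$ (i, j) = Some g \<longleftrightarrow> \<phi> j = Some (i, g)"
  by (auto simp: toM_def split: option.splits if_splits)

lemma bij_toM: "bij_betw (toM n) (Phi n) (carrier (rook_wreath G n))"
proof -
  have inj: "inj_on (toM n) (Phi n)"
  proof (rule inj_onI)
    fix \<phi> \<psi> assume a: "\<phi> \<in> Phi n" "\<psi> \<in> Phi n" "toM n \<phi> = toM n \<psi>"
    have iff: "\<phi> j = Some (i, g) \<longleftrightarrow> \<psi> j = Some (i, g)" for i j g
      using PhiD(2,3)[OF a(1), of j i g] PhiD(2,3)[OF a(2), of j i g] toM_entry[of i n j \<phi> g] toM_entry[of i n j \<psi> g] a(3)
      by (cases "i < n \<and> j < n") auto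
    then have "\<phi> j = Some x \<longleftrightarrow> \<psi> j = Some x" for j x by (cases x) blast
    then show "\<phi> = \<psi>" by (intro ext option_eqI)
  qed
  have ne: "toM n \<phi> $$ (i, j) \<noteq> None \<longleftrightarrow> (\<exists>g. \<phi> j = Some (i, g))" if "i < n" "j < n" for \<phi> i j
    using toM_entry[OF that, of \<phi>] by (auto simp: not_None_eq)
  have "toM n \<phi> \<in> carrier (rook_wreath G n)" if p: "\<phi> \<in> Phi n" for \<phi>
  proof -
    have "toM n \<phi> $$ (i, j) \<in> {None} \<union> Some ` carrier G" if "i < n" "j < n" for i j
      using toM_entry[OF that, of \<phi>] PhiD(4)[OF p, of j i] by (cases "toM n \<phi> $$ (i, j)") auto
    moreover have "j = k" if "i < n" "j < n" "k < n" "toM n \<phi> $$ (i, j) \<noteq> None" "toM n \<phi> $$ (i, k) \<noteq> None" for i j k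
      using that ne PhiD(5)[OF p] by metis
    moreover have "j = k" if "i < n" "j < n" "k < n" "toM n \<phi> $$ (j, i) \<noteq> None" "toM n \<phi> $$ (k, i) \<noteq> None" for i j k
      using that ne by (metis option.inject prod.inject)
    moreover have "toM n \<phi> \<in> carrier_mat n n" by (simp add: toM_def)
    ultimately show ?thesis unfolding rook_wreath_def by simp
  qed
  moreover have "\<exists>\<phi>\<in>Phi n. A = toM n \<phi>" if A: "A \<in> carrier (rook_wreath G n)" for A
  proof -
    have A1: "A \<in> carrier_mat n n" "\<And>i j. i < n \<Longrightarrow> j < n \<Longrightarrow> A $$ (i, j) \<in> {None} \<union> Some ` carrier G"
      and A2: "\<And>i j k. i < n \<Longrightarrow> j < n \<Longrightarrow> k < n \<Longrightarrow> A $$ (i, j) \<noteq> None \<Longrightarrow> A $$ (i, k) \<noteq> None \<Longrightarrow> j = k"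
      and A3: "\<And>i j k. i < n \<Longrightarrow> j < n \<Longrightarrow> k < n \<Longrightarrow> A $$ (j, i) \<noteq> None \<Longrightarrow> A $$ (k, i) \<noteq> None \<Longrightarrow> j = k"
      using A unfolding rook_wreath_def by simp_all
    define \<phi> where "\<phi> = (\<lambda>j. if j < n \<and> (\<exists>i<n. A $$ (i, j) \<noteq> None)
      then (let i = (SOME i. i < n \<and> A $$ (i, j) \<noteq> None) in Some (i, the (A $$ (i, j)))) else None)"
    have phi: "\<phi> j = Some (i, g) \<longleftrightarrow> i < n \<and> j < n \<and> A $$ (i, j) = Some g" for i j g
    proof
      assume a: "\<phi> j = Some (i, g)"
      then have c: "j < n \<and> (\<exists>i<n. A $$ (i, j) \<noteq> None)" by (auto simp: \<phi>_def split: if_splits)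
      then have "(SOME i. i < n \<and> A $$ (i, j) \<noteq> None) < n \<and> A $$ (SOME i. i < n \<and> A $$ (i, j) \<noteq> None, j) \<noteq> None"
        by (intro someI_ex[of "\<lambda>i. i < n \<and> A $$ (i, j) \<noteq> None"]) auto
      then show "i < n \<and> j < n \<and> A $$ (i, j) = Some g" using a c by (auto simp: \<phi>_def Let_def)
    next
      assume a: "i < n \<and> j < n \<and> A $$ (i, j) = Some g"
      then have c: "j < n \<and> (\<exists>i<n. A $$ (i, j) \<noteq> None)" by auto
      then have s: "(SOME i. i < n \<and> A $$ (i, j) \<noteq> None) < n \<and> A $$ (SOME i. i < n \<and> A $$ (i, j) \<noteq> None, j) \<noteq> None"
        by (intro someI_ex[of "\<lambda>i. i < n \<and> A $$ (i, j) \<noteq> None"]) auto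
      then have "(SOME i. i < n \<and> A $$ (i, j) \<noteq> None) = i" using A3[of j _ i] a by auto
      then show "\<phi> j = Some (i, g)" using a c by (simp add: \<phi>_def Let_def)
    qed
    have "\<phi> \<in> Phi n"
    proof (rule PhiI)
      fix j i g assume "\<phi> j = Some (i, g)"
      then have "i < n" "j < n" "A $$ (i, j) = Some g" using phi by auto
      then show "j < n \<and> i < n \<and> g \<in> carrier G" using A1(2)[of i j] by auto
    next
      fix j j' i g g' assume "\<phi> j = Some (i, g)" "\<phi> j' = Some (i, g')"
      then show "j = j'" using phi A2[of i j j'] by auto
    qed
    moreover have "A = toM n \<phi>"
    proof (rule eq_matI)
      fix i j assume "i < dim_row (toM n \<phi>)" "j < dim_col (toM n \<phi>)"
      then have ij: "i < n" "j < n" by (auto simp: toM_def)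
      have "A $$ (i, j) = Some g \<longleftrightarrow> toM n \<phi> $$ (i, j) = Some g" for g
        using toM_entry[OF ij, of \<phi> g] phi[of j i g] ij by simp
      then show "A $$ (i, j) = toM n \<phi> $$ (i, j)" by (rule option_eqI)
    qed (use A1 in \<open>auto simp: toM_def\<close>)
    ultimately show ?thesis by blast
  qed
  ultimately show ?thesis using inj by (auto simp: bij_betw_def)
qed

text \<open>Column j of \<psi> has at most one entry, so every \<open>zsum\<close> has at most one
  term other than \<open>None\<close>, and the unspecified sum of two group elements is never
  met.\<close>

lemma toM_pmul:
  assumes \<phi>: "\<phi> \<in> Phi n" and \<psi>: "\<psi> \<in> Phi n"
  shows "toM n (pmul \<phi> \<psi>) = toM n \<phi> \<otimes>\<^bsub>rook_wreath G n\<^esub> toM n \<psi>"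
proof (rule eq_matI)
  fix l j assume "l < dim_row (toM n \<phi> \<otimes>\<^bsub>rook_wreath G n\<^esub> toM n \<psi>)" "j < dim_col (toM n \<phi> \<otimes>\<^bsub>rook_wreath G n\<^esub> toM n \<psi>)"
  then have lj: "l < n" "j < n" by (auto simp: rook_wreath_def)
  have "zsum n (\<lambda>k. zmult G (toM n \<phi> $$ (l, k)) (toM n \<psi> $$ (k, j))) = toM n (pmul \<phi> \<psi>) $$ (l, j)"
  proof (cases "\<psi> j")
    case None
    then have "toM n \<psi> $$ (k, j) = None" if "k < n" for k using that lj by (simp add: toM_def)
    then have "zsum n (\<lambda>k. zmult G (toM n \<phi> $$ (l, k)) (toM n \<psi> $$ (k, j))) = None"
      by (intro zsum_None) simp
    then show ?thesis using None lj by (simp add: toM_def pmul_def)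
  next
    case (Some p)
    obtain i g where p: "p = (i, g)" by force
    have i: "i < n" using PhiD(3)[OF \<psi>] Some p by auto
    have "toM n \<psi> $$ (k, j) = (if k = i then Some g else None)" if "k < n" for k
      using that lj Some p by (auto simp: toM_def)
    then have "zsum n (\<lambda>k. zmult G (toM n \<phi> $$ (l, k)) (toM n \<psi> $$ (k, j))) = zmult G (toM n \<phi> $$ (l, i)) (Some g)"
      using i by (subst zsum_single[OF i]) simp_all
    also have "\<dots> = toM n (pmul \<phi> \<psi>) $$ (l, j)"
      using lj i Some p by (auto simp: toM_def pmul_def split: option.splits)
    finally show ?thesis .
  qed
  then show "toM n (pmul \<phi> \<psi>) $$ (l, j) = (toM n \<phi> \<otimes>\<^bsub>rook_wreath G n\<^esub> toM n \<psi>) $$ (l, j)"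
    using lj by (simp add: rook_wreath_def)
qed (auto simp: rook_wreath_def toM_def)

subsection \<open>Summation over extensions\<close>

text \<open>Only the columns below m of an extension are free, so that m = 0 leaves just t, and the sums for Suc m are
  obtained from those for m by varying column m.\<close>

definition extensions :: "nat \<Rightarrow> nat \<Rightarrow> (nat \<Rightarrow> (nat \<times> 'a) option) \<Rightarrow> (nat \<Rightarrow> (nat \<times> 'a) option) set" where
  "extensions n m t = {s \<in> Phi n. \<forall>j. j \<in> dom t \<or> m \<le> j \<longrightarrow> s j = t j}"

definition zeta :: "nat \<Rightarrow> ((nat \<Rightarrow> (nat \<times> 'a) option) \<Rightarrow> 'f \<Rightarrow> complex) \<Rightarrow> nat \<Rightarrow> (nat \<Rightarrow> (nat \<times> 'a) option) \<Rightarrow> 'f \<Rightarrow> complex" where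
  "zeta n q m t = (\<lambda>f. \<Sum>s\<in>extensions n m t. q s f)"

lemma extensions_Suc_dom:
  assumes "m \<in> dom t"
  shows "extensions n (Suc m) t = extensions n m t"
proof -
  have "j \<in> dom t \<or> Suc m \<le> j \<longleftrightarrow> j \<in> dom t \<or> m \<le> j" for j
    using assms by (cases "j = m") (auto simp del: domIff)
  then show ?thesis by (simp add: extensions_def del: domIff)
qed

text \<open>The updated map is a restriction of s, since it agrees with s at m and on the domain of
  t; injectivity and the ranges are inherited.\<close>

lemma Phi_update:
  assumes t: "t \<in> Phi n" and s: "s \<in> Phi n" and ext: "\<And>j. j \<in> dom t \<Longrightarrow> s j = t j"
  shows "t(m := s m) \<in> Phi n"
proof (rule PhiI)
  have sub: "s j = Some x" if "(t(m := s m)) j = Some x" for j x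
    using that ext[of j] by (auto split: if_splits)
  fix j i g assume "(t(m := s m)) j = Some (i, g)"
  from sub[OF this] show "j < n \<and> i < n \<and> g \<in> carrier G" using PhiD(2,3,4)[OF s] by blast
next
  have sub: "s j = Some x" if "(t(m := s m)) j = Some x" for j x
    using that ext[of j] by (auto split: if_splits)
  fix j j' i g g' assume "(t(m := s m)) j = Some (i, g)" "(t(m := s m)) j' = Some (i, g')"
  from this[THEN sub] show "j = j'" using PhiD(5)[OF s] by blast
qed

text \<open>The extensions for \<open>Suc m\<close> are partitioned by their value in column m,
  which is empty or one of n |G| pairs. Values that would violate injectivity are excluded from X,
  so all sums stay in the table indexed by \<open>Phi n\<close>.\<close>

lemma zeta_step:
  assumes t: "t \<in> Phi n" and m: "t m = None"
  defines "X \<equiv> {t' \<in> Phi n. \<forall>j. j \<noteq> m \<longrightarrow> t' j = t j}"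
  shows "zeta n q (Suc m) t = (\<lambda>f. \<Sum>t'\<in>X. 1 * zeta n q m t' f)" "card X \<le> Suc (n * card (carrier G))" "finite X"
proof -
  show finX: "finite X" unfolding X_def using finite_Phi by simp
  have "X \<subseteq> (\<lambda>x. t(m := x)) ` insert None (Some ` ({..<n} \<times> carrier G))"
  proof
    fix t' assume t': "t' \<in> X"
    then have "t' = t(m := t' m)" unfolding X_def by (intro ext) simp
    moreover have "t' m \<in> insert None (Some ` ({..<n} \<times> carrier G))"
      using t' PhiD(3,4)[of t' n m] by (cases "t' m") (auto simp: X_def)
    ultimately show "t' \<in> (\<lambda>x. t(m := x)) ` insert None (Some ` ({..<n} \<times> carrier G))"
      by (rule image_eqI)
  qed
  then have "card X \<le> card (insert None (Some ` ({..<n} \<times> carrier G)))"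
    by (rule surj_card_le[rotated]) (simp add: fin)
  also have "\<dots> = Suc (card ({..<n} \<times> carrier G))"
    by (subst card_insert_disjoint) (auto simp: fin card_image)
  finally show "card X \<le> Suc (n * card (carrier G))" by (simp add: card_cartesian_product)
  have un: "extensions n (Suc m) t = (\<Union>t'\<in>X. extensions n m t')"
  proof (rule equalityI; rule subsetI)
    fix s assume s: "s \<in> extensions n (Suc m) t"
    then have "s \<in> Phi n" "\<And>j. j \<in> dom t \<Longrightarrow> s j = t j" unfolding extensions_def by blast+
    then have "t(m := s m) \<in> X" using Phi_update[OF t, of s m] unfolding X_def by simp
    moreover have "s \<in> extensions n m (t(m := s m))"
    proof -
      have "s j = (t(m := s m)) j" if "j \<in> dom (t(m := s m)) \<or> m \<le> j" for j
      proof (cases "j = m")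
        case False
        then have "j \<in> dom t \<or> Suc m \<le> j" using that by (auto simp: dom_def simp del: dom_fun_upd)
        then have "s j = t j" using s unfolding extensions_def mem_Collect_eq by (elim conjE allE[of _ j] impE)
        then show ?thesis using False by simp
      qed simp
      then show ?thesis using \<open>s \<in> Phi n\<close> unfolding extensions_def by (intro CollectI conjI allI impI)
    qed
    ultimately show "s \<in> (\<Union>t'\<in>X. extensions n m t')" by blast
  next
    fix s assume "s \<in> (\<Union>t'\<in>X. extensions n m t')"
    then obtain t' where t': "t' \<in> Phi n" "\<And>j. j \<noteq> m \<Longrightarrow> t' j = t j" "s \<in> extensions n m t'" by (auto simp: X_def)
    have "s j = t j" if "j \<in> dom t \<or> Suc m \<le> j" for j
    proof -
      have "j \<noteq> m" using that m by auto
      then have "t' j = t j" by (rule t'(2))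
      moreover have "s j = t' j" using t'(3) that \<open>t' j = t j\<close> unfolding extensions_def by (auto simp: dom_def)
      ultimately show ?thesis by simp
    qed
    moreover have "s \<in> Phi n" using t'(3) by (simp add: extensions_def)
    ultimately show "s \<in> extensions n (Suc m) t" unfolding extensions_def by blast
  qed
  have disj: "extensions n m t1 \<inter> extensions n m t2 = {}" if "t1 \<in> X" "t2 \<in> X" "t1 \<noteq> t2" for t1 t2
  proof -
    have "t1 m \<noteq> t2 m"
    proof
      assume eq: "t1 m = t2 m"
      have "t1 j = t j" "t2 j = t j" if "j \<noteq> m" for j
        using that \<open>t1 \<in> X\<close> \<open>t2 \<in> X\<close> unfolding X_def by blast+
      then have "t1 = t2" using eq by (metis ext)
      then show False using that(3) by contradiction
    qed
    moreover have "s m = t m" if "s \<in> extensions n m t" for s t using that by (simp add: extensions_def)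
    ultimately show ?thesis by (metis disjoint_iff)
  qed
  have fe: "finite (extensions n m t')" for t' unfolding extensions_def using finite_Phi by simp
  show "zeta n q (Suc m) t = (\<lambda>f. \<Sum>t'\<in>X. 1 * zeta n q m t' f)"
  proof
    fix f
    have "zeta n q (Suc m) t f = (\<Sum>t'\<in>X. \<Sum>s\<in>extensions n m t'. q s f)"
      unfolding zeta_def un
      by (rule sum.UNION_disjoint[OF finX]) (simp_all add: fe disj)
    then show "zeta n q (Suc m) t f = (\<Sum>t'\<in>X. 1 * zeta n q m t' f)" by (simp add: zeta_def)
  qed
qed

text \<open>The table indexed by \<open>Phi n\<close> is updated once per column. Entries for maps
  already defined at that column are carried over without any operation.\<close>

lemma zeta_cost: "slp (q ` Phi n) (m * (card (Phi n) * Suc (n * card (carrier G)))) (zeta n q m ` Phi n)"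
proof (induction m)
  case 0
  have "zeta n q 0 t = q t" if "t \<in> Phi n" for t
  proof -
    have "extensions n 0 t = {t}" using that by (auto simp: extensions_def)
    then show ?thesis by (simp add: zeta_def)
  qed
  then show ?case by (auto intro!: slp.base)
next
  case (Suc m)
  let ?c = "Suc (n * card (carrier G))"
  have "slp (zeta n q m ` Phi n) ?c {zeta n q (Suc m) t}" if t: "t \<in> Phi n" for t
  proof (cases "t m")
    case None
    note z = zeta_step[OF t None]
    show ?thesis unfolding z(1)
      by (rule slp_le[OF slp_linear_combination z(2)]) (use z(3) in auto)
  next
    case (Some x)
    then have "zeta n q (Suc m) t = zeta n q m t" using extensions_Suc_dom[of m t n, OF domI] by (simp add: zeta_def)
    then have "slp (zeta n q m ` Phi n) 0 {zeta n q (Suc m) t}" using t by (intro slp.base) auto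
    then show ?thesis by (rule slp_le) simp
  qed
  then have "slp (zeta n q m ` Phi n) (card (Phi n) * ?c) (\<Union>t\<in>Phi n. {zeta n q (Suc m) t})"
    by (rule slp_UN_le[OF finite_Phi _ order_refl])
  then have "slp (zeta n q m ` Phi n) (card (Phi n) * ?c) (zeta n q (Suc m) ` Phi n)"
    by (simp only: UNION_singleton_eq_range)
  from slp_comp[OF Suc.IH this] show ?case by (simp add: algebra_simps)
qed

end

section \<open>Partial maps between equally large subsets in normal form\<close>

context wreath
begin

text \<open>Here en J enumerates J in increasing order and ix J is its inverse; tt J and ts J are the partial maps with
  labels \<open>\<one>\<close> that they induce between an initial segment and J.\<close>

definition en :: "nat set \<Rightarrow> nat \<Rightarrow> nat" where
  "en J i = sorted_list_of_set J ! i"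

definition ix :: "nat set \<Rightarrow> nat \<Rightarrow> nat" where
  "ix J = the_inv_into {..<card J} (en J)"

definition pid :: "nat set \<Rightarrow> nat \<Rightarrow> (nat \<times> 'a) option" where
  "pid J = (\<lambda>j. if j \<in> J then Some (j, \<one>) else None)"

definition tt :: "nat set \<Rightarrow> nat \<Rightarrow> (nat \<times> 'a) option" where
  "tt J = (\<lambda>i. if i < card J then Some (en J i, \<one>) else None)"

definition ts :: "nat set \<Rightarrow> nat \<Rightarrow> (nat \<times> 'a) option" where
  "ts J = (\<lambda>j. if j \<in> J then Some (ix J j, \<one>) else None)"

definition emb :: "nat \<Rightarrow> (nat \<Rightarrow> nat \<times> 'a) \<Rightarrow> nat \<Rightarrow> (nat \<times> 'a) option" where
  "emb k w = (\<lambda>j. if j < k then Some (w j) else None)"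

text \<open>The partial map from J onto L that becomes w when both sets are enumerated in increasing order.\<close>

definition mk :: "nat set \<Rightarrow> nat set \<Rightarrow> (nat \<Rightarrow> nat \<times> 'a) \<Rightarrow> nat \<Rightarrow> (nat \<times> 'a) option" where
  "mk L J w = (\<lambda>j. if j \<in> J then Some (en L (fst (w (ix J j))), snd (w (ix J j))) else None)"

definition im :: "(nat \<Rightarrow> (nat \<times> 'a) option) \<Rightarrow> nat set" where
  "im \<phi> = {i. \<exists>j g. \<phi> j = Some (i, g)}"

lemma bij_en: "finite J \<Longrightarrow> bij_betw (en J) {..<card J} J"
  unfolding en_def by (rule bij_betw_nth) auto

lemma en_in: "finite J \<Longrightarrow> i < card J \<Longrightarrow> en J i \<in> J"
  using bij_betwE[OF bij_en, of J] by auto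

lemma ix_less: "finite J \<Longrightarrow> j \<in> J \<Longrightarrow> ix J j < card J"
  using bij_betwE[OF bij_betw_the_inv_into[OF bij_en], of J] unfolding ix_def by auto

lemma en_ix: "finite J \<Longrightarrow> j \<in> J \<Longrightarrow> en J (ix J j) = j"
  unfolding ix_def by (rule f_the_inv_into_f_bij_betw[OF bij_en]) auto

lemma ix_en: "finite J \<Longrightarrow> i < card J \<Longrightarrow> ix J (en J i) = i"
  unfolding ix_def by (rule the_inv_into_f_f[OF bij_betw_imp_inj_on[OF bij_en]]) auto

lemma en_inj: "finite J \<Longrightarrow> i < card J \<Longrightarrow> i' < card J \<Longrightarrow> en J i = en J i' \<Longrightarrow> i = i'"
  using ix_en by metis

lemma card_subset_lessThan: "J \<subseteq> {..<n} \<Longrightarrow> finite J \<and> card J \<le> n"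
  using card_mono[of "{..<n}" J] finite_subset[of J "{..<n}"] by auto

lemma pid_Phi: "J \<subseteq> {..<n} \<Longrightarrow> pid J \<in> Phi n"
  by (rule PhiI) (auto simp: pid_def split: if_splits)

lemma tt_Phi:
  assumes J: "J \<subseteq> {..<n}"
  shows "tt J \<in> Phi n"
proof -
  have f: "finite J" "card J \<le> n" using card_subset_lessThan[OF J] by auto
  show ?thesis
  proof (rule PhiI)
    fix j i g assume "tt J j = Some (i, g)"
    then show "j < n \<and> i < n \<and> g \<in> carrier G"
      using f en_in[OF f(1), of j] J by (auto simp: tt_def split: if_splits)
  next
    fix j j' i g g' assume "tt J j = Some (i, g)" "tt J j' = Some (i, g')"
    then show "j = j'" using en_inj[OF f(1), of j j'] by (simp add: tt_def split: if_splits)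
  qed
qed

lemma ts_Phi:
  assumes J: "J \<subseteq> {..<n}"
  shows "ts J \<in> Phi n"
proof -
  have f: "finite J" "card J \<le> n" using card_subset_lessThan[OF J] by auto
  show ?thesis
  proof (rule PhiI)
    fix j i g assume "ts J j = Some (i, g)"
    then show "j < n \<and> i < n \<and> g \<in> carrier G"
      using f ix_less[OF f(1), of j] J by (auto simp: ts_def split: if_splits)
  next
    fix j j' i g g' assume a: "ts J j = Some (i, g)" "ts J j' = Some (i, g')"
    then have "j \<in> J" "j' \<in> J" "ix J j = ix J j'" by (auto simp: ts_def split: if_splits)
    then show "j = j'" using en_ix[OF f(1)] by metis
  qed
qed

lemma emb_Phi:
  assumes w: "w \<in> K k" and k: "k \<le> n"
  shows "emb k w \<in> Phi n"
proof (rule PhiI)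
  fix j i g assume "emb k w j = Some (i, g)"
  then show "j < n \<and> i < n \<and> g \<in> carrier G"
    using K_D(4)[OF w, of j] K_D(2)[OF w, of j] k by (auto simp: emb_def split: if_splits)
next
  fix j j' i g g' assume "emb k w j = Some (i, g)" "emb k w j' = Some (i, g')"
  then have "fst (w j) = fst (w j')" by (auto simp: emb_def split: if_splits)
  then show "j = j'" by (simp only: K_D(5)[OF w])
qed

lemma mk_Phi:
  assumes w: "w \<in> K k" and J: "J \<subseteq> {..<n}" "card J = k" and L: "L \<subseteq> {..<n}" "card L = k"
  shows "mk L J w \<in> Phi n"
proof -
  have f: "finite J" "finite L" using card_subset_lessThan J L by auto
  have lt: "fst (w (ix J j)) < k" if "j \<in> J" for j using K_D(4)[OF w] ix_less[OF f(1) that] J by simp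
  show ?thesis
  proof (rule PhiI)
    fix j i g assume "mk L J w j = Some (i, g)"
    then show "j < n \<and> i < n \<and> g \<in> carrier G"
      using J L en_in[OF f(2)] lt[of j] K_D(2)[OF w, of "ix J j"] by (auto simp: mk_def split: if_splits)
  next
    fix j j' i g g' assume "mk L J w j = Some (i, g)" "mk L J w j' = Some (i, g')"
    then have j: "j \<in> J" "j' \<in> J" "en L (fst (w (ix J j))) = en L (fst (w (ix J j')))"
      by (auto simp: mk_def split: if_splits)
    then have "fst (w (ix J j)) = fst (w (ix J j'))" using en_inj[OF f(2)] lt L by simp
    then have "ix J j = ix J j'" by (simp only: K_D(5)[OF w])
    then show "j = j'" using en_ix[OF f(1)] j by metis
  qed
qed

lemma emb_mult:
  assumes "w \<in> K k" "v \<in> K k"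
  shows "pmul (emb k w) (emb k v) = emb k (cmul w v)"
proof
  fix j show "pmul (emb k w) (emb k v) j = emb k (cmul w v) j"
    using K_D(4)[OF assms(2), of j]
    by (cases "j < k"; cases "v j"; cases "w (fst (v j))") (auto simp: pmul_def emb_def cmul_def)
qed

lemma emb_ce: "emb k ce = pid {..<k}"
  by (auto simp: emb_def ce_def pid_def)

lemma ts_tt: "finite J \<Longrightarrow> pmul (ts J) (tt J) = pid {..<card J}"
  using en_in[of J] ix_en[of J] by (auto simp: pmul_def ts_def tt_def pid_def)

lemma tt_ts: "finite J \<Longrightarrow> pmul (tt J) (ts J) = pid J"
  using ix_less[of J] en_ix[of J] by (auto simp: pmul_def ts_def tt_def pid_def)

lemma tt_pid: "pmul (tt J) (pid {..<card J}) = tt J"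
  by (auto simp: pmul_def tt_def pid_def)

lemma pmul_pid_dom:
  assumes "\<phi> \<in> Phi n"
  shows "pmul \<phi> (pid (dom \<phi>)) = \<phi>"
proof
  fix j show "pmul \<phi> (pid (dom \<phi>)) j = \<phi> j"
    using PhiD(4)[OF assms, of j] by (auto simp: pmul_def pid_def split: option.splits)
qed

lemma pmul_pid_im:
  assumes "\<phi> \<in> Phi n"
  shows "pmul (pid (im \<phi>)) \<phi> = \<phi>"
proof
  fix j show "pmul (pid (im \<phi>)) \<phi> j = \<phi> j"
    using PhiD(4)[OF assms, of j] by (auto simp: pmul_def pid_def im_def split: option.splits)
qed

lemma dom_pmul: "dom (pmul \<phi> \<psi>) \<subseteq> dom \<psi>"
  by (auto simp: pmul_def split: option.splits)

lemma im_pmul: "im (pmul \<phi> \<psi>) \<subseteq> im \<phi>"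
  by (auto simp: im_def pmul_Some)

lemma im_pid_pmul: "im (pmul (pid J) \<phi>) \<subseteq> J \<inter> im \<phi>"
  by (auto simp: im_def pmul_Some pid_def split: if_splits)

lemma im_pid: "im (pid J) = J"
  by (auto simp: im_def pid_def)

lemma im_tt: "finite J \<Longrightarrow> im (tt J) \<subseteq> J"
  using en_in[of J] by (auto simp: im_def tt_def split: if_splits)

lemma im_ts: "finite J \<Longrightarrow> im (ts J) \<subseteq> {..<card J}"
  using ix_less[of J] by (auto simp: im_def ts_def split: if_splits)

lemma dom_tt: "dom (tt J) = {..<card J}"
  by (auto simp: tt_def dom_def)

lemma card_im:
  assumes \<phi>: "\<phi> \<in> Phi n"
  shows "card (im \<phi>) = card (dom \<phi>)"
proof -
  have "im \<phi> = (\<lambda>j. fst (the (\<phi> j))) ` dom \<phi>"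
    unfolding im_def dom_def by (force simp: image_iff)
  moreover have "inj_on (\<lambda>j. fst (the (\<phi> j))) (dom \<phi>)"
  proof (rule inj_onI)
    fix j j' assume "j \<in> dom \<phi>" "j' \<in> dom \<phi>" and e: "fst (the (\<phi> j)) = fst (the (\<phi> j'))"
    then obtain i g i' g' where p: "\<phi> j = Some (i, g)" "\<phi> j' = Some (i', g')" by fastforce
    then have "i = i'" using e by simp
    then show "j = j'" using PhiD(5)[OF \<phi>] p by blast
  qed
  ultimately show ?thesis by (simp add: card_image)
qed

text \<open>A domain of at least k points inside \<open>{..<k}\<close> is all of it, and an
  injective map of a finite set into itself is a permutation; w continues u by the identity, as
  \<open>K k\<close> demands.\<close>

lemma full_rank:
  assumes u: "u \<in> Phi n" and d: "dom u \<subseteq> {..<k}" and i: "im u \<subseteq> {..<k}" and c: "\<not> card (dom u) < k"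
  shows "\<exists>w\<in>K k. u = emb k w"
proof -
  have du: "dom u = {..<k}"
    by (rule card_subset_eq) (use d c card_mono[OF _ d] in auto)
  define w where "w = (\<lambda>j. if j < k then the (u j) else (j, \<one>))"
  have uw: "u j = Some (w j)" if "j < k" for j
  proof -
    have "j \<in> dom u" using du that by simp
    then show ?thesis using that by (auto simp: w_def)
  qed
  have uw': "u j = Some (fst (w j), snd (w j))" if "j < k" for j using uw[OF that] by simp
  have "inj_on (\<lambda>j. fst (w j)) {..<k}"
  proof (rule inj_onI)
    fix j j' assume "j \<in> {..<k}" "j' \<in> {..<k}" "fst (w j) = fst (w j')"
    then show "j = j'" using PhiD(5)[OF u, of j "fst (w j)" "snd (w j)" j' "snd (w j')"] uw'[of j] uw'[of j'] by simp
  qed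
  moreover have "(\<lambda>j. fst (w j)) ` {..<k} \<subseteq> {..<k}" using uw' i unfolding im_def by blast
  ultimately have "bij_betw (\<lambda>j. fst (w j)) {..<k} {..<k}"
    by (simp add: bij_betw_def endo_inj_surj)
  moreover have "snd (w j) \<in> carrier G" for j
    using PhiD(4)[OF u uw'[of j]] by (cases "j < k") (auto simp: w_def)
  ultimately have "w \<in> K k"
    by (intro K_I bij_imp_permutes) (auto simp: w_def)
  moreover have "u = emb k w"
  proof
    fix j show "u j = emb k w j"
      using uw[of j] du by (cases "j < k") (auto simp: emb_def domIff dest: equalityD1)
  qed
  ultimately show ?thesis by blast
qed

text \<open>The link between representations and sums over extensions: the left side is how s is
  seen between the blocks J and L of a representation, the right side says that s extends the
  partial map with data (L, J, w).\<close>

lemma compress_iff: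
  assumes s: "s \<in> Phi n" and w: "w \<in> K k" and J: "J \<subseteq> {..<n}" "card J = k" and L: "L \<subseteq> {..<n}" "card L = k"
  shows "pmul (ts L) (pmul s (tt J)) = emb k w \<longleftrightarrow> s |` J = mk L J w"
proof
  have f: "finite J" "finite L" using card_subset_lessThan J L by auto
  assume a: "pmul (ts L) (pmul s (tt J)) = emb k w"
  show "s |` J = mk L J w"
  proof
    fix j
    show "(s |` J) j = mk L J w j"
    proof (cases "j \<in> J")
      case True
      have i: "ix J j < k" using ix_less[OF f(1) True] J by simp
      obtain x y where xy: "w (ix J j) = (x, y)" by force
      have "pmul (ts L) (pmul s (tt J)) (ix J j) = Some (x, y)"
        unfolding a using i by (simp add: emb_def xy)
      then obtain l h where lh: "s j = Some (l, h)" "l \<in> L" "x = ix L l" "y = \<one> \<otimes> (h \<otimes> \<one>)"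
        using en_ix[OF f(1) True] by (auto simp: pmul_Some tt_def ts_def split: if_splits)
      then show ?thesis using True en_ix[OF f(2) lh(2)] PhiD(4)[OF s lh(1)] by (simp add: mk_def xy)
    qed (simp add: mk_def)
  qed
next
  have f: "finite J" "finite L" using card_subset_lessThan J L by auto
  assume a: "s |` J = mk L J w"
  show "pmul (ts L) (pmul s (tt J)) = emb k w"
  proof
    fix i
    show "pmul (ts L) (pmul s (tt J)) i = emb k w i"
    proof (cases "i < k")
      case True
      have j: "en J i \<in> J" "ix J (en J i) = i" using en_in[OF f(1)] ix_en[OF f(1)] True J by auto
      have "s (en J i) = (s |` J) (en J i)" using j by simp
      also have "\<dots> = Some (en L (fst (w i)), snd (w i))" unfolding a using j by (simp add: mk_def)
      finally have sj: "s (en J i) = Some (en L (fst (w i)), snd (w i))" .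
      have "fst (w i) < k" using K_D(4)[OF w True] .
      then have l: "en L (fst (w i)) \<in> L" "ix L (en L (fst (w i))) = fst (w i)"
        using en_in[OF f(2)] ix_en[OF f(2)] L by auto
      show ?thesis
        using True J sj l K_D(2)[OF w, of i] by (simp add: pmul_def tt_def ts_def emb_def)
    qed (simp add: pmul_def tt_def emb_def J)
  qed
qed

lemma emb_inj: "w \<in> K k \<Longrightarrow> v \<in> K k \<Longrightarrow> emb k w = emb k v \<Longrightarrow> w = v"
proof
  fix j assume a: "w \<in> K k" "v \<in> K k" "emb k w = emb k v"
  show "w j = v j"
    using fun_cong[OF a(3), of j] K_D(3)[OF a(1), of j] K_D(3)[OF a(2), of j] by (cases "j < k") (auto simp: emb_def)
qed

lemma mk_restrict: "mk L J w |` J = mk L J w"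
  by (auto simp: mk_def restrict_map_def)

lemma dom_mk: "dom (mk L J w) = J"
  by (auto simp: mk_def dom_def)

text \<open>L and J are recovered as image and domain, and then w by applying
  \<open>compress_iff\<close> to the partial map itself.\<close>

lemma mk_inj:
  assumes w: "w \<in> K k" "w' \<in> K k'" and J: "J \<subseteq> {..<n}" "card J = k" "J' \<subseteq> {..<n}" "card J' = k'"
    and L: "L \<subseteq> {..<n}" "card L = k" "L' \<subseteq> {..<n}" "card L' = k'" and e: "mk L J w = mk L' J' w'"
  shows "L = L'" "J = J'" "w = w'" "k = k'"
proof -
  show JJ: "J = J'" using e dom_mk by metis
  then show kk: "k = k'" using J by simp
  have im: "im (mk A B v) = A" if "v \<in> K m" "A \<subseteq> {..<n}" "card A = m" "B \<subseteq> {..<n}" "card B = m" for A B v m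
  proof -
    have f: "finite A" "finite B" using card_subset_lessThan that by auto
    have "im (mk A B v) \<subseteq> A"
      using en_in[OF f(1)] K_D(4)[OF that(1)] ix_less[OF f(2)] that by (auto simp: im_def mk_def split: if_splits)
    moreover have "card (im (mk A B v)) = m" using card_im[OF mk_Phi[OF that(1,4,5,2,3)]] that by (simp add: dom_mk)
    ultimately show ?thesis using card_subset_eq[OF f(1)] that by simp
  qed
  show LL: "L = L'" using im[OF w(1) L(1,2) J(1,2)] im[OF w(2) L(3,4) J(3,4)] e by simp
  have w'k: "w' \<in> K k" using w(2) kk by simp
  have m: "mk L J w \<in> Phi n" by (rule mk_Phi[OF w(1) J(1,2) L(1,2)])
  have "mk L J w |` J = mk L J w'" using e JJ LL mk_restrict by simp
  then have "emb k w = emb k w'"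
    using compress_iff[OF m w(1) J(1,2) L(1,2)] compress_iff[OF m w'k J(1,2) L(1,2)] mk_restrict by simp
  then show "w = w'" using emb_inj[OF w(1) w'k] by simp
qed

text \<open>The partial maps \<open>mk L J w\<close> for different data are different. This converts
  a cost per element of the groups \<open>K k\<close>, weighted by the number of pairs (L, J), into
  a cost per element of the rook wreath product.\<close>

lemma sum_card_triples:
  "(\<Sum>k\<le>n. card {J. J \<subseteq> {..<n} \<and> card J = k} * card {J. J \<subseteq> {..<n} \<and> card J = k} * card (K k)) \<le> card (Phi n)"
proof -
  define N where "N = (\<lambda>k. {J. J \<subseteq> {..<n} \<and> card J = k})"
  have N: "finite (N k)" for k unfolding N_def by (rule finite_subset[of _ "Pow {..<n}"]) auto
  define T where "T = (SIGMA k:{..n}. N k \<times> N k \<times> K k)"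
  have "inj_on (\<lambda>(k, L, J, w). mk L J w) T"
  proof (rule inj_onI)
    fix x y assume xy: "x \<in> T" "y \<in> T" "(\<lambda>(k, L, J, w). mk L J w) x = (\<lambda>(k, L, J, w). mk L J w) y"
    obtain k L J w where x: "x = (k, L, J, w)" by (metis surj_pair)
    obtain k' L' J' w' where y: "y = (k', L', J', w')" by (metis surj_pair)
    have a: "w \<in> K k" "w' \<in> K k'" "J \<subseteq> {..<n}" "card J = k" "J' \<subseteq> {..<n}" "card J' = k'"
      "L \<subseteq> {..<n}" "card L = k" "L' \<subseteq> {..<n}" "card L' = k'" "mk L J w = mk L' J' w'"
      using xy by (simp_all add: x y T_def N_def)
    show "x = y" using mk_inj[OF a] by (simp add: x y)
  qed
  moreover have "(\<lambda>(k, L, J, w). mk L J w) ` T \<subseteq> Phi n"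
    by (auto simp: T_def N_def intro: mk_Phi)
  ultimately have "card T \<le> card (Phi n)" by (rule card_inj_on_le) (rule finite_Phi)
  moreover have "card T = (\<Sum>k\<le>n. card (N k) * card (N k) * card (K k))"
    unfolding T_def using N finite_K by (simp add: card_cartesian_product mult.assoc)
  ultimately show ?thesis by (simp add: N_def)
qed

end

section \<open>Irreducible representations of the rook wreath product\<close>

lemma mm_row_cong: "A x = A' x' \<Longrightarrow> (A \<star>[K] B) x = (A' \<star>[K] B) x'"
  by (simp add: mm_def)

lemma mm_col_cong: "(\<And>k. B k y = B' k y') \<Longrightarrow> (A \<star>[K] B) x y = (A \<star>[K] B') x y'"
  by (simp add: mm_def)

context wreath
begin

lemma dom_pid: "dom (pid J) = J"
  by (auto simp: pid_def dom_def)

text \<open>Coordinates of the representation that belongs to one of degree r of \<open>K k\<close>: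
  a copy of its space for each k-element set of columns.\<close>

definition basis_index :: "nat \<Rightarrow> nat \<Rightarrow> nat \<Rightarrow> (nat set \<times> nat) set" where
  "basis_index n k r = {J. J \<subseteq> {..<n} \<and> card J = k} \<times> {..<r}"

end

text \<open>\<open>R_irr\<close> is irreducibility in matrix form: the columns of the products R(s)P
  span the whole space, as witnessed by a way M to write the identity. The condition that some
  product is nonzero excludes P whose columns are annihilated by the whole semigroup.\<close>

locale rook_rep = wreath +
  fixes n d :: nat and R :: "(nat \<Rightarrow> (nat \<times> 'a) option) \<Rightarrow> (nat, nat) cmat"
  assumes R_mats: "\<phi> \<in> Phi n \<Longrightarrow> R \<phi> \<in> mats {..<d} {..<d}"
    and R_mult: "\<phi> \<in> Phi n \<Longrightarrow> \<psi> \<in> Phi n \<Longrightarrow> R (pmul \<phi> \<psi>) = R \<phi> \<star>[{..<d}] R \<psi>"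
    and R_irr: "P \<in> mats {..<d} {..<d} \<Longrightarrow> s \<in> Phi n \<Longrightarrow> R s \<star>[{..<d}] P \<noteq> 0 \<Longrightarrow>
      \<exists>M. (\<Sum>s\<in>Phi n. R s \<star>[{..<d}] P \<star>[{..<d}] M s) = idm {..<d}"
    and R_nonzero: "\<exists>s\<in>Phi n. R s \<noteq> 0"
begin

definition rank where "rank = (LEAST k. \<exists>s\<in>Phi n. card (dom s) = k \<and> R s \<noteq> 0)"

lemma rank: "\<exists>s\<in>Phi n. card (dom s) = rank \<and> R s \<noteq> 0"
  unfolding rank_def using R_nonzero by (rule_tac LeastI_ex) blast

lemma R_small: "\<phi> \<in> Phi n \<Longrightarrow> card (dom \<phi>) < rank \<Longrightarrow> R \<phi> = 0"
  unfolding rank_def using not_less_Least by blast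

lemma rank_le: "rank \<le> n"
proof -
  obtain s where "s \<in> Phi n" "card (dom s) = rank" using rank by blast
  then show ?thesis using card_subset_lessThan[OF PhiD(1)] by metis
qed

definition E where "E = R (pid {..<rank})"

lemma pid_rank_Phi: "pid {..<rank} \<in> Phi n"
  by (rule pid_Phi) (use rank_le in auto)

lemma E_mats: "E \<in> mats {..<d} {..<d}"
  unfolding E_def by (rule R_mats[OF pid_rank_Phi])

lemma R_emb_E:
  assumes w: "w \<in> K rank"
  shows "E \<star>[{..<d}] R (emb rank w) = R (emb rank w)" "R (emb rank w) \<star>[{..<d}] E = R (emb rank w)"
proof -
  have wG: "\<And>j. snd (w j) \<in> carrier G" by (rule K_D(2)[OF w])
  have "pmul (pid {..<rank}) (emb rank w) = emb rank w" "pmul (emb rank w) (pid {..<rank}) = emb rank w"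
    unfolding emb_ce[symmetric] emb_mult[OF ce_K w] emb_mult[OF w ce_K] cmul_ce[OF wG] by auto
  then show "E \<star>[{..<d}] R (emb rank w) = R (emb rank w)" "R (emb rank w) \<star>[{..<d}] E = R (emb rank w)"
    unfolding E_def using R_mult[OF pid_rank_Phi emb_Phi[OF w rank_le]] R_mult[OF emb_Phi[OF w rank_le] pid_rank_Phi] by auto
qed

lemma E_idem: "E \<star>[{..<d}] E = E"
  using R_emb_E(1)[OF ce_K] by (simp add: emb_ce E_def)

text \<open>Every partial identity of minimal rank factors through E. If E vanished, so would these,
  and with them every element of that rank.\<close>

lemma tt_E_ts:
  assumes J: "J \<subseteq> {..<n}" "card J = rank"
  shows "R (tt J) \<star>[{..<d}] E \<star>[{..<d}] R (ts J) = R (pid J)"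
proof -
  have f: "finite J" using card_subset_lessThan J by blast
  have "R (tt J) \<star>[{..<d}] E = R (tt J)"
    unfolding E_def using R_mult[OF tt_Phi[OF J(1)] pid_rank_Phi] tt_pid[of J] J(2) by simp
  then show ?thesis using R_mult[OF tt_Phi[OF J(1)] ts_Phi[OF J(1)]] tt_ts[OF f] by simp
qed

lemma E_nonzero: "E \<noteq> 0"
proof
  assume "E = 0"
  obtain s where s: "s \<in> Phi n" "card (dom s) = rank" "R s \<noteq> 0" using rank by blast
  have "R (pid (dom s)) = 0" using tt_E_ts[OF PhiD(1)[OF s(1)] s(2)] \<open>E = 0\<close> by simp
  then have "R (pmul s (pid (dom s))) = 0" using R_mult[OF s(1) pid_Phi[OF PhiD(1)[OF s(1)]]] by simp
  then show False using pmul_pid_dom[OF s(1)] s(3) by simp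
qed

definition N where "N = {J. J \<subseteq> {..<n} \<and> card J = rank}"

lemma finite_N: "finite N"
  unfolding N_def by (rule finite_subset[of _ "Pow {..<n}"]) auto

lemma card_Int_less: "J \<in> N \<Longrightarrow> L \<in> N \<Longrightarrow> J \<noteq> L \<Longrightarrow> card (J \<inter> L) < rank"
proof -
  assume a: "J \<in> N" "L \<in> N" "J \<noteq> L"
  have f: "finite J" "finite L" using a card_subset_lessThan by (auto simp: N_def)
  have "J \<inter> L \<noteq> J \<or> J \<inter> L \<noteq> L" using a by auto
  then have "J \<inter> L \<subset> J \<or> J \<inter> L \<subset> L" by auto
  then show "card (J \<inter> L) < rank" using psubset_card_mono[OF f(1)] psubset_card_mono[OF f(2)] a by (auto simp: N_def)
qed

text \<open>The product has its image in J \<inter> L, which has fewer points than the minimal rank,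
  so R sends it to 0.\<close>

lemma R_pid_zero:
  assumes J: "J \<in> N" and u: "u \<in> Phi n" and L: "L \<in> N" "im u \<subseteq> L" "J \<noteq> L"
  shows "R (pmul (pid J) u) = 0"
proof (rule R_small)
  have p: "pmul (pid J) u \<in> Phi n" using J by (intro pmul_Phi pid_Phi u) (auto simp: N_def)
  show "pmul (pid J) u \<in> Phi n" by (rule p)
  have "finite J" using J card_subset_lessThan by (auto simp: N_def)
  then have "card (im (pmul (pid J) u)) \<le> card (J \<inter> L)"
    using im_pid_pmul[of J u] L(2) by (intro card_mono) auto
  then show "card (dom (pmul (pid J) u)) < rank" using card_Int_less[OF J L(1,3)] card_im[OF p] by simp
qed

text \<open>Each R(s)E is either 0 or belongs to an element of minimal rank whose image is one
  member of N, so one summand fixes it and the others annihilate it. By irreducibility the matrices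
  R(s)E generate the identity, so the sum fixes everything.\<close>

lemma sum_pid: "(\<Sum>J\<in>N. R (pid J)) = idm {..<d}"
proof -
  define Z where "Z = (\<Sum>J\<in>N. R (pid J))"
  have Zm: "Z \<in> mats {..<d} {..<d}"
    unfolding Z_def by (intro sum_mats R_mats pid_Phi) (simp add: N_def)
  have "R (pid {..<rank}) \<star>[{..<d}] E \<noteq> 0" using E_idem E_nonzero by (simp add: E_def)
  then obtain M where M: "(\<Sum>s\<in>Phi n. R s \<star>[{..<d}] E \<star>[{..<d}] M s) = idm {..<d}"
    using R_irr[OF E_mats pid_rank_Phi] by blast
  have absorb: "Z \<star>[{..<d}] (R s \<star>[{..<d}] E) = R s \<star>[{..<d}] E" if s: "s \<in> Phi n" for s
  proof -
    define u where "u = pmul s (pid {..<rank})"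
    have u: "u \<in> Phi n" unfolding u_def by (rule pmul_Phi[OF s pid_rank_Phi])
    have Ru: "R s \<star>[{..<d}] E = R u" unfolding u_def E_def using R_mult[OF s pid_rank_Phi] by simp
    have "dom u \<subseteq> {..<rank}" using dom_pmul[of s "pid {..<rank}"] by (simp only: u_def dom_pid)
    then have c: "card (dom u) \<le> rank" using card_mono[of "{..<rank}"] by fastforce
    show ?thesis
    proof (cases "card (dom u) < rank")
      case True
      then show ?thesis unfolding Ru using R_small[OF u] by simp
    next
      case False
      then have im: "im u \<in> N" using c card_im[OF u] PhiD(3)[OF u] unfolding N_def im_def by auto
      have t: "R (pid J) \<star>[{..<d}] R u = (if J = im u then R u else 0)" if J: "J \<in> N" for J
      proof -
        have "R (pid J) \<star>[{..<d}] R u = R (pmul (pid J) u)"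
          using R_mult[OF pid_Phi u, of J] J by (simp add: N_def)
        then show ?thesis using R_pid_zero[OF J u im order_refl] pmul_pid_im[OF u] by simp
      qed
      have "Z \<star>[{..<d}] R u = (\<Sum>J\<in>N. if J = im u then R u else 0)"
        unfolding Z_def mm_sum_left using t by (intro sum.cong refl)
      then show ?thesis unfolding Ru using finite_N im by (simp add: sum.delta)
    qed
  qed
  have "Z = Z \<star>[{..<d}] idm {..<d}" using Zm by (simp add: mm_idm_right)
  also have "\<dots> = (\<Sum>s\<in>Phi n. Z \<star>[{..<d}] (R s \<star>[{..<d}] E) \<star>[{..<d}] M s)"
    unfolding M[symmetric] mm_sum_right by (simp only: mm_assoc)
  also have "\<dots> = idm {..<d}" unfolding M[symmetric] using absorb by (intro sum.cong) auto
  finally show ?thesis by (simp add: Z_def)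
qed

lemma R_cross:
  assumes J: "J \<in> N" and L: "L \<in> N"
  shows "R (ts L) \<star>[{..<d}] R (tt J) = (if J = L then E else 0)"
proof -
  have f: "finite J" "finite L" and J': "J \<subseteq> {..<n}" "card J = rank" and L': "L \<subseteq> {..<n}" "card L = rank"
    using J L card_subset_lessThan by (auto simp: N_def)
  show ?thesis
  proof (cases "J = L")
    case True
    then show ?thesis using R_mult[OF ts_Phi[OF L'(1)] tt_Phi[OF J'(1)]] ts_tt[OF f(1)] J'(2) by (simp add: E_def)
  next
    case False
    have "dom (ts L) = L" by (auto simp: ts_def dom_def)
    then have "pmul (ts L) (pid L) = ts L" using pmul_pid_dom[OF ts_Phi[OF L'(1)]] by simp
    then have "R (ts L) \<star>[{..<d}] R (tt J) = R (ts L) \<star>[{..<d}] (R (pid L) \<star>[{..<d}] R (tt J))"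
      using R_mult[OF ts_Phi[OF L'(1)] pid_Phi[OF L'(1)]] by (simp add: mm_assoc[symmetric])
    moreover have "R (pmul (pid L) (tt J)) = 0"
      by (rule R_pid_zero[OF L tt_Phi[OF J'(1)] J im_tt[OF f(1)]]) (use False in auto)
    then have "R (pid L) \<star>[{..<d}] R (tt J) = 0"
      using R_mult[OF pid_Phi[OF L'(1)] tt_Phi[OF J'(1)]] by simp
    ultimately show ?thesis using False by simp
  qed
qed

text \<open>The matrices E R(s) E are 0 or of the form R(emb w), so an idempotent intertwiner F of
  the compressed representation, moved to P = BFB', commutes with all of them. Irreducibility of R
  then turns P \<noteq> 0 into P = E.\<close>

lemma compressed_simple:
  assumes B: "B \<in> mats {..<d} {..<r}" "B' \<in> mats {..<r} {..<d}" "B' \<star>[{..<d}] B = idm {..<r}" "B \<star>[{..<r}] B' = E"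
  shows "simple_rep (chain.H rank) (r, \<lambda>w. B' \<star>[{..<d}] R (emb rank w) \<star>[{..<d}] B)" (is "simple_rep _ (r, ?\<tau>)")
proof -
  have Re: "R (emb rank w) \<in> mats {..<d} {..<d}" if "w \<in> K rank" for w
    by (rule R_mats[OF emb_Phi[OF that rank_le]])
  have B'E: "B' \<star>[{..<d}] E = B'" by (metis B(2,3,4) mm_assoc mm_idm_left finite_lessThan)
  have EB: "E \<star>[{..<d}] B = B" by (metis B(1,3,4) mm_assoc mm_idm_right finite_lessThan)
  have \<tau>m: "?\<tau> w \<in> mats {..<r} {..<r}" if "w \<in> K rank" for w
    by (rule mm_mats[OF mm_mats[OF B(2) Re[OF that]] B(1)])
  have rep: "matrix_rep (chain.H rank) (r, ?\<tau>)"
    unfolding matrix_rep_def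
  proof (clarsimp, intro conjI ballI)
    fix w assume "w \<in> K rank"
    then show "?\<tau> w \<in> mats {..<r} {..<r}" by (rule \<tau>m)
  next
    show "B' \<star>[{..<d}] R (emb rank ce) \<star>[{..<d}] B = idm {..<r}"
      using B(3) B'E by (simp add: emb_ce E_def)
  next
    fix w v assume wv: "w \<in> K rank" "v \<in> K rank"
    have "R (emb rank (cmul w v)) = R (emb rank w) \<star>[{..<d}] E \<star>[{..<d}] R (emb rank v)"
      using R_mult[OF emb_Phi[OF wv(1) rank_le] emb_Phi[OF wv(2) rank_le]] R_emb_E(2)[OF wv(1)] emb_mult[OF wv] by simp
    then show "B' \<star>[{..<d}] R (emb rank (cmul w v)) \<star>[{..<d}] B = ?\<tau> w \<star>[{..<r}] ?\<tau> v"
      unfolding B(4)[symmetric] by (simp add: mm_assoc)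
  qed
  have "r > 0"
  proof (rule ccontr)
    assume "\<not> 0 < r"
    then have "B \<star>[{..<r}] B' = 0" by (auto simp: mm_def fun_eq_iff)
    then show False using B(4) E_nonzero by simp
  qed
  moreover have "F = 0 \<or> F = idm {..<r}"
    if F: "intertwiner (chain.H rank) (r, ?\<tau>) (r, ?\<tau>) F" "F \<star>[{..<r}] F = F" for F
  proof (cases "F = 0")
    case False
    have Fm: "F \<in> mats {..<r} {..<r}" using intertwinerD(1)[OF F(1)] .
    define P where "P = B \<star>[{..<r}] F \<star>[{..<r}] B'"
    have Pm: "P \<in> mats {..<d} {..<d}" unfolding P_def by (rule mm_mats[OF mm_mats[OF B(1) Fm] B(2)])
    have EP: "E \<star>[{..<d}] P = P" unfolding P_def by (simp add: mm_assoc[symmetric] EB)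
    have PE: "P \<star>[{..<d}] E = P" unfolding P_def by (simp add: mm_assoc B'E)
    have FP: "B' \<star>[{..<d}] P \<star>[{..<d}] B = F"
    proof -
      have "B' \<star>[{..<d}] P \<star>[{..<d}] B = (B' \<star>[{..<d}] B) \<star>[{..<r}] F \<star>[{..<r}] (B' \<star>[{..<d}] B)"
        unfolding P_def by (simp only: mm_assoc)
      then show ?thesis using Fm by (simp add: B(3) mm_idm_left mm_idm_right)
    qed
    have PP: "P \<star>[{..<d}] P = P"
    proof -
      have "P \<star>[{..<d}] P = B \<star>[{..<r}] F \<star>[{..<r}] (B' \<star>[{..<d}] B) \<star>[{..<r}] F \<star>[{..<r}] B'"
        unfolding P_def by (simp only: mm_assoc)
      also have "\<dots> = B \<star>[{..<r}] (F \<star>[{..<r}] F) \<star>[{..<r}] B'"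
        unfolding B(3) using mm_mats[OF B(1) Fm, of "{..<r}"] by (simp add: mm_idm_right) (simp add: mm_assoc)
      finally show ?thesis by (simp add: F(2) P_def)
    qed
    have "P \<noteq> 0" using FP False by auto
    then have "R (pid {..<rank}) \<star>[{..<d}] P \<noteq> 0" using EP by (simp add: E_def)
    then obtain M where M: "(\<Sum>s\<in>Phi n. R s \<star>[{..<d}] P \<star>[{..<d}] M s) = idm {..<d}"
      using R_irr[OF Pm pid_rank_Phi] by blast
    have comm: "E \<star>[{..<d}] R s \<star>[{..<d}] P = P \<star>[{..<d}] (E \<star>[{..<d}] R s \<star>[{..<d}] E)" if s: "s \<in> Phi n" for s
    proof -
      define u where "u = pmul (pid {..<rank}) (pmul s (pid {..<rank}))"
      have u: "u \<in> Phi n" unfolding u_def by (intro pmul_Phi s pid_rank_Phi)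
      have Ru: "E \<star>[{..<d}] R s \<star>[{..<d}] E = R u"
        unfolding u_def E_def using R_mult[OF pid_rank_Phi pmul_Phi[OF s pid_rank_Phi]] R_mult[OF s pid_rank_Phi]
        by (simp add: mm_assoc)
      have "E \<star>[{..<d}] R s \<star>[{..<d}] P = R u \<star>[{..<d}] P"
        unfolding Ru[symmetric] by (simp add: mm_assoc EP)
      also have "\<dots> = P \<star>[{..<d}] R u"
      proof (cases "card (dom u) < rank")
        case True
        then show ?thesis using R_small[OF u] by simp
      next
        case c: False
        have "dom u \<subseteq> {..<rank}"
          using order_trans[OF dom_pmul[of "pid {..<rank}" "pmul s (pid {..<rank})"] dom_pmul[of s "pid {..<rank}"]]
          unfolding u_def dom_pid .
        moreover have "im u \<subseteq> {..<rank}" using im_pid_pmul[of "{..<rank}"] unfolding u_def by blast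
        ultimately obtain w where w: "w \<in> K rank" "u = emb rank w" using full_rank[OF u _ _ c] by blast
        have Rw: "R u = B \<star>[{..<r}] ?\<tau> w \<star>[{..<r}] B'"
        proof -
          have "B \<star>[{..<r}] ?\<tau> w \<star>[{..<r}] B' = (B \<star>[{..<r}] B') \<star>[{..<d}] R (emb rank w) \<star>[{..<d}] (B \<star>[{..<r}] B')"
            by (simp only: mm_assoc)
          then show ?thesis using R_emb_E[OF w(1)] by (simp add: B(4) w(2))
        qed
        have "R u \<star>[{..<d}] P = B \<star>[{..<r}] ?\<tau> w \<star>[{..<r}] (B' \<star>[{..<d}] B) \<star>[{..<r}] F \<star>[{..<r}] B'"
          unfolding Rw P_def by (simp only: mm_assoc)
        also have "\<dots> = B \<star>[{..<r}] (?\<tau> w \<star>[{..<r}] F) \<star>[{..<r}] B'"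
          unfolding B(3) mm_idm_right[OF finite_lessThan mm_mats[OF B(1) \<tau>m[OF w(1)]]] by (simp only: mm_assoc)
        also have "?\<tau> w \<star>[{..<r}] F = F \<star>[{..<r}] ?\<tau> w" using intertwinerD(2)[OF F(1), of w] w(1) by simp
        also have "B \<star>[{..<r}] (F \<star>[{..<r}] ?\<tau> w) \<star>[{..<r}] B' =
            B \<star>[{..<r}] F \<star>[{..<r}] (B' \<star>[{..<d}] B) \<star>[{..<r}] ?\<tau> w \<star>[{..<r}] B'"
          unfolding B(3) mm_idm_right[OF finite_lessThan mm_mats[OF B(1) Fm]] by (simp only: mm_assoc)
        also have "\<dots> = P \<star>[{..<d}] R u" unfolding Rw P_def by (simp only: mm_assoc)
        finally show ?thesis .
      qed
      finally show ?thesis unfolding Ru .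
    qed
    \<comment> \<open>Moving P to the front of the sum exhibits E as P times a matrix. Since P is
      idempotent this gives PE = E, while PE = P by construction.\<close>
    have "E = E \<star>[{..<d}] (\<Sum>s\<in>Phi n. R s \<star>[{..<d}] P \<star>[{..<d}] M s)"
      unfolding M using E_mats by (simp add: mm_idm_right)
    also have "\<dots> = (\<Sum>s\<in>Phi n. (E \<star>[{..<d}] R s \<star>[{..<d}] P) \<star>[{..<d}] M s)"
      unfolding mm_sum_right by (simp only: mm_assoc)
    also have "\<dots> = (\<Sum>s\<in>Phi n. P \<star>[{..<d}] (E \<star>[{..<d}] R s \<star>[{..<d}] E) \<star>[{..<d}] M s)"
      using comm by (intro sum.cong refl) simp
    also have "\<dots> = P \<star>[{..<d}] (\<Sum>s\<in>Phi n. E \<star>[{..<d}] R s \<star>[{..<d}] E \<star>[{..<d}] M s)"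
      unfolding mm_sum_right by (simp only: mm_assoc)
    finally obtain X where X: "E = P \<star>[{..<d}] X" by blast
    then have "P \<star>[{..<d}] E = E" using PP by (simp add: mm_assoc[symmetric])
    then have "P = E" using PE by simp
    then show ?thesis using FP B'E B(3) by simp
  qed simp
  ultimately show ?thesis unfolding simple_rep_def using rep by simp
qed

text \<open>The range of E carries, in suitable coordinates B, one of the chosen representations
  \<mu> of \<open>K rank\<close>. The maps \<open>tt J\<close> transport this space to the ranges of
  the partial identities of minimal rank, which make up the whole space by \<open>sum_pid\<close>
  and are independent by \<open>R_cross\<close>.\<close>

theorem normal_form:
  "\<exists>k\<le>n. \<exists>(r, \<mu>)\<in>chain.irr k. \<exists>PP QQ. PP \<in> mats {..<d} (basis_index n k r) \<and> QQ \<in> mats (basis_index n k r) {..<d} \<and>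
    PP \<star>[basis_index n k r] QQ = idm {..<d} \<and> QQ \<star>[{..<d}] PP = idm (basis_index n k r) \<and>
    (\<forall>\<phi>\<in>Phi n. \<forall>(L, l)\<in>basis_index n k r. \<forall>(J, j)\<in>basis_index n k r.
      (QQ \<star>[{..<d}] R \<phi> \<star>[{..<d}] PP) (L, l) (J, j) = (\<Sum>w\<in>K k. if \<phi> |` J = mk L J w then \<mu> w l j else 0))"
proof -
  obtain r0 :: nat and B0 B0' where B0: "B0 \<in> mats {..<d} {..<r0}" "B0' \<in> mats {..<r0} {..<d}"
    "B0' \<star>[{..<d}] B0 = idm {..<r0}" "B0 \<star>[{..<r0}] B0' = E"
    using idempotent_factorization[OF finite_lessThan E_mats E_idem] by metis
  let ?\<tau> = "\<lambda>w. B0' \<star>[{..<d}] R (emb rank w) \<star>[{..<d}] B0"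
  obtain r \<mu> where y: "(r, \<mu>) \<in> chain.irr rank" "equiv_mreps (chain.H rank) (r0, ?\<tau>) (r, \<mu>)"
    using chain.irr_complete[OF compressed_simple[OF B0]] by auto
  obtain P Q where P: "intertwiner (chain.H rank) (r0, ?\<tau>) (r, \<mu>) P" and Q: "Q \<in> mats {..<r} {..<r0}"
    and PQ: "P \<star>[{..<r}] Q = idm {..<r0}" and QP: "Q \<star>[{..<r0}] P = idm {..<r}"
    using y(2) by (auto simp: equiv_mreps_def)
  have Pm: "P \<in> mats {..<r0} {..<r}" using intertwinerD(1)[OF P] .
  define B where "B = B0 \<star>[{..<r0}] P"
  define B' where "B' = Q \<star>[{..<r0}] B0'"
  have Bm: "B \<in> mats {..<d} {..<r}" "B' \<in> mats {..<r} {..<d}"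
    unfolding B_def B'_def by (rule mm_mats[OF B0(1) Pm], rule mm_mats[OF Q B0(2)])
  have BB: "B \<star>[{..<r}] B' = E"
  proof -
    have "B \<star>[{..<r}] B' = B0 \<star>[{..<r0}] (P \<star>[{..<r}] Q) \<star>[{..<r0}] B0'" unfolding B_def B'_def by (simp only: mm_assoc)
    then show ?thesis using B0 by (simp add: PQ mm_idm_right)
  qed
  have comp: "B' \<star>[{..<d}] R (emb rank w) \<star>[{..<d}] B = \<mu> w" if w: "w \<in> K rank" for w
  proof -
    have "B' \<star>[{..<d}] R (emb rank w) \<star>[{..<d}] B = Q \<star>[{..<r0}] (?\<tau> w \<star>[{..<r0}] P)"
      unfolding B_def B'_def by (simp only: mm_assoc)
    also have "?\<tau> w \<star>[{..<r0}] P = P \<star>[{..<r}] \<mu> w" using intertwinerD(2)[OF P, of w] w by simp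
    also have "Q \<star>[{..<r0}] (P \<star>[{..<r}] \<mu> w) = (Q \<star>[{..<r0}] P) \<star>[{..<r}] \<mu> w" by (simp only: mm_assoc)
    also have "\<dots> = \<mu> w"
      using matrix_repD(1)[OF simple_repD(1)[OF chain.irr_simple[OF y(1)]], of w] w by (simp add: QP mm_idm_left)
    finally show ?thesis .
  qed
  have EB: "B' \<star>[{..<d}] E \<star>[{..<d}] B = idm {..<r}"
    using comp[OF ce_K] matrix_repD(2)[OF simple_repD(1)[OF chain.irr_simple[OF y(1)]]] by (simp add: emb_ce E_def)
  define I where "I = basis_index n rank r"
  have I_N: "I = N \<times> {..<r}" by (simp add: I_def basis_index_def N_def)
  have ttm: "R (tt J) \<in> mats {..<d} {..<d}" "R (ts J) \<in> mats {..<d} {..<d}" if "J \<in> N" for J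
    using that by (auto simp: N_def intro: R_mats tt_Phi ts_Phi)
  \<comment> \<open>Column (J, b) of \<open>PP\<close> is the basis vector b of the range of E,
    transported to J; \<open>QQ\<close> transports back with \<open>ts J\<close> and takes
    coordinates.\<close>
  define PP where "PP = (\<lambda>i x. if x \<in> I then (R (tt (fst x)) \<star>[{..<d}] B) i (snd x) else 0)"
  define QQ where "QQ = (\<lambda>x i. if x \<in> I then (B' \<star>[{..<d}] R (ts (fst x))) (snd x) i else 0)"
  have PPm: "PP \<in> mats {..<d} I"
  proof (rule matsI)
    fix i x assume "i \<notin> {..<d} \<or> x \<notin> I"
    then show "PP i x = 0"
      using mats_zero[OF mm_mats[OF ttm(1) Bm(1)], of "fst x" i "snd x"] by (auto simp: PP_def I_N)
  qed
  have QQm: "QQ \<in> mats I {..<d}"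
  proof (rule matsI)
    fix x i assume "x \<notin> I \<or> i \<notin> {..<d}"
    then show "QQ x i = 0"
      using mats_zero[OF mm_mats[OF Bm(2) ttm(2)], of "fst x" "snd x" i] by (auto simp: QQ_def I_N)
  qed
  have sandwich: "(QQ \<star>[{..<d}] X \<star>[{..<d}] PP) (L, l) (J, j) =
      (B' \<star>[{..<d}] (R (ts L) \<star>[{..<d}] (X \<star>[{..<d}] R (tt J))) \<star>[{..<d}] B) l j" if "(L, l) \<in> I" "(J, j) \<in> I" for X L l J j
  proof -
    have q: "QQ (L, l) = (B' \<star>[{..<d}] R (ts L)) l" using that by (auto simp: QQ_def)
    have "(QQ \<star>[{..<d}] X \<star>[{..<d}] PP) (L, l) (J, j) = (QQ \<star>[{..<d}] X \<star>[{..<d}] (R (tt J) \<star>[{..<d}] B)) (L, l) j"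
      by (rule mm_col_cong) (use that in \<open>simp add: PP_def\<close>)
    also have "\<dots> = (B' \<star>[{..<d}] R (ts L) \<star>[{..<d}] X \<star>[{..<d}] (R (tt J) \<star>[{..<d}] B)) l j"
      by (rule fun_cong, rule mm_row_cong, rule mm_row_cong, rule q)
    finally show ?thesis by (simp only: mm_assoc)
  qed
  have PPQQ: "PP \<star>[I] QQ = idm {..<d}"
  proof (intro ext)
    fix i j
    have "(PP \<star>[I] QQ) i j = (\<Sum>J\<in>N. \<Sum>b<r. (R (tt J) \<star>[{..<d}] B) i b * (B' \<star>[{..<d}] R (ts J)) b j)"
      unfolding mm_def[of PP] I_N sum.cartesian_product by (intro sum.cong) (auto simp: PP_def QQ_def I_N)
    also have "\<dots> = (\<Sum>J\<in>N. ((R (tt J) \<star>[{..<d}] B) \<star>[{..<r}] (B' \<star>[{..<d}] R (ts J))) i j)"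
      by (intro sum.cong refl) (simp only: mm_def)
    also have "\<dots> = (\<Sum>J\<in>N. R (pid J) i j)"
    proof (intro sum.cong refl)
      fix J assume "J \<in> N"
      then have "(R (tt J) \<star>[{..<d}] B) \<star>[{..<r}] (B' \<star>[{..<d}] R (ts J)) = R (pid J)"
        using tt_E_ts[of J] unfolding N_def BB[symmetric] by (simp add: mm_assoc)
      then show "((R (tt J) \<star>[{..<d}] B) \<star>[{..<r}] (B' \<star>[{..<d}] R (ts J))) i j = R (pid J) i j" by simp
    qed
    also have "\<dots> = idm {..<d} i j" using fun_cong[OF fun_cong[OF sum_pid], of i j] by (simp add: sum_fun_eval)
    finally show "(PP \<star>[I] QQ) i j = idm {..<d} i j" .
  qed
  have QQPP: "QQ \<star>[{..<d}] PP = idm I"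
  proof (rule mats_eqI[OF mm_mats[OF QQm PPm] idm_mats])
    fix x y assume xy: "x \<in> I" "y \<in> I"
    obtain L l J j where [simp]: "x = (L, l)" "y = (J, j)" by (metis surj_pair)
    have LJ: "L \<in> N" "J \<in> N" "l < r" "j < r" using xy by (auto simp: I_N)
    have "(QQ \<star>[{..<d}] PP) x y = (QQ \<star>[{..<d}] idm {..<d} \<star>[{..<d}] PP) x y"
      using QQm by (simp add: mm_idm_right)
    also have "\<dots> = (B' \<star>[{..<d}] (R (ts L) \<star>[{..<d}] R (tt J)) \<star>[{..<d}] B) l j"
      using sandwich[of L l J j "idm {..<d}"] xy ttm(1)[OF LJ(2)] by (simp add: mm_idm_left)
    also have "\<dots> = idm I x y"
      unfolding R_cross[OF LJ(2,1)] using EB LJ xy by (auto simp: idm_def)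
    finally show "(QQ \<star>[{..<d}] PP) x y = idm I x y" .
  qed
  \<comment> \<open>Compression between J and L gives a single element u. If its rank is too small,
    both sides are 0; otherwise u comes from a unique v, and only the term of v survives in the
    sum.\<close>
  have coef: "(QQ \<star>[{..<d}] R \<phi> \<star>[{..<d}] PP) (L, l) (J, j) = (\<Sum>w\<in>K rank. if \<phi> |` J = mk L J w then \<mu> w l j else 0)"
    if \<phi>: "\<phi> \<in> Phi n" and x: "(L, l) \<in> I" and y: "(J, j) \<in> I" for \<phi> L l J j
  proof -
    have J: "J \<subseteq> {..<n}" "card J = rank" and L: "L \<subseteq> {..<n}" "card L = rank" using x y by (auto simp: I_N N_def)
    define u where "u = pmul (ts L) (pmul \<phi> (tt J))"
    have u: "u \<in> Phi n" unfolding u_def by (intro pmul_Phi \<phi> ts_Phi tt_Phi J L)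
    have "R (ts L) \<star>[{..<d}] (R \<phi> \<star>[{..<d}] R (tt J)) = R u"
      unfolding u_def using R_mult[OF ts_Phi[OF L(1)] pmul_Phi[OF \<phi> tt_Phi[OF J(1)]]] R_mult[OF \<phi> tt_Phi[OF J(1)]] by simp
    then have lhs: "(QQ \<star>[{..<d}] R \<phi> \<star>[{..<d}] PP) (L, l) (J, j) = (B' \<star>[{..<d}] R u \<star>[{..<d}] B) l j"
      using sandwich[OF x y] by simp
    have iff: "\<phi> |` J = mk L J w \<longleftrightarrow> u = emb rank w" if "w \<in> K rank" for w
      unfolding u_def using compress_iff[OF \<phi> that J L] by simp
    show ?thesis
    proof (cases "card (dom u) < rank")
      case True
      have "\<phi> |` J \<noteq> mk L J w" if w: "w \<in> K rank" for w
      proof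
        assume "\<phi> |` J = mk L J w"
        then have "u = emb rank w" using iff[OF w] by simp
        then have "dom u = {..<rank}" by (auto simp: emb_def dom_def)
        then show False using True by simp
      qed
      then show ?thesis unfolding lhs using R_small[OF u True] by (simp cong: sum.cong)
    next
      case False
      have "dom u \<subseteq> {..<rank}"
        using order_trans[OF dom_pmul[of "ts L" "pmul \<phi> (tt J)"] dom_pmul[of \<phi> "tt J"]]
        unfolding u_def dom_tt J(2) .
      moreover have "im u \<subseteq> {..<rank}"
        using order_trans[OF im_pmul[of "ts L" "pmul \<phi> (tt J)"] im_ts[OF conjunct1[OF card_subset_lessThan[OF L(1)]]]]
        unfolding u_def L(2) .
      ultimately obtain v where v: "v \<in> K rank" "u = emb rank v" using full_rank[OF u _ _ False] by auto
      have "(\<Sum>w\<in>K rank. if \<phi> |` J = mk L J w then \<mu> w l j else 0) = (\<Sum>w\<in>K rank. if w = v then \<mu> v l j else 0)"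
      proof (intro sum.cong refl)
        fix w assume w: "w \<in> K rank"
        have "\<phi> |` J = mk L J w \<longleftrightarrow> w = v"
          unfolding iff[OF w] v(2) using emb_inj[OF v(1) w] by blast
        then show "(if \<phi> |` J = mk L J w then \<mu> w l j else 0) = (if w = v then \<mu> v l j else 0)" by simp
      qed
      also have "\<dots> = \<mu> v l j" using v(1) finite_K by (simp add: sum.delta)
      finally show ?thesis unfolding lhs v(2) comp[OF v(1)] by simp
    qed
  qed
  show ?thesis
  proof (intro exI[of _ rank] conjI rank_le bexI[OF _ y(1)], unfold prod.case, intro exI conjI ballI)
    show "PP \<in> mats {..<d} (basis_index n rank r)" using PPm by (simp add: I_def)
    show "QQ \<in> mats (basis_index n rank r) {..<d}" using QQm by (simp add: I_def)
    show "PP \<star>[basis_index n rank r] QQ = idm {..<d}" using PPQQ by (simp add: I_def)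
    show "QQ \<star>[{..<d}] PP = idm (basis_index n rank r)" using QQPP by (simp add: I_def)
    fix \<phi> assume \<phi>: "\<phi> \<in> Phi n"
    show "case x of (L, l) \<Rightarrow> \<forall>(J, j)\<in>basis_index n rank r.
        (QQ \<star>[{..<d}] R \<phi> \<star>[{..<d}] PP) (L, l) (J, j) = (\<Sum>w\<in>K rank. if \<phi> |` J = mk L J w then \<mu> w l j else 0)"
      if "x \<in> basis_index n rank r" for x
    proof (cases x)
      case (Pair L l)
      show ?thesis
        unfolding Pair prod.case
      proof (rule ballI)
        fix y assume y: "y \<in> basis_index n rank r"
        obtain J j where y': "y = (J, j)" by force
        show "case y of (J, j) \<Rightarrow>
            (QQ \<star>[{..<d}] R \<phi> \<star>[{..<d}] PP) (L, l) (J, j) = (\<Sum>w\<in>K rank. if \<phi> |` J = mk L J w then \<mu> w l j else 0)"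
          unfolding y' prod.case by (rule coef[OF \<phi>]) (use that y in \<open>simp_all only: Pair y' I_def\<close>)
      qed
    qed
  qed
qed

end

section \<open>From semigroup algebras to matrices\<close>

lemma basis_elem_algebra: "s \<in> carrier S \<Longrightarrow> basis_elem s \<in> semigroup_algebra S"
  by (auto simp: basis_elem_def semigroup_algebra_def)

lemma convolve_basis_elem:
  assumes "finite (carrier S)" and s: "s \<in> carrier S" and t: "t \<in> carrier S"
  shows "convolve S (basis_elem s) (basis_elem t) = basis_elem (s \<otimes>\<^bsub>S\<^esub> t)"
proof
  fix u
  let ?X = "{(a, b). a \<in> carrier S \<and> b \<in> carrier S \<and> a \<otimes>\<^bsub>S\<^esub> b = u}"
  have "finite ?X" by (rule finite_subset[of _ "carrier S \<times> carrier S"]) (use assms in auto)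
  have "convolve S (basis_elem s) (basis_elem t) u = (\<Sum>x\<in>?X. if x = (s, t) then 1 else 0)"
    unfolding convolve_def by (intro sum.cong) (auto simp: basis_elem_def split: if_splits)
  also have "\<dots> = basis_elem (s \<otimes>\<^bsub>S\<^esub> t) u"
    using \<open>finite ?X\<close> s t by (subst sum.delta) (auto simp: basis_elem_def)
  finally show "convolve S (basis_elem s) (basis_elem t) u = basis_elem (s \<otimes>\<^bsub>S\<^esub> t) u" .
qed

lemma representationD:
  assumes "representation S (d, \<rho>)"
  shows "f \<in> semigroup_algebra S \<Longrightarrow> \<rho> f \<in> carrier_mat d d"
    "f \<in> semigroup_algebra S \<Longrightarrow> g \<in> semigroup_algebra S \<Longrightarrow> \<rho> (\<lambda>s. f s + g s) = \<rho> f + \<rho> g"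
    "f \<in> semigroup_algebra S \<Longrightarrow> \<rho> (\<lambda>s. c * f s) = c \<cdot>\<^sub>m \<rho> f"
    "f \<in> semigroup_algebra S \<Longrightarrow> g \<in> semigroup_algebra S \<Longrightarrow> \<rho> (convolve S f g) = \<rho> f * \<rho> g"
  using assms by (auto simp: representation_def)

text \<open>Additivity is given for two summands only, so f is built up from its truncations to
  growing subsets A of the carrier.\<close>

lemma rep_expansion:
  assumes fin: "finite (carrier S)" and rep: "representation S (d, \<rho>)" and f: "f \<in> semigroup_algebra S"
    and ij: "i < d" "j < d"
  shows "\<rho> f $$ (i, j) = (\<Sum>s\<in>carrier S. f s * \<rho> (basis_elem s) $$ (i, j))"
proof -
  have "(\<lambda>s. if s \<in> A then f s else 0) \<in> semigroup_algebra S \<and>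
      \<rho> (\<lambda>s. if s \<in> A then f s else 0) $$ (i, j) = (\<Sum>s\<in>A. f s * \<rho> (basis_elem s) $$ (i, j))"
    if "A \<subseteq> carrier S" for A
    using finite_subset[OF that fin] that
  proof (induction A rule: finite_induct)
    case empty
    have "\<rho> (\<lambda>s. 0 * f s) $$ (i, j) = 0"
      using representationD(1)[OF rep f] representationD(3)[OF rep f, of 0] ij by simp
    then show ?case by (simp add: semigroup_algebra_def)
  next
    case (insert x A)
    let ?g = "\<lambda>s. if s \<in> A then f s else 0"
    have x: "x \<in> carrier S" using insert.prems by auto
    have g: "?g \<in> semigroup_algebra S" using insert by auto
    have b: "basis_elem x \<in> semigroup_algebra S" by (rule basis_elem_algebra[OF x])
    have cb: "(\<lambda>s. f x * basis_elem x s) \<in> semigroup_algebra S" using b by (auto simp: semigroup_algebra_def)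
    have eq: "(\<lambda>s. if s \<in> insert x A then f s else 0) = (\<lambda>s. f x * basis_elem x s + ?g s)"
      using insert.hyps by (auto simp: basis_elem_def)
    have "\<rho> (\<lambda>s. f x * basis_elem x s + ?g s) $$ (i, j) = f x * \<rho> (basis_elem x) $$ (i, j) + \<rho> ?g $$ (i, j)"
      using representationD(2)[OF rep cb g] representationD(3)[OF rep b, of "f x"]
        representationD(1)[OF rep b] representationD(1)[OF rep g] ij by simp
    moreover have "(\<lambda>s. if s \<in> insert x A then f s else 0) \<in> semigroup_algebra S"
      using insert.prems by (auto simp: semigroup_algebra_def)
    ultimately show ?case unfolding eq[symmetric] using insert by simp
  qed
  from this[OF order_refl] have "\<rho> (\<lambda>s. if s \<in> carrier S then f s else 0) $$ (i, j) =
      (\<Sum>s\<in>carrier S. f s * \<rho> (basis_elem s) $$ (i, j))" by blast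
  moreover have "(\<lambda>s. if s \<in> carrier S then f s else 0) = f" using f by (auto simp: semigroup_algebra_def)
  ultimately show ?thesis by simp
qed

lemma irreducible_repD:
  assumes "irreducible_rep S (d, \<rho>)"
  shows "representation S (d, \<rho>)" "\<exists>f\<in>semigroup_algebra S. \<rho> f \<noteq> 0\<^sub>m d d"
    "invariant_subspace S (d, \<rho>) W \<Longrightarrow> W = {0\<^sub>v d} \<or> W = carrier_vec d"
  using assms by (auto simp: irreducible_rep_def)

lemma conj_mat_mult:
  fixes A B P Q :: "complex mat"
  assumes "P \<in> carrier_mat d d" "Q \<in> carrier_mat d d" "P * Q = 1\<^sub>m d" "A \<in> carrier_mat d d" "B \<in> carrier_mat d d"
  shows "Q * (A * B) * P = (Q * A * P) * (Q * B * P)"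
proof -
  have "(Q * A * P) * (Q * B * P) = Q * A * (P * Q) * B * P"
    using assms(1,2,4,5) by (simp add: assoc_mult_mat[of _ d d _ d _ d])
  also have "\<dots> = Q * (A * B) * P"
    unfolding assms(3) using assms(1,2,4,5) by (simp add: assoc_mult_mat[of _ d d _ d _ d])
  finally show ?thesis by simp
qed

lemma irreducible_conj:
  assumes irr: "irreducible_rep S (d, \<rho>)" and P: "P \<in> carrier_mat d d" and Q: "Q \<in> carrier_mat d d"
    and PQ: "P * Q = 1\<^sub>m d" and QP: "Q * P = 1\<^sub>m d"
  shows "irreducible_rep S (d, \<lambda>f. Q * \<rho> f * P)" "equivalent_reps S (d, \<rho>) (d, \<lambda>f. Q * \<rho> f * P)"
proof -
  note r = representationD[OF irreducible_repD(1)[OF irr]]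
  have unconj: "P * (Q * A * P) * Q = A" if A: "A \<in> carrier_mat d d" for A
  proof -
    have "P * (Q * A * P) * Q = (P * Q) * A * (P * Q)"
      using P Q A by (simp add: assoc_mult_mat[of _ d d _ d _ d])
    then show ?thesis using A by (simp add: PQ)
  qed
  show "equivalent_reps S (d, \<rho>) (d, \<lambda>f. Q * \<rho> f * P)"
    unfolding equivalent_reps_def
  proof (clarsimp, intro exI ballI)
    fix f assume f: "f \<in> semigroup_algebra S"
    show "similar_mat_wit (\<rho> f) (Q * \<rho> f * P) P Q"
      unfolding similar_mat_wit_def Let_def using r(1)[OF f] P Q PQ QP unconj[OF r(1)[OF f]] by auto
  qed
  have rep: "representation S (d, \<lambda>f. Q * \<rho> f * P)"
    unfolding representation_def
  proof (clarsimp, intro conjI ballI allI)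
    fix f assume f: "f \<in> semigroup_algebra S"
    show "Q * \<rho> f * P \<in> carrier_mat d d" using P Q r(1)[OF f] by auto
    show "Q * \<rho> (\<lambda>s. c * f s) * P = c \<cdot>\<^sub>m (Q * \<rho> f * P)" for c
      using P Q r(1)[OF f] r(3)[OF f] by (simp add: mult_smult_distrib[of _ d d _ d] mult_smult_assoc_mat[of _ d d _ d])
    fix g assume g: "g \<in> semigroup_algebra S"
    show "Q * \<rho> (\<lambda>s. f s + g s) * P = Q * \<rho> f * P + Q * \<rho> g * P"
      using P Q r(1)[OF f] r(1)[OF g] r(2)[OF f g] by (simp add: mult_add_distrib_mat[of _ d d _ d] add_mult_distrib_mat[of _ d d _ _ d])
    show "Q * \<rho> (convolve S f g) * P = Q * \<rho> f * P * (Q * \<rho> g * P)"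
      unfolding r(4)[OF f g] by (rule conj_mat_mult[OF P Q PQ r(1)[OF f] r(1)[OF g]])
  qed
  have nz: "\<exists>f\<in>semigroup_algebra S. Q * \<rho> f * P \<noteq> 0\<^sub>m d d"
  proof -
    obtain f where f: "f \<in> semigroup_algebra S" "\<rho> f \<noteq> 0\<^sub>m d d" using irreducible_repD(2)[OF irr] by blast
    have "Q * \<rho> f * P \<noteq> 0\<^sub>m d d"
    proof
      assume z: "Q * \<rho> f * P = 0\<^sub>m d d"
      have "\<rho> f = P * (Q * \<rho> f * P) * Q" using unconj[OF r(1)[OF f(1)]] by simp
      also have "\<dots> = 0\<^sub>m d d" unfolding z using P Q by simp
      finally show False using f(2) by contradiction
    qed
    then show ?thesis using f(1) by blast
  qed
  have sub: "W = {0\<^sub>v d} \<or> W = carrier_vec d" if W: "invariant_subspace S (d, \<lambda>f. Q * \<rho> f * P) W" for W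
  proof -
    have W1: "W \<subseteq> carrier_vec d" "0\<^sub>v d \<in> W" "\<And>v w. v \<in> W \<Longrightarrow> w \<in> W \<Longrightarrow> v + w \<in> W" "\<And>c v. v \<in> W \<Longrightarrow> c \<cdot>\<^sub>v v \<in> W"
      "\<And>f v. f \<in> semigroup_algebra S \<Longrightarrow> v \<in> W \<Longrightarrow> (Q * \<rho> f * P) *\<^sub>v v \<in> W"
      using W by (auto simp: invariant_subspace_def)
    have QPv: "Q *\<^sub>v (P *\<^sub>v v) = v" and PQv: "P *\<^sub>v (Q *\<^sub>v v) = v" if "v \<in> carrier_vec d" for v
      using assoc_mult_mat_vec[OF Q P that] assoc_mult_mat_vec[OF P Q that] that by (auto simp: QP PQ)
    \<comment> \<open>Conjugation transports invariant subspaces: V is the image of W under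
      P.\<close>
    define V where "V = {v \<in> carrier_vec d. Q *\<^sub>v v \<in> W}"
    have "invariant_subspace S (d, \<rho>) V"
      unfolding invariant_subspace_def
    proof (clarsimp, intro conjI ballI allI)
      show "V \<subseteq> carrier_vec d" by (auto simp: V_def)
      have "Q *\<^sub>v 0\<^sub>v d = 0\<^sub>v d" using Q by (auto simp: scalar_prod_def)
      then show "0\<^sub>v d \<in> V" using W1(2) by (simp add: V_def)
      fix v assume v: "v \<in> V"
      then have vc: "v \<in> carrier_vec d" "Q *\<^sub>v v \<in> W" by (auto simp: V_def)
      show "v + w \<in> V" if "w \<in> V" for w
        using that vc W1(3) mult_add_distrib_mat_vec[OF Q vc(1), of w] by (auto simp: V_def)
      show "c \<cdot>\<^sub>v v \<in> V" for c
        using vc W1(4) mult_mat_vec[OF Q vc(1), of c] by (auto simp: V_def)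
      fix f assume f: "f \<in> semigroup_algebra S"
      have "(Q * \<rho> f * P) *\<^sub>v (Q *\<^sub>v v) = Q *\<^sub>v (\<rho> f *\<^sub>v v)"
      proof -
        have "(Q * \<rho> f * P) *\<^sub>v (Q *\<^sub>v v) = (Q * \<rho> f) *\<^sub>v (P *\<^sub>v (Q *\<^sub>v v))"
          using P Q r(1)[OF f] vc(1) by (intro assoc_mult_mat_vec[of _ d d _ d]) auto
        also have "\<dots> = Q *\<^sub>v (\<rho> f *\<^sub>v v)" unfolding PQv[OF vc(1)] using Q r(1)[OF f] vc(1) by (rule assoc_mult_mat_vec)
        finally show ?thesis .
      qed
      then show "\<rho> f *\<^sub>v v \<in> V" using W1(5)[OF f vc(2)] r(1)[OF f] vc(1) by (auto simp: V_def)
    qed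
    then have V: "V = {0\<^sub>v d} \<or> V = carrier_vec d" using irreducible_repD(3)[OF irr] by blast
    have WV: "w \<in> W \<Longrightarrow> P *\<^sub>v w \<in> V" for w
      using W1(1) QPv P by (auto simp: V_def)
    show ?thesis
    proof (cases "V = {0\<^sub>v d}")
      case True
      have "w = 0\<^sub>v d" if w: "w \<in> W" for w
      proof -
        have "P *\<^sub>v w = 0\<^sub>v d" using WV[OF w] True by simp
        then have "w = Q *\<^sub>v 0\<^sub>v d" using QPv[of w] w W1(1) by auto
        then show ?thesis using Q by (auto simp: scalar_prod_def)
      qed
      then show ?thesis using W1(2) by blast
    next
      case False
      then have "V = carrier_vec d" using V by blast
      then have "w \<in> W" if "w \<in> carrier_vec d" for w
      proof -
        have "P *\<^sub>v w \<in> V" using \<open>V = carrier_vec d\<close> P that by auto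
        then show ?thesis using QPv[OF that] by (simp add: V_def)
      qed
      then show ?thesis using W1(1) by blast
    qed
  qed
  show "irreducible_rep S (d, \<lambda>f. Q * \<rho> f * P)"
    unfolding irreducible_rep_def using rep nz sub by simp
qed

lemma equivalent_reps_refl: "irreducible_rep S r \<Longrightarrow> equivalent_reps S r r"
proof -
  assume irr: "irreducible_rep S r"
  obtain d \<rho> where r: "r = (d, \<rho>)" by force
  have "similar_mat_wit (\<rho> f) (\<rho> f) (1\<^sub>m d) (1\<^sub>m d)" if "f \<in> semigroup_algebra S" for f
    using representationD(1)[OF irreducible_repD(1)[OF irr[unfolded r]] that] by (rule similar_mat_wit_refl)
  then show ?thesis unfolding equivalent_reps_def r by blast
qed

lemma equivalent_reps_sym: "equivalent_reps S r r' \<Longrightarrow> equivalent_reps S r' r"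
  unfolding equivalent_reps_def using similar_mat_wit_sym by (clarsimp split: prod.splits) blast

lemma equivalent_reps_trans: "equivalent_reps S r r' \<Longrightarrow> equivalent_reps S r' r'' \<Longrightarrow> equivalent_reps S r r''"
  unfolding equivalent_reps_def using similar_mat_wit_trans by (clarsimp split: prod.splits) blast

lemma bounded_smallest_program:
  assumes "complete_irreps S Y" "computes_fourier S Y p"
  shows "\<exists>m \<le> length p. fourier_complexity S = enat m"
proof -
  have "fourier_complexity S \<le> fourier_complexity_wrt S Y"
    unfolding fourier_complexity_def by (rule INF_lower) (use assms in simp)
  also have "\<dots> \<le> enat (length p)"
    unfolding fourier_complexity_wrt_def by (rule INF_lower) (use assms in simp)
  finally show ?thesis by (cases "fourier_complexity S") auto
qed

section \<open>Irreducible representations of the rook wreath product as matrix families in standard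
  form\<close>

context wreath
begin

abbreviation S where "S n \<equiv> rook_wreath G n"

lemma finite_S: "finite (carrier (S n))"
  using bij_betw_finite[OF bij_toM] finite_Phi by blast

lemma card_S: "card (carrier (S n)) = card (Phi n)"
  using bij_betw_same_card[OF bij_toM] by simp

lemma toM_S: "\<phi> \<in> Phi n \<Longrightarrow> toM n \<phi> \<in> carrier (S n)"
  using bij_betwE[OF bij_toM] by blast

lemma sum_S: "(\<Sum>s\<in>carrier (S n). h s) = (\<Sum>\<phi>\<in>Phi n. h (toM n \<phi>))"
  by (rule sum.reindex_bij_betw[OF bij_toM, symmetric])

definition basis_matrix :: "nat \<Rightarrow> nat \<Rightarrow> (('a option mat \<Rightarrow> complex) \<Rightarrow> complex mat) \<Rightarrow> (nat \<Rightarrow> (nat \<times> 'a) option) \<Rightarrow> (nat, nat) cmat" where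
  "basis_matrix n d \<rho> \<phi> = (\<lambda>i j. if i < d \<and> j < d then \<rho> (basis_elem (toM n \<phi>)) $$ (i, j) else 0)"

lemma basis_matrix_mats: "basis_matrix n d \<rho> \<phi> \<in> mats {..<d} {..<d}"
  by (rule matsI) (auto simp: basis_matrix_def)

lemma basis_matrix_mult:
  assumes rep: "representation (S n) (d, \<rho>)" and p: "\<phi> \<in> Phi n" "\<psi> \<in> Phi n"
  shows "basis_matrix n d \<rho> (pmul \<phi> \<psi>) = basis_matrix n d \<rho> \<phi> \<star>[{..<d}] basis_matrix n d \<rho> \<psi>"
proof (rule mats_eqI[OF basis_matrix_mats mm_mats[OF basis_matrix_mats basis_matrix_mats]])
  fix i j assume ij: "i \<in> {..<d}" "j \<in> {..<d}"
  have m: "toM n \<phi> \<in> carrier (S n)" "toM n \<psi> \<in> carrier (S n)" using toM_S p by auto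
  note b = basis_elem_algebra[OF m(1)] basis_elem_algebra[OF m(2)]
  have "basis_elem (toM n (pmul \<phi> \<psi>)) = convolve (S n) (basis_elem (toM n \<phi>)) (basis_elem (toM n \<psi>))"
    unfolding toM_pmul[OF p] by (rule convolve_basis_elem[OF finite_S m, symmetric])
  then have "\<rho> (basis_elem (toM n (pmul \<phi> \<psi>))) = \<rho> (basis_elem (toM n \<phi>)) * \<rho> (basis_elem (toM n \<psi>))"
    using representationD(4)[OF rep b] by simp
  then show "basis_matrix n d \<rho> (pmul \<phi> \<psi>) i j = (basis_matrix n d \<rho> \<phi> \<star>[{..<d}] basis_matrix n d \<rho> \<psi>) i j"
    using ij representationD(1)[OF rep b(1)] representationD(1)[OF rep b(2)]
    by (simp add: basis_matrix_def mm_def scalar_prod_def lessThan_atLeast0)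
qed

lemma rep_expansion_Phi:
  assumes "representation (S n) (d, \<rho>)" "f \<in> semigroup_algebra (S n)" "i < d" "j < d"
  shows "\<rho> f $$ (i, j) = (\<Sum>\<phi>\<in>Phi n. f (toM n \<phi>) * basis_matrix n d \<rho> \<phi> i j)"
  using rep_expansion[OF finite_S assms] assms(3,4) by (simp add: sum_S basis_matrix_def)

text \<open>The vectors that are combinations of columns of the matrices R s P form an invariant subspace.\<close>

definition reached :: "nat \<Rightarrow> nat \<Rightarrow> ((nat \<Rightarrow> (nat \<times> 'a) option) \<Rightarrow> (nat, nat) cmat) \<Rightarrow> (nat, nat) cmat \<Rightarrow> (nat \<Rightarrow> complex) \<Rightarrow> bool" where
  "reached n d R P v \<longleftrightarrow> (\<exists>c. \<forall>i<d. v i = (\<Sum>x\<in>Phi n \<times> {..<d}. c x * (R (fst x) \<star>[{..<d}] P) i (snd x)))"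

lemma reached_column:
  assumes "s \<in> Phi n" "k < d"
  shows "reached n d R P (\<lambda>i. (R s \<star>[{..<d}] P) i k)"
  unfolding reached_def
proof (intro exI allI impI)
  fix i
  have "(\<Sum>x\<in>Phi n \<times> {..<d}. (if x = (s, k) then 1 else 0) * (R (fst x) \<star>[{..<d}] P) i (snd x)) =
      (\<Sum>x\<in>Phi n \<times> {..<d}. if x = (s, k) then (R s \<star>[{..<d}] P) i k else 0)"
    by (intro sum.cong) auto
  also have "\<dots> = (R s \<star>[{..<d}] P) i k" using assms finite_Phi by (simp add: sum.delta)
  finally show "(R s \<star>[{..<d}] P) i k =
      (\<Sum>x\<in>Phi n \<times> {..<d}. (if x = (s, k) then 1 else 0) * (R (fst x) \<star>[{..<d}] P) i (snd x))" by simp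
qed

lemma reached_sum:
  assumes "\<And>t. t \<in> T \<Longrightarrow> reached n d R P (v t)"
  shows "reached n d R P (\<lambda>i. \<Sum>t\<in>T. a t * v t i)"
proof -
  have "\<forall>t\<in>T. \<exists>c. \<forall>i<d. v t i = (\<Sum>x\<in>Phi n \<times> {..<d}. c x * (R (fst x) \<star>[{..<d}] P) i (snd x))"
    using assms unfolding reached_def by blast
  then obtain c where c: "\<forall>t\<in>T. \<forall>i<d. v t i = (\<Sum>x\<in>Phi n \<times> {..<d}. c t x * (R (fst x) \<star>[{..<d}] P) i (snd x))"
    by (rule bchoice[elim_format]) blast
  show ?thesis
    unfolding reached_def
  proof (intro exI[of _ "\<lambda>x. \<Sum>t\<in>T. a t * c t x"] allI impI)
    fix i assume i: "i < d"
    have "(\<Sum>t\<in>T. a t * v t i) = (\<Sum>t\<in>T. \<Sum>x\<in>Phi n \<times> {..<d}. a t * c t x * (R (fst x) \<star>[{..<d}] P) i (snd x))"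
      using c i by (intro sum.cong refl) (simp add: sum_distrib_left mult.assoc)
    also have "\<dots> = (\<Sum>x\<in>Phi n \<times> {..<d}. (\<Sum>t\<in>T. a t * c t x) * (R (fst x) \<star>[{..<d}] P) i (snd x))"
      by (subst sum.swap) (simp add: sum_distrib_right)
    finally show "(\<Sum>t\<in>T. a t * v t i) = (\<Sum>x\<in>Phi n \<times> {..<d}. (\<Sum>t\<in>T. a t * c t x) * (R (fst x) \<star>[{..<d}] P) i (snd x))" .
  qed
qed

lemma reached_cong: "reached n d R P v \<Longrightarrow> (\<And>i. i < d \<Longrightarrow> w i = v i) \<Longrightarrow> reached n d R P w"
  unfolding reached_def by auto

lemma reached_mult:
  assumes R: "\<And>\<phi> \<psi>. \<phi> \<in> Phi n \<Longrightarrow> \<psi> \<in> Phi n \<Longrightarrow> R (pmul \<phi> \<psi>) = R \<phi> \<star>[{..<d}] R \<psi>"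
    and t: "t \<in> Phi n" and v: "reached n d R P v"
  shows "reached n d R P (\<lambda>i. \<Sum>j<d. R t i j * v j)"
proof -
  obtain c where c: "\<And>i. i < d \<Longrightarrow> v i = (\<Sum>x\<in>Phi n \<times> {..<d}. c x * (R (fst x) \<star>[{..<d}] P) i (snd x))"
    using v unfolding reached_def by blast
  have "(\<Sum>j<d. R t i j * v j) = (\<Sum>x\<in>Phi n \<times> {..<d}. c x * (R (pmul t (fst x)) \<star>[{..<d}] P) i (snd x))" for i
  proof -
    have "(\<Sum>j<d. R t i j * v j) = (\<Sum>j<d. \<Sum>x\<in>Phi n \<times> {..<d}. c x * (R t i j * (R (fst x) \<star>[{..<d}] P) j (snd x)))"
      using c by (intro sum.cong refl) (simp add: sum_distrib_left mult.left_commute)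
    also have "\<dots> = (\<Sum>x\<in>Phi n \<times> {..<d}. c x * (R t \<star>[{..<d}] (R (fst x) \<star>[{..<d}] P)) i (snd x))"
      by (subst sum.swap) (simp add: sum_distrib_left[symmetric] mm_def[of "R t"])
    also have "\<dots> = (\<Sum>x\<in>Phi n \<times> {..<d}. c x * (R (pmul t (fst x)) \<star>[{..<d}] P) i (snd x))"
    proof (intro sum.cong refl)
      fix x assume "x \<in> Phi n \<times> {..<d}"
      then have "fst x \<in> Phi n" by auto
      from R[OF t this] show "c x * (R t \<star>[{..<d}] (R (fst x) \<star>[{..<d}] P)) i (snd x) =
          c x * (R (pmul t (fst x)) \<star>[{..<d}] P) i (snd x)" by (simp only: mm_assoc)
    qed
    finally show ?thesis .
  qed
  moreover have "reached n d R P (\<lambda>i. \<Sum>x\<in>Phi n \<times> {..<d}. c x * (R (pmul t (fst x)) \<star>[{..<d}] P) i (snd x))"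
    by (rule reached_sum, rule reached_column) (auto intro: pmul_Phi[OF t])
  ultimately show ?thesis by simp
qed

text \<open>The reached vectors form an invariant subspace that contains a nonzero column of a
  product, hence all vectors. The coefficients that express the unit vectors are collected in
  M.\<close>

lemma irreducible_generates:
  assumes irr: "irreducible_rep (S n) (d, \<rho>)" and s: "s \<in> Phi n"
    and nz: "basis_matrix n d \<rho> s \<star>[{..<d}] P \<noteq> 0" and P: "P \<in> mats {..<d} {..<d}"
  shows "\<exists>M. (\<Sum>s\<in>Phi n. basis_matrix n d \<rho> s \<star>[{..<d}] P \<star>[{..<d}] M s) = idm {..<d}"
proof -
  let ?R = "basis_matrix n d \<rho>"
  note rep = irreducible_repD(1)[OF irr]
  let ?W = "{v \<in> carrier_vec d. reached n d ?R P (\<lambda>i. v $ i)}"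
  have "invariant_subspace (S n) (d, \<rho>) ?W"
    unfolding invariant_subspace_def
  proof (simp only: prod.case, intro conjI ballI allI)
    show "?W \<subseteq> carrier_vec d" by auto
    have "reached n d ?R P (\<lambda>i. 0\<^sub>v d $ i)"
      using reached_cong[OF reached_sum[of "{}"]] by simp
    then show "0\<^sub>v d \<in> ?W" by simp
  next
    fix v w assume vw: "v \<in> ?W" "w \<in> ?W"
    have "reached n d ?R P (\<lambda>i. if t then v $ i else w $ i)" for t using vw by (cases t) simp_all
    then have "reached n d ?R P (\<lambda>i. \<Sum>t\<in>{False, True}. 1 * (if t then v $ i else w $ i))"
      by (rule reached_sum)
    then have "reached n d ?R P (\<lambda>i. (v + w) $ i)"
      by (rule reached_cong) (use vw in auto)
    then show "v + w \<in> ?W" using vw by simp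
  next
    fix c v assume v: "v \<in> ?W"
    have "reached n d ?R P (\<lambda>i. \<Sum>t\<in>{()}. c * v $ i)"
      using v by (intro reached_sum[where v = "\<lambda>t i. v $ i"]) auto
    then have "reached n d ?R P (\<lambda>i. (c \<cdot>\<^sub>v v) $ i)"
      by (rule reached_cong) (use v in auto)
    then show "c \<cdot>\<^sub>v v \<in> ?W" using v by simp
  next
    fix f v assume f: "f \<in> semigroup_algebra (S n)" and v: "v \<in> ?W"
    have fm: "\<rho> f \<in> carrier_mat d d" by (rule representationD(1)[OF rep f])
    have vd: "v \<in> carrier_vec d" using v by simp
    have "reached n d ?R P (\<lambda>i. \<Sum>t\<in>Phi n. f (toM n t) * (\<Sum>j<d. ?R t i j * v $ j))"
      by (rule reached_sum, rule reached_mult) (use v basis_matrix_mult[OF rep] in auto)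
    then have "reached n d ?R P (\<lambda>i. (\<rho> f *\<^sub>v v) $ i)"
    proof (rule reached_cong)
      fix i assume i: "i < d"
      have "(\<rho> f *\<^sub>v v) $ i = (\<Sum>j<d. \<rho> f $$ (i, j) * v $ j)"
        using i fm vd by (auto simp: scalar_prod_def lessThan_atLeast0 intro!: sum.cong)
      also have "\<dots> = (\<Sum>j<d. \<Sum>t\<in>Phi n. f (toM n t) * (?R t i j * v $ j))"
        using rep_expansion_Phi[OF rep f i] by (intro sum.cong refl) (simp add: sum_distrib_right mult.assoc)
      also have "\<dots> = (\<Sum>t\<in>Phi n. f (toM n t) * (\<Sum>j<d. ?R t i j * v $ j))"
        by (subst sum.swap) (simp add: sum_distrib_left)
      finally show "(\<rho> f *\<^sub>v v) $ i = (\<Sum>t\<in>Phi n. f (toM n t) * (\<Sum>j<d. ?R t i j * v $ j))" .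
    qed
    then show "\<rho> f *\<^sub>v v \<in> ?W" using fm v by simp
  qed
  from irreducible_repD(3)[OF irr this] have W: "?W = {0\<^sub>v d} \<or> ?W = carrier_vec d" .
  obtain i k where ik: "(?R s \<star>[{..<d}] P) i k \<noteq> 0" using nz by (metis ext zero_fun_apply)
  have ikd: "i < d" "k < d" using ik mats_zero[OF mm_mats[OF basis_matrix_mats[of n d \<rho> s] P, of "{..<d}"], of i k] by auto
  let ?v = "vec d (\<lambda>i. (?R s \<star>[{..<d}] P) i k)"
  have "?v \<in> ?W" using reached_cong[OF reached_column[OF s ikd(2), of ?R P]] by simp
  moreover have "?v \<noteq> 0\<^sub>v d" using ik ikd by (metis index_vec index_zero_vec(1))
  ultimately have "?W = carrier_vec d" using W by blast
  then have "reached n d ?R P (\<lambda>i. unit_vec d j $ i)" for j using unit_vec_carrier[of d j] by blast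
  then have "\<forall>j. \<exists>c. \<forall>i<d. unit_vec d j $ i = (\<Sum>x\<in>Phi n \<times> {..<d}. c x * (?R (fst x) \<star>[{..<d}] P) i (snd x))"
    unfolding reached_def by blast
  then obtain c where c: "\<And>i j. i < d \<Longrightarrow> unit_vec d j $ i = (\<Sum>x\<in>Phi n \<times> {..<d}. c j x * (?R (fst x) \<star>[{..<d}] P) i (snd x))"
    by (rule choice[elim_format]) blast
  define M where "M = (\<lambda>s k j. if j < d \<and> k < d then c j (s, k) else 0)"
  have Mm: "M s \<in> mats {..<d} {..<d}" for s by (rule matsI) (auto simp: M_def)
  have "(\<Sum>s\<in>Phi n. ?R s \<star>[{..<d}] P \<star>[{..<d}] M s) = idm {..<d}"
  proof (rule mats_eqI)
    show "(\<Sum>s\<in>Phi n. ?R s \<star>[{..<d}] P \<star>[{..<d}] M s) \<in> mats {..<d} {..<d}"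
      by (rule sum_mats, rule mm_mats[OF mm_mats[OF basis_matrix_mats P] Mm])
    show "idm {..<d} \<in> mats {..<d} {..<d}" by (rule idm_mats)
    fix i j assume ij: "i \<in> {..<d}" "j \<in> {..<d}"
    have "(\<Sum>s\<in>Phi n. ?R s \<star>[{..<d}] P \<star>[{..<d}] M s) i j = (\<Sum>s\<in>Phi n. \<Sum>k<d. c j (s, k) * (?R s \<star>[{..<d}] P) i k)"
      unfolding sum_fun_eval using ij by (intro sum.cong refl) (simp add: mm_def[of "_ \<star>[_] _"] M_def mult.commute)
    also have "\<dots> = unit_vec d j $ i" using c[of i j] ij by (simp add: sum.cartesian_product split_def)
    finally show "(\<Sum>s\<in>Phi n. ?R s \<star>[{..<d}] P \<star>[{..<d}] M s) i j = idm {..<d} i j"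
      using ij by (auto simp: idm_def unit_vec_def)
  qed
  then show ?thesis by blast
qed

lemma irreducible_rook_rep:
  assumes irr: "irreducible_rep (S n) (d, \<rho>)"
  shows "rook_rep G n d (basis_matrix n d \<rho>)"
proof (rule rook_rep.intro[OF wreath_axioms], rule rook_rep_axioms.intro)
  note rep = irreducible_repD(1)[OF irr]
  show "basis_matrix n d \<rho> \<phi> \<in> mats {..<d} {..<d}" for \<phi> by (rule basis_matrix_mats)
  show "basis_matrix n d \<rho> (pmul \<phi> \<psi>) = basis_matrix n d \<rho> \<phi> \<star>[{..<d}] basis_matrix n d \<rho> \<psi>"
    if "\<phi> \<in> Phi n" "\<psi> \<in> Phi n" for \<phi> \<psi> by (rule basis_matrix_mult[OF rep that])
  show "\<exists>M. (\<Sum>s\<in>Phi n. basis_matrix n d \<rho> s \<star>[{..<d}] P \<star>[{..<d}] M s) = idm {..<d}"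
    if "P \<in> mats {..<d} {..<d}" "s \<in> Phi n" "basis_matrix n d \<rho> s \<star>[{..<d}] P \<noteq> 0" for P s
    by (rule irreducible_generates[OF irr that(2,3,1)])
  show "\<exists>s\<in>Phi n. basis_matrix n d \<rho> s \<noteq> 0"
  proof (rule ccontr)
    assume "\<not> ?thesis"
    then have z: "basis_matrix n d \<rho> s i j = 0" if "s \<in> Phi n" for s i j using that by auto
    obtain f where f: "f \<in> semigroup_algebra (S n)" "\<rho> f \<noteq> 0\<^sub>m d d" using irreducible_repD(2)[OF irr] by blast
    have "\<rho> f = 0\<^sub>m d d"
      by (rule eq_matI) (use rep_expansion_Phi[OF rep f(1)] representationD(1)[OF rep f(1)] z in auto)
    then show False using f(2) by contradiction
  qed
qed

text \<open>The matrix entries of a standard representation are combinations, with the group representation \<mu>, of the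
  indicator functions of the sets of extensions of the partial maps mk L J w.\<close>

definition standard :: "nat \<Rightarrow> 'a option mat rep \<Rightarrow> bool" where
  "standard n = (\<lambda>(d, \<rho>). irreducible_rep (S n) (d, \<rho>) \<and> (\<exists>k\<le>n. \<exists>r \<mu> \<beta>. (r, \<mu>) \<in> chain.irr k \<and>
    (\<forall>i<d. \<beta> i \<in> basis_index n k r) \<and>
    (\<forall>\<phi>\<in>Phi n. \<forall>i<d. \<forall>j<d. \<rho> (basis_elem (toM n \<phi>)) $$ (i, j) =
      (\<Sum>w\<in>K k. if \<phi> |` fst (\<beta> j) = mk (fst (\<beta> i)) (fst (\<beta> j)) w then \<mu> w (snd (\<beta> i)) (snd (\<beta> j)) else 0))))"

text \<open>The coordinates of \<open>normal_form\<close> are pairs (J, j). The base change is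
  invertible on both sides, so there are exactly d of them, and numbering them by \<beta> allows
  conjugation with ordinary square matrices.\<close>

lemma exists_standard:
  assumes irr: "irreducible_rep (S n) r"
  shows "\<exists>r'. standard n r' \<and> equivalent_reps (S n) r r'"
proof -
  obtain d \<rho> where r: "r = (d, \<rho>)" by force
  note irr = irr[unfolded r]
  interpret rook_rep G n d "basis_matrix n d \<rho>" by (rule irreducible_rook_rep[OF irr])
  obtain k e \<mu> PP QQ where k: "k \<le> n" and y: "(e, \<mu>) \<in> chain.irr k"
    and PP: "PP \<in> mats {..<d} (basis_index n k e)" and QQ: "QQ \<in> mats (basis_index n k e) {..<d}"
    and PQ: "PP \<star>[basis_index n k e] QQ = idm {..<d}" and QP: "QQ \<star>[{..<d}] PP = idm (basis_index n k e)"
    and coef: "\<forall>\<phi>\<in>Phi n. \<forall>(L, l)\<in>basis_index n k e. \<forall>(J, j)\<in>basis_index n k e.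
      (QQ \<star>[{..<d}] basis_matrix n d \<rho> \<phi> \<star>[{..<d}] PP) (L, l) (J, j) = (\<Sum>w\<in>K k. if \<phi> |` J = mk L J w then \<mu> w l j else 0)"
    using normal_form by blast
  define I where "I = basis_index n k e"
  have finI: "finite I"
    unfolding I_def basis_index_def by (intro finite_cartesian_product finite_subset[of "{J. J \<subseteq> {..<n} \<and> card J = k}" "Pow {..<n}"]) auto
  have PQe: "(\<Sum>x\<in>I. PP i x * QQ x j) = idm {..<d} i j" for i j
    using fun_cong[OF fun_cong[OF PQ], of i j] by (simp add: mm_def I_def)
  have QPe: "(\<Sum>i<d. QQ x i * PP i y) = idm I x y" for x y
    using fun_cong[OF fun_cong[OF QP], of x y] by (simp add: mm_def I_def)
  have "card I \<le> card {..<d}" by (rule left_inverse_card_le[of _ _ QQ PP]) (use finI QPe in \<open>auto simp: idm_def\<close>)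
  moreover have "card {..<d} \<le> card I" by (rule left_inverse_card_le[of _ _ PP QQ]) (use finI PQe in \<open>auto simp: idm_def\<close>)
  ultimately have "card {..<d} = card I" by simp
  then obtain \<beta> where \<beta>: "bij_betw \<beta> {..<d} I" using finite_same_card_bij[OF finite_lessThan finI] by blast
  have \<beta>I: "\<beta> i \<in> I" if "i < d" for i using bij_betwE[OF \<beta>] that by auto
  have \<beta>inj: "\<beta> i = \<beta> j \<longleftrightarrow> i = j" if "i < d" "j < d" for i j
    using inj_onD[OF bij_betw_imp_inj_on[OF \<beta>], of i j] that by auto
  define P where "P = mat d d (\<lambda>(i, j). PP i (\<beta> j))"
  define Q where "Q = mat d d (\<lambda>(i, j). QQ (\<beta> i) j)"
  have Pc: "P \<in> carrier_mat d d" and Qc: "Q \<in> carrier_mat d d" by (auto simp: P_def Q_def)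
  have PQ1: "P * Q = 1\<^sub>m d"
  proof (rule eq_matI)
    fix i j assume "i < dim_row (1\<^sub>m d)" "j < dim_col (1\<^sub>m d)"
    then have ij: "i < d" "j < d" by auto
    have "(P * Q) $$ (i, j) = (\<Sum>t<d. PP i (\<beta> t) * QQ (\<beta> t) j)"
      using ij by (simp add: P_def Q_def scalar_prod_def lessThan_atLeast0)
    also have "\<dots> = (\<Sum>x\<in>I. PP i x * QQ x j)" by (rule sum.reindex_bij_betw[OF \<beta>])
    finally show "(P * Q) $$ (i, j) = 1\<^sub>m d $$ (i, j)" using ij by (simp add: PQe idm_def)
  qed (use Pc Qc in auto)
  have QP1: "Q * P = 1\<^sub>m d"
  proof (rule eq_matI)
    fix i j assume "i < dim_row (1\<^sub>m d)" "j < dim_col (1\<^sub>m d)"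
    then have ij: "i < d" "j < d" by auto
    have "(Q * P) $$ (i, j) = (\<Sum>t<d. QQ (\<beta> i) t * PP t (\<beta> j))"
      using ij by (simp add: P_def Q_def scalar_prod_def lessThan_atLeast0)
    then show "(Q * P) $$ (i, j) = 1\<^sub>m d $$ (i, j)"
      using ij \<beta>I[of i] by (simp add: QPe idm_def \<beta>inj)
  qed (use Pc Qc in auto)
  let ?\<rho>' = "\<lambda>f. Q * \<rho> f * P"
  note conj = irreducible_conj[OF irr Pc Qc PQ1 QP1]
  have "?\<rho>' (basis_elem (toM n \<phi>)) $$ (i, j) =
      (\<Sum>w\<in>K k. if \<phi> |` fst (\<beta> j) = mk (fst (\<beta> i)) (fst (\<beta> j)) w then \<mu> w (snd (\<beta> i)) (snd (\<beta> j)) else 0)"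
    if \<phi>: "\<phi> \<in> Phi n" and ij: "i < d" "j < d" for \<phi> i j
  proof -
    have m: "\<rho> (basis_elem (toM n \<phi>)) \<in> carrier_mat d d"
      by (rule representationD(1)[OF irreducible_repD(1)[OF irr] basis_elem_algebra[OF toM_S[OF \<phi>]]])
    have "?\<rho>' (basis_elem (toM n \<phi>)) $$ (i, j) =
        (\<Sum>t<d. (\<Sum>u<d. QQ (\<beta> i) u * basis_matrix n d \<rho> \<phi> u t) * PP t (\<beta> j))"
      using ij m Pc Qc by (simp add: P_def Q_def scalar_prod_def lessThan_atLeast0 basis_matrix_def)
    also have "\<dots> = (QQ \<star>[{..<d}] basis_matrix n d \<rho> \<phi> \<star>[{..<d}] PP) (\<beta> i) (\<beta> j)" by (simp only: mm_def)
    also have "\<dots> = (\<Sum>w\<in>K k. if \<phi> |` fst (\<beta> j) = mk (fst (\<beta> i)) (fst (\<beta> j)) w then \<mu> w (snd (\<beta> i)) (snd (\<beta> j)) else 0)"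
    proof -
      obtain L l where Ll: "\<beta> i = (L, l)" by force
      obtain J t where Jt: "\<beta> j = (J, t)" by force
      have in1: "(L, l) \<in> basis_index n k e" and in2: "(J, t) \<in> basis_index n k e"
        using \<beta>I[OF ij(1)] \<beta>I[OF ij(2)] unfolding Ll Jt I_def .
      show ?thesis unfolding Ll Jt fst_conv snd_conv
        using bspec[OF bspec[OF bspec[OF coef \<phi>] in1, unfolded prod.case] in2, unfolded prod.case] .
    qed
    finally show ?thesis .
  qed
  then have "standard n (d, ?\<rho>')"
    unfolding standard_def prod.case
    using conj(1) k y \<beta>I[unfolded I_def] by (intro conjI exI[of _ k] exI[of _ e] exI[of _ \<mu>] exI[of _ \<beta>]) auto
  then show ?thesis using conj(2) r by blast
qed

text \<open>Representatives are taken among the irreducible representations in standard form. Every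
  irreducible representation is equivalent to one of these, so the choice meets each class exactly
  once.\<close>

lemma exists_complete_standard: "\<exists>Y. complete_irreps (S n) Y \<and> (\<forall>r\<in>Y. standard n r)"
proof -
  let ?Z = "{r. standard n r}"
  have irr: "irreducible_rep (S n) r" if "standard n r" for r using that by (cases r) (auto simp: standard_def)
  define Y where "Y = transversal (equivalent_reps (S n)) ?Z"
  have Z: "Y \<subseteq> ?Z" unfolding Y_def
    by (rule transversal(1)) (use equivalent_reps_refl irr equivalent_reps_sym equivalent_reps_trans in blast)+
  have cover: "\<exists>y\<in>Y. equivalent_reps (S n) z y" if "z \<in> ?Z" for z
    unfolding Y_def by (rule transversal(2)[OF _ _ _ that]) (use equivalent_reps_refl irr equivalent_reps_sym equivalent_reps_trans in blast)+
  have uniq: "x = y" if "x \<in> Y" "y \<in> Y" "equivalent_reps (S n) x y" for x y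
    by (rule transversal(3)[OF _ _ _ that[unfolded Y_def]])
      (use equivalent_reps_refl irr equivalent_reps_sym equivalent_reps_trans in blast)+
  have "\<exists>!r'. r' \<in> Y \<and> equivalent_reps (S n) r r'" if r: "irreducible_rep (S n) r" for r
  proof -
    obtain z where z: "standard n z" "equivalent_reps (S n) r z" using exists_standard[OF r] by blast
    obtain y where y: "y \<in> Y" "equivalent_reps (S n) z y" using cover z(1) by blast
    show ?thesis
    proof (rule ex1I[of _ y])
      show "y \<in> Y \<and> equivalent_reps (S n) r y" using y equivalent_reps_trans[OF z(2) y(2)] by blast
      fix x assume x: "x \<in> Y \<and> equivalent_reps (S n) r x"
      have "equivalent_reps (S n) x y"
        using x equivalent_reps_trans[OF equivalent_reps_sym equivalent_reps_trans[OF z(2) y(2)]] by blast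
      then show "x = y" using uniq x y(1) by blast
    qed
  qed
  then have "complete_irreps (S n) Y" unfolding complete_irreps_def using Z irr by blast
  then show ?thesis using Z by blast
qed

section \<open>The Fourier coefficients as quantities and the count of operations\<close>

definition input :: "nat \<Rightarrow> (nat \<Rightarrow> (nat \<times> 'a) option) \<Rightarrow> ('a option mat \<Rightarrow> complex) \<Rightarrow> complex" where
  "input n \<phi> = (\<lambda>f. f (toM n \<phi>))"

text \<open>For m = n every column outside the domain of t is free, because maps in
  \<open>Phi n\<close> are empty from column n on.\<close>

lemma extensions_mk:
  assumes t: "t \<in> Phi n"
  shows "extensions n n t = {s \<in> Phi n. s |` dom t = t}"
proof -
  have "(\<forall>j. j \<in> dom t \<or> n \<le> j \<longrightarrow> s j = t j) \<longleftrightarrow> s |` dom t = t" if s: "s \<in> Phi n" for s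
  proof -
    have "u j = None" if "u \<in> Phi n" "n \<le> j" for u j
      using PhiD(2)[OF that(1), of j] that(2) by (cases "u j") auto
    then have z: "s j = None" "t j = None" if "n \<le> j" for j using s t that by blast+
    show ?thesis
    proof
      assume a: "\<forall>j. j \<in> dom t \<or> n \<le> j \<longrightarrow> s j = t j"
      show "s |` dom t = t"
      proof
        fix j show "(s |` dom t) j = t j"
        proof (cases "t j")
          case None
          then show ?thesis by (simp add: restrict_map_def domIff)
        next
          case (Some x)
          then have j: "j \<in> dom t" by auto
          then have "s j = t j" using a by blast
          then show ?thesis using j by (simp only: restrict_in)
        qed
      qed
    next
      assume a: "s |` dom t = t"
      have "s j = t j" if "j \<in> dom t" for j using fun_cong[OF a, of j] that by (simp add: restrict_map_def)
      then show "\<forall>j. j \<in> dom t \<or> n \<le> j \<longrightarrow> s j = t j" using z by metis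
    qed
  qed
  then show ?thesis unfolding extensions_def by blast
qed

text \<open>The first term pays for the table of sums over extensions; then each pair of k-element
  sets takes one transform on \<open>K k\<close>.\<close>

definition program_cost :: "nat \<Rightarrow> nat" where
  "program_cost n = n * (card (Phi n) * Suc (n * card (carrier G))) +
    (\<Sum>k\<le>n. card {J. J \<subseteq> {..<n} \<and> card J = k} * card {J. J \<subseteq> {..<n} \<and> card J = k} * chain.fft_cost k)"

lemma fourier_quantities:
  "slp (input n ` Phi n) (program_cost n)
    (\<Union>k\<in>{..n}. \<Union>(L, J)\<in>{J. J \<subseteq> {..<n} \<and> card J = k} \<times> {J. J \<subseteq> {..<n} \<and> card J = k}.
      chain.coefficient k (\<lambda>w. zeta n (input n) n (mk L J w)) ` chain.entries k)"
  unfolding program_cost_def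
proof (rule slp_comp[OF zeta_cost], rule slp_UN)
  fix k
  let ?N = "{J. J \<subseteq> {..<n} \<and> card J = k}"
  have N: "finite ?N" by (rule finite_subset[of _ "Pow {..<n}"]) auto
  show "slp (zeta n (input n) n ` Phi n) (card ?N * card ?N * chain.fft_cost k)
      (\<Union>(L, J)\<in>?N \<times> ?N. chain.coefficient k (\<lambda>w. zeta n (input n) n (mk L J w)) ` chain.entries k)"
  proof (rule slp_UN_le)
    show "finite (?N \<times> ?N)" using N by simp
    show "card (?N \<times> ?N) * chain.fft_cost k \<le> card ?N * card ?N * chain.fft_cost k" by (simp add: card_cartesian_product)
    fix x assume x: "x \<in> ?N \<times> ?N"
    obtain L J where LJ: "x = (L, J)" by force
    have "(\<lambda>w. zeta n (input n) n (mk L J w)) ` K k \<subseteq> zeta n (input n) n ` Phi n"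
      using x mk_Phi unfolding LJ by auto
    then show "slp (zeta n (input n) n ` Phi n) (chain.fft_cost k)
        (case x of (L, J) \<Rightarrow> chain.coefficient k (\<lambda>w. zeta n (input n) n (mk L J w)) ` chain.entries k)"
      unfolding LJ prod.case by (intro slp_mono_in[OF chain.fft]) blast
  qed
qed simp

text \<open>Inserting the standard form and exchanging the sums over \<phi> and w turns the matrix
  entry into a coefficient on \<open>K k\<close> of the function that sends w to the sum of f over
  the extensions of \<open>mk L J w\<close>.\<close>

lemma standard_fourier:
  assumes std: "standard n (d, \<rho>)" and ij: "i < d" "j < d"
  shows "\<exists>b\<in>(\<Union>k\<in>{..n}. \<Union>(L, J)\<in>{J. J \<subseteq> {..<n} \<and> card J = k} \<times> {J. J \<subseteq> {..<n} \<and> card J = k}.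
      chain.coefficient k (\<lambda>w. zeta n (input n) n (mk L J w)) ` chain.entries k).
    \<forall>f. b f = fourier (S n) f (d, \<rho>) $$ (i, j)"
proof -
  obtain k r \<mu> \<beta> where k: "k \<le> n" and y: "(r, \<mu>) \<in> chain.irr k" and \<beta>: "\<forall>i<d. \<beta> i \<in> basis_index n k r"
    and coef: "\<forall>\<phi>\<in>Phi n. \<forall>i<d. \<forall>j<d. \<rho> (basis_elem (toM n \<phi>)) $$ (i, j) =
      (\<Sum>w\<in>K k. if \<phi> |` fst (\<beta> j) = mk (fst (\<beta> i)) (fst (\<beta> j)) w then \<mu> w (snd (\<beta> i)) (snd (\<beta> j)) else 0)"
    using std unfolding standard_def by blast
  obtain L l where Ll: "\<beta> i = (L, l)" by force
  obtain J t where Jt: "\<beta> j = (J, t)" by force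
  have "(L, l) \<in> basis_index n k r" "(J, t) \<in> basis_index n k r" using \<beta> ij Ll Jt by metis+
  then have LJ: "L \<subseteq> {..<n}" "card L = k" "J \<subseteq> {..<n}" "card J = k" "l < r" "t < r" by (auto simp: basis_index_def)
  let ?b = "chain.coefficient k (\<lambda>w. zeta n (input n) n (mk L J w)) ((r, \<mu>), l, t)"
  have "?b f = fourier (S n) f (d, \<rho>) $$ (i, j)" for f
  proof -
    have z: "zeta n (input n) n (mk L J w) f = (\<Sum>\<phi>\<in>Phi n. if \<phi> |` J = mk L J w then f (toM n \<phi>) else 0)"
      if w: "w \<in> K k" for w
      unfolding zeta_def extensions_mk[OF mk_Phi[OF w LJ(3,4,1,2)]] dom_mk input_def
      by (rule sum.inter_filter[OF finite_Phi])
    have "?b f = (\<Sum>w\<in>K k. \<Sum>\<phi>\<in>Phi n. f (toM n \<phi>) * (if \<phi> |` J = mk L J w then \<mu> w l t else 0))"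
      unfolding chain.coefficient_def prod.case snd_conv using z
      by (intro sum.cong refl) (simp add: sum_distrib_right if_distrib[of "\<lambda>x. x * _"] if_distrib[of "\<lambda>x. _ * x"] cong: if_cong)
    also have "\<dots> = (\<Sum>\<phi>\<in>Phi n. f (toM n \<phi>) * (\<Sum>w\<in>K k. if \<phi> |` J = mk L J w then \<mu> w l t else 0))"
      by (subst sum.swap) (simp add: sum_distrib_left)
    also have "\<dots> = (\<Sum>\<phi>\<in>Phi n. f (toM n \<phi>) * \<rho> (basis_elem (toM n \<phi>)) $$ (i, j))"
      using coef[rule_format, OF _ ij] unfolding Ll Jt fst_conv snd_conv by (intro sum.cong refl) simp
    also have "\<dots> = fourier (S n) f (d, \<rho>) $$ (i, j)"
      using ij by (simp add: fourier_def sum_S)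
    finally show ?thesis .
  qed
  moreover have "((r, \<mu>), l, t) \<in> chain.entries k" using y LJ by (auto simp: chain.entries_def)
  then have "?b \<in> (\<Union>k\<in>{..n}. \<Union>(L, J)\<in>{J. J \<subseteq> {..<n} \<and> card J = k} \<times> {J. J \<subseteq> {..<n} \<and> card J = k}.
      chain.coefficient k (\<lambda>w. zeta n (input n) n (mk L J w)) ` chain.entries k)"
    by (intro UN_I[of k] UN_I[of "(L, J)"]) (use k LJ in auto)
  ultimately show ?thesis by blast
qed

text \<open>One complete set and one program for it bound both infima, which also shows that the
  complexity is finite.\<close>

lemma fourier_complexity_bound: "\<exists>m \<le> program_cost n. fourier_complexity (S n) = enat m"
proof -
  obtain Y where Y: "complete_irreps (S n) Y" "\<forall>r\<in>Y. standard n r" using exists_complete_standard by blast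
  let ?B = "\<Union>k\<in>{..n}. \<Union>(L, J)\<in>{J. J \<subseteq> {..<n} \<and> card J = k} \<times> {J. J \<subseteq> {..<n} \<and> card J = k}.
      chain.coefficient k (\<lambda>w. zeta n (input n) n (mk L J w)) ` chain.entries k"
  have inputs: "realizes (S n) [] a" if a: "a \<in> input n ` Phi n" for a
  proof -
    obtain \<phi> where \<phi>: "\<phi> \<in> Phi n" "a = input n \<phi>" using a by blast
    show ?thesis
      unfolding realizes_def by (rule exI[of _ "Input (toM n \<phi>)"]) (simp add: \<phi> toM_S input_def)
  qed
  have "valid_program (S n) []" by (simp add: valid_program_def)
  then have "\<exists>p. valid_program (S n) p \<and> length p = length ([] :: 'a option mat program) + program_cost n \<and>
      (\<forall>b\<in>?B. realizes (S n) p b)"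
    by (rule slp_program[OF fourier_quantities]) (rule inputs)
  then obtain p where p: "valid_program (S n) p" "length p = program_cost n" "\<forall>b\<in>?B. realizes (S n) p b"
    unfolding list.size add_0 by (elim exE conjE) (rule that)
  define out where "out = (\<lambda>r i j. SOME x. available (S n) (length p) x \<and>
    (\<forall>f. operand_value f (run f p) x = fourier (S n) f r $$ (i, j)))"
  have out: "available (S n) (length p) (out (d, \<rho>) i j) \<and>
      (\<forall>f. operand_value f (run f p) (out (d, \<rho>) i j) = fourier (S n) f (d, \<rho>) $$ (i, j))"
    if dij: "(d, \<rho>) \<in> Y" "i < d" "j < d" for d \<rho> i j
  proof -
    obtain b where b: "b \<in> ?B" "\<forall>f. b f = fourier (S n) f (d, \<rho>) $$ (i, j)"
      by (rule bexE[OF standard_fourier[OF bspec[OF Y(2) dij(1)] dij(2,3)]]) (rule that)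
    obtain x where x: "available (S n) (length p) x" "\<forall>f. operand_value f (run f p) x = b f"
      using bspec[OF p(3) b(1)] unfolding realizes_def by (elim exE conjE) (rule that)
    have "\<exists>x. available (S n) (length p) x \<and> (\<forall>f. operand_value f (run f p) x = fourier (S n) f (d, \<rho>) $$ (i, j))"
      by (rule exI[of _ x]) (simp only: x b simp_thms)
    then show ?thesis unfolding out_def by (rule someI_ex)
  qed
  have "computes_fourier (S n) Y p"
    unfolding computes_fourier_def
  proof (intro conjI p(1) exI[of _ out] ballI)
    fix r assume r: "r \<in> Y"
    obtain d \<rho> where dr: "r = (d, \<rho>)" by force
    show "case r of (d, \<rho>) \<Rightarrow> \<forall>i<d. \<forall>j<d. available (S n) (length p) (out (d, \<rho>) i j) \<and>
        (\<forall>f\<in>semigroup_algebra (S n). operand_value f (run f p) (out (d, \<rho>) i j) = fourier (S n) f (d, \<rho>) $$ (i, j))"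
      unfolding dr prod.case using out[OF r[unfolded dr]] by simp
  qed
  from bounded_smallest_program[OF Y(1) this] show ?thesis using p(2) by simp
qed

text \<open>The bound per element of \<open>K k\<close> grows with k, so its value at n can be taken
  out of the sum; \<open>sum_card_triples\<close> bounds what remains.\<close>

lemma program_cost_le:
  "program_cost n \<le> (n * Suc (n * card (carrier G)) + card (K 0) + 2 * card (carrier G) * card (carrier G) * n * n ^ 3) * card (Phi n)"
proof -
  let ?N = "\<lambda>k. card {J. J \<subseteq> {..<n} \<and> card J = k}"
  let ?C = "card (K 0) + 2 * card (carrier G) * card (carrier G) * n * n ^ 3"
  have "(\<Sum>k\<le>n. ?N k * ?N k * chain.fft_cost k) \<le> (\<Sum>k\<le>n. ?N k * ?N k * (?C * card (K k)))"
  proof (intro sum_mono mult_le_mono2)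
    fix k assume "k \<in> {..n}"
    then have k: "k \<le> n" by simp
    have "2 * card (carrier G) * card (carrier G) * k * k ^ 3 \<le> 2 * card (carrier G) * card (carrier G) * n * n ^ 3"
      using k by (intro mult_le_mono power_mono order_refl) auto
    then have "(card (K 0) + 2 * card (carrier G) * card (carrier G) * k * k ^ 3) * card (K k) \<le> ?C * card (K k)"
      by (intro mult_le_mono1) simp
    then show "chain.fft_cost k \<le> ?C * card (K k)" using chain.fft_cost_le[of k] by (rule order_trans[rotated])
  qed
  also have "\<dots> = ?C * (\<Sum>k\<le>n. ?N k * ?N k * card (K k))"
    unfolding sum_distrib_left by (intro sum.cong refl) (simp only: mult_ac)
  also have "\<dots> \<le> ?C * card (Phi n)" by (rule mult_le_mono2[OF sum_card_triples])
  finally have "(\<Sum>k\<le>n. ?N k * ?N k * chain.fft_cost k) \<le> ?C * card (Phi n)" .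
  then show ?thesis unfolding program_cost_def by (simp only: distrib_right add.assoc mult.assoc mult.left_commute mult.commute) (simp add: algebra_simps)
qed

text \<open>The partial identities alone number 2^n. Hence n is at most the binary logarithm of the
  order, which turns n^4 into the fourth power of a logarithm.\<close>

lemma two_power_le_card: "2 ^ n \<le> card (Phi n)"
proof -
  have "inj_on pid (Pow {..<n})"
    by (rule inj_onI) (metis im_pid)
  moreover have "pid ` Pow {..<n} \<subseteq> Phi n" by (auto intro: pid_Phi)
  ultimately have "card (Pow {..<n}) \<le> card (Phi n)" using finite_Phi by (rule card_inj_on_le)
  then show ?thesis by (simp add: card_Pow)
qed

lemma program_cost_bigo:
  assumes C: "\<And>n. C n \<le> program_cost n"
  shows "(\<lambda>n. real (C n)) \<in> O(\<lambda>n. real (card (Phi n)) * ln (real (card (Phi n))) ^ 4)"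
proof -
  define c where "c = card (carrier G)"
  \<comment> \<open>The coefficients after all powers of n are raised to n^4: 1 + c from the sums
    over extensions, \<open>card (K 0)\<close> from the transforms at level 0, and 2 c^2 from the
    higher levels.\<close>
  define A where "A = 1 + c + card (K 0) + 2 * c * c"
  have bound: "real (C n) \<le> real A / ln 2 ^ 4 * (real (card (Phi n)) * ln (real (card (Phi n))) ^ 4)" if n: "n \<ge> 1" for n
  proof -
    have n4: "1 \<le> n ^ 4" "n \<le> n ^ 4" "n * n \<le> n ^ 4"
      using n power_increasing[of 1 4 n] power_increasing[of 2 4 n] by (auto simp: power2_eq_square)
    have key: "n * Suc (n * c) + card (K 0) + 2 * c * c * n * n ^ 3 \<le> A * n ^ 4"
    proof -
      have "n * Suc (n * c) = n + c * (n * n)" by (simp add: algebra_simps)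
      also have "\<dots> \<le> n ^ 4 + c * n ^ 4" using n4 by (intro add_mono mult_le_mono2)
      finally have 1: "n * Suc (n * c) \<le> n ^ 4 + c * n ^ 4" .
      have 2: "card (K 0) \<le> card (K 0) * n ^ 4" using mult_le_mono2[OF n4(1), of "card (K 0)"] by simp
      have 3: "2 * c * c * n * n ^ 3 = 2 * c * c * n ^ 4" by (simp add: power_Suc[symmetric] numeral_eq_Suc)
      show ?thesis unfolding 3 A_def using 1 2 by (simp only: distrib_right mult_1)
    qed
    have "C n \<le> A * n ^ 4 * card (Phi n)"
      by (rule order_trans[OF C order_trans[OF program_cost_le mult_le_mono1[OF key[unfolded c_def]]]])
    from of_nat_mono[OF this, where 'a = real]
    have 1: "real (C n) \<le> real A * (real n) ^ 4 * real (card (Phi n))" by simp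
    have two: "(2 :: real) ^ n \<le> real (card (Phi n))"
      using of_nat_mono[OF two_power_le_card[of n], where 'a = real] by simp
    have "real n * ln 2 = ln (2 ^ n)" by (simp add: ln_realpow)
    also have "\<dots> \<le> ln (real (card (Phi n)))"
      using less_le_trans[OF _ two, of 0] two by (subst ln_le_cancel_iff) simp_all
    finally have "(real n * ln 2) ^ 4 \<le> ln (real (card (Phi n))) ^ 4" by (intro power_mono) auto
    then have "(real n) ^ 4 \<le> ln (real (card (Phi n))) ^ 4 / ln 2 ^ 4" by (simp add: power_mult_distrib pos_le_divide_eq)
    then have "real A * (real n) ^ 4 * real (card (Phi n)) \<le> real A * (ln (real (card (Phi n))) ^ 4 / ln 2 ^ 4) * real (card (Phi n))"
      by (intro mult_right_mono mult_left_mono) auto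
    from order_trans[OF 1 this] show ?thesis by (simp only: times_divide_eq_left times_divide_eq_right mult.assoc mult.commute mult.left_commute)
  qed
  show ?thesis
  \<comment> \<open>The estimate starts at n = 1; for n = 0 the order is 1 and its logarithm is
    0.\<close>
  proof (rule bigoI[of _ "real A / ln 2 ^ 4"], rule eventually_mono[OF eventually_ge_at_top[of 1]])
    fix n :: nat assume "1 \<le> n"
    from bound[OF this] show "norm (real (C n)) \<le> real A / ln 2 ^ 4 * norm (real (card (Phi n)) * ln (real (card (Phi n))) ^ 4)"
      by (simp add: abs_mult)
  qed
qed

end

theorem theorem6p12:
  fixes G :: "('a, 'b) monoid_scheme"
  assumes "group G" and "finite (carrier G)"
  shows "\<exists>C :: nat \<Rightarrow> nat.
    (\<forall>n. fourier_complexity (rook_wreath G n) = enat (C n)) \<and>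
    (\<lambda>n. real (C n)) \<in>
      O(\<lambda>n. real (card (carrier (rook_wreath G n))) * ln (real (card (carrier (rook_wreath G n)))) ^ 4)"
proof -
  interpret wreath G
    using assms by (simp add: wreath_def fin_group_def fin_group_axioms_def)
  have "\<forall>n. \<exists>m. m \<le> program_cost n \<and> fourier_complexity (rook_wreath G n) = enat m"
    using fourier_complexity_bound by blast
  then obtain C where C: "\<And>n. C n \<le> program_cost n" "\<And>n. fourier_complexity (rook_wreath G n) = enat (C n)"
    by metis
  then show ?thesis
    using program_cost_bigo[OF C(1)] unfolding card_S by blast
qed


end
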